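(* For MAB superprocess with multi-period actions and preemption there is a polynomial-time randomized algorithm whose expected reward is at least $\frac{1}{12}\,\mathrm{OPT}_{\mathrm{PolyLP}}$.
   Context: Model: $n$ arms $i\in[n]$, finite action set $A$ with default action $\alpha\in A$, horizon $B$, $[B]=\{1,\dots,B\}$. Arm $i$: disjoint finite node set $\mathcal{S}_i$ ($\mathcal{S}=\bigcup_i\mathcal{S}_i$), root $\rho_i$, transition probabilities $p^a_{u,v}\ge0$ with $\sum_vp^a_{u,v}=1$, rewards $r^a_u\ge0$; layered acyclic (depth function with $\mathrm{depth}(\rho_i)=0$, $p^a_{u,v}>0\Rightarrow\mathrm{depth}(v)=\mathrm{depth}(u)+1$). A set $\mathcal{B}\subseteq\mathcal{S}$ of bridge nodes (no roots) models multi-period actions: a transition taking $k$ time steps (possibly with random, correlated processing time) is represented by a path through $k-1$ bridge nodes played with action $\alpha$; input size is measured in this expanded representation. $\mathrm{Par}(u)=\{(v,b):p^b_{v,u}>0\}$. Problem (with preemption): arms start at roots; at each step the controller pulls at most one arm with some action $a$; pulling an arm on node $u$ yields $r^a_u$ and moves it to $v$ w.p. $p^a_{u,v}$, observed; other arms stay put and may be resumed later; but if an arm has just moved onto a bridge node, it must be pulled with action $\alpha$ at the next step. Goal: maximize expected total reward over $B$ steps. $(\mathrm{PolyLP})$: maximize $\sum_u\sum_ar^a_u\sum_tx^a_{u,t}$ subject to $\sum_u\sum_ax^a_{u,t}\le1$; $\sum_ax^a_{u,t}\le s_{u,t}$; $x^\alpha_{u,t}=s_{u,t}$ for $u\in\mathcal{B}$;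 $x^a_{u,t}\ge0$; $s_{\rho_i,1}=1$; $s_{u,1}=0$ for non-root $u$; for $t>1$, $s_{u,t}=s_{u,t-1}-\sum_ax^a_{u,t-1}+\sum_{(v,a)\in\mathrm{Par}(u)}x^a_{v,t-1}p^a_{v,u}$. $\mathrm{OPT}_{\mathrm{PolyLP}}$ is its optimal value.
   Formalization: Transition probabilities are required to sum to 1 only at nodes of depth less than B (requiring it at every node of a finite layered acyclic node set is contradictory); rewards and probabilities are rational, as needed for a bit-size polynomial-time claim. *)

theory Defs
  imports
    "HOL-Probability.Probability"
    "HOL-Computational_Algebra.Polynomial"
    "HOL-Library.Log_Nat"
begin

section \<open>Problem instances\<close>

text \<open>
  Algorithms receive an instance as a finite string, so arms, actions and nodes are numbered: the
  arms are \<open>{..<arms I}\<close>, the actions are \<open>{..<actions I}\<close>, and the union of the node sets of all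
  arms is \<open>{..<nodes I}\<close>. The node set of arm \<open>i\<close> consists of the nodes \<open>u\<close> with \<open>arm_of I u = i\<close>;
  in particular these node sets are disjoint. Numerical data are rational. The values of the
  functions below outside these ranges are irrelevant. \<open>rew I u a\<close> is $r^a_u$ and \<open>trans I u a v\<close>
  is $p^a_{u,v}$.
\<close>

record mab =
  arms :: nat
  actions :: nat
  default :: nat
  horizon :: nat
  nodes :: nat
  arm_of :: "nat \<Rightarrow> nat"
  root :: "nat \<Rightarrow> nat"
  bridge :: "nat \<Rightarrow> bool"
  rew :: "nat \<Rightarrow> nat \<Rightarrow> rat"
  trans :: "nat \<Rightarrow> nat \<Rightarrow> nat \<Rightarrow> rat"

text \<open>
  A finite layered acyclic node set cannot have total outgoing probability 1 at \<^emph>\<open>every\<close> node. A node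
  of depth \<open>d\<close> can be pulled in step \<open>d + 1\<close> at the earliest, so the condition is imposed at the depths
  below the horizon, which are the only ones at which a pull can ever take place.
\<close>

definition superprocess :: "mab \<Rightarrow> bool" where
  "superprocess I \<longleftrightarrow>
     0 < arms I \<and> 0 < horizon I \<and> default I < actions I \<and>
     (\<forall>u<nodes I. arm_of I u < arms I) \<and>
     (\<forall>i<arms I. root I i < nodes I \<and> arm_of I (root I i) = i \<and> \<not> bridge I (root I i)) \<and>
     (\<forall>u<nodes I. \<forall>a<actions I. 0 \<le> rew I u a) \<and>
     (\<forall>u<nodes I. \<forall>a<actions I. \<forall>v<nodes I. 0 \<le> trans I u a v) \<and>
     (\<forall>u<nodes I. \<forall>a<actions I. \<forall>v<nodes I. 0 < trans I u a v \<longrightarrow> arm_of I v = arm_of I u) \<and>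
     (\<exists>depth :: nat \<Rightarrow> nat.
        (\<forall>i<arms I. depth (root I i) = 0) \<and>
        (\<forall>u<nodes I. \<forall>a<actions I. \<forall>v<nodes I. 0 < trans I u a v \<longrightarrow> depth v = depth u + 1) \<and>
        (\<forall>u<nodes I. depth u < horizon I \<longrightarrow>
           (\<forall>a<actions I. (\<Sum>v<nodes I. trans I u a v) = 1)))"


section \<open>The linear program\<close>

definition Par :: "mab \<Rightarrow> nat \<Rightarrow> (nat \<times> nat) set" where
  "Par I u = {(v, b). v < nodes I \<and> b < actions I \<and> 0 < trans I v b u}"

definition PolyLP_feasible ::
  "mab \<Rightarrow> (nat \<Rightarrow> nat \<Rightarrow> nat \<Rightarrow> real) \<Rightarrow> (nat \<Rightarrow> nat \<Rightarrow> real) \<Rightarrow> bool" where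
  "PolyLP_feasible I x s \<longleftrightarrow>
     (\<forall>t\<in>{1..horizon I}. (\<Sum>u<nodes I. \<Sum>a<actions I. x u a t) \<le> 1) \<and>
     (\<forall>u<nodes I. \<forall>t\<in>{1..horizon I}. (\<Sum>a<actions I. x u a t) \<le> s u t) \<and>
     (\<forall>u<nodes I. \<forall>t\<in>{1..horizon I}. bridge I u \<longrightarrow> x u (default I) t = s u t) \<and>
     (\<forall>u<nodes I. \<forall>a<actions I. \<forall>t\<in>{1..horizon I}. 0 \<le> x u a t) \<and>
     (\<forall>u<nodes I. s u 1 = (if u \<in> root I ` {..<arms I} then 1 else 0)) \<and>
     (\<forall>u<nodes I. \<forall>t\<in>{2..horizon I}.
        s u t = s u (t - 1) - (\<Sum>a<actions I. x u a (t - 1))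
                + (\<Sum>(v, a)\<in>Par I u. x v a (t - 1) * of_rat (trans I v a u)))"

definition PolyLP_objective :: "mab \<Rightarrow> (nat \<Rightarrow> nat \<Rightarrow> nat \<Rightarrow> real) \<Rightarrow> real" where
  "PolyLP_objective I x =
     (\<Sum>u<nodes I. \<Sum>a<actions I. of_rat (rew I u a) * (\<Sum>t\<in>{1..horizon I}. x u a t))"

definition OPT_PolyLP :: "mab \<Rightarrow> real" where
  "OPT_PolyLP I = Sup {PolyLP_objective I x | x s. PolyLP_feasible I x s}"


section \<open>Randomized algorithms\<close>

text \<open>
  The model of computation is a random access machine under the logarithmic cost criterion, with a
  fixed structured program, integer memory cells and indirect addressing. Every node of an evaluated
  expression is charged the bit length of its value, so running time is polynomially related to
  running time on a Turing machine.

  The program acts as the controller: it interacts with the arms through \<open>Pull\<close> and \<open>Idle\<close>, each of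
  which consumes one of the time steps of the horizon, and its memory persists between time
  steps. Its running time is the total time spent on all decisions and on any preprocessing.
\<close>

datatype exp =
    Const int
  | Mem exp
  | Add exp exp
  | Sub exp exp
  | Mul exp exp
  | Div exp exp

text \<open>
  \<open>If\<close> and \<open>While\<close> test whether the expression is positive. \<open>Random x k\<close> stores a uniformly distributed
  element of \<open>{0..<k}\<close> in cell \<open>x\<close>. \<open>Pull i a x\<close> pulls arm \<open>i\<close> with action \<open>a\<close> and stores the observed
  new node of the arm in cell \<open>x\<close>. \<open>Idle\<close> lets a time step pass without pulling an arm.
\<close>

datatype com =
    Skip
  | Assign exp exp
  | Seq com com
  | If exp com com
  | While exp com
  | Random exp exp
  | Pull exp exp exp
  | Idle

definition bits :: "int \<Rightarrow> nat" where
  "bits z = 1 + floorlog 2 (nat \<bar>z\<bar>)"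

primrec val :: "(nat \<Rightarrow> int) \<Rightarrow> exp \<Rightarrow> int" where
  "val m (Const c) = c"
| "val m (Mem e) = m (nat (val m e))"
| "val m (Add e f) = val m e + val m f"
| "val m (Sub e f) = val m e - val m f"
| "val m (Mul e f) = val m e * val m f"
| "val m (Div e f) = val m e div val m f"

primrec exp_cost :: "(nat \<Rightarrow> int) \<Rightarrow> exp \<Rightarrow> nat" where
  "exp_cost m (Const c) = bits (val m (Const c))"
| "exp_cost m (Mem e) = bits (val m (Mem e)) + exp_cost m e"
| "exp_cost m (Add e f) = bits (val m (Add e f)) + exp_cost m e + exp_cost m f"
| "exp_cost m (Sub e f) = bits (val m (Sub e f)) + exp_cost m e + exp_cost m f"
| "exp_cost m (Mul e f) = bits (val m (Mul e f)) + exp_cost m e + exp_cost m f"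
| "exp_cost m (Div e f) = bits (val m (Div e f)) + exp_cost m e + exp_cost m f"

text \<open>
  Besides the machine's memory and the running time spent so far, a configuration contains the state
  of the environment, which the program cannot inspect directly: the number of time steps that have
  passed, the current node of every arm, and the reward collected.
\<close>

record config =
  mem :: "nat \<Rightarrow> int"
  cost :: nat
  elapsed :: nat
  node :: "nat \<Rightarrow> nat"
  reward :: real

definition charge :: "exp list \<Rightarrow> config \<Rightarrow> config" where
  "charge es c = c\<lparr>cost := cost c + 1 + (\<Sum>e\<leftarrow>es. exp_cost (mem c) e)\<rparr>"

definition store :: "exp \<Rightarrow> int \<Rightarrow> config \<Rightarrow> config" where
  "store e z c = c\<lparr>mem := (mem c)(nat (val (mem c) e) := z), cost := cost c + bits z\<rparr>"

text \<open>
  An arm standing on a bridge node has just moved there, because no step other than pulling that arm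
  with the default action is then legal.
\<close>

definition legal_pull :: "mab \<Rightarrow> config \<Rightarrow> nat \<Rightarrow> nat \<Rightarrow> bool" where
  "legal_pull I c i a \<longleftrightarrow>
     elapsed c < horizon I \<and> i < arms I \<and> a < actions I \<and>
     (\<forall>j<arms I. bridge I (node c j) \<longrightarrow> i = j \<and> a = default I)"

definition legal_idle :: "mab \<Rightarrow> config \<Rightarrow> bool" where
  "legal_idle I c \<longleftrightarrow> elapsed c < horizon I \<and> (\<forall>j<arms I. \<not> bridge I (node c j))"

definition next_node :: "mab \<Rightarrow> nat \<Rightarrow> nat \<Rightarrow> nat pmf" where
  "next_node I u a = embed_pmf (\<lambda>v. if v < nodes I then of_rat (trans I u a v) else 0)"

definition advance :: "mab \<Rightarrow> nat \<Rightarrow> nat \<Rightarrow> nat \<Rightarrow> config \<Rightarrow> config" where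
  "advance I i a v c = c\<lparr>elapsed := elapsed c + 1, node := (node c)(i := v),
     reward := reward c + of_rat (rew I (node c i) a)\<rparr>"

partial_function (spmf) while_spmf ::
  "('s \<Rightarrow> bool) \<Rightarrow> ('s \<Rightarrow> 's spmf) \<Rightarrow> 's \<Rightarrow> 's spmf" where
  "while_spmf b f s = (if b s then bind_spmf (f s) (while_spmf b f) else return_spmf s)"

text \<open>
  The result is a subprobability distribution; the missing mass is the probability that the program
  does not terminate or attempts something illegal. \<^const>\<open>spmf_of_set\<close> of the empty set has mass 0.
\<close>

primrec exec :: "mab \<Rightarrow> com \<Rightarrow> config \<Rightarrow> config spmf" where
  "exec I Skip = return_spmf"
| "exec I (Assign x e) = (\<lambda>c. return_spmf (store x (val (mem c) e) (charge [x, e] c)))"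
| "exec I (Seq P Q) = (\<lambda>c. bind_spmf (exec I P c) (exec I Q))"
| "exec I (If e P Q) =
     (\<lambda>c. if 0 < val (mem c) e then exec I P (charge [e] c) else exec I Q (charge [e] c))"
| "exec I (While e P) =
     (\<lambda>c. map_spmf (charge [e])
        (while_spmf (\<lambda>c. 0 < val (mem c) e) (\<lambda>c. exec I P (charge [e] c)) c))"
| "exec I (Random x k) =
     (\<lambda>c. map_spmf (\<lambda>z. store x z (charge [x, k] c)) (spmf_of_set {0..<val (mem c) k}))"
| "exec I (Pull i a x) =
     (\<lambda>c. let i' = nat (val (mem c) i); a' = nat (val (mem c) a) in
        if legal_pull I c i' a'
        then map_spmf (\<lambda>v. advance I i' a' v (store x (int v) (charge [i, a, x] c)))
               (spmf_of_pmf (next_node I (node c i') a'))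
        else return_pmf None)"
| "exec I Idle =
     (\<lambda>c. if legal_idle I c then return_spmf ((charge [] c)\<lparr>elapsed := elapsed c + 1\<rparr>)
        else return_pmf None)"


section \<open>Input encoding and polynomial time\<close>

definition encode_rat :: "rat \<Rightarrow> int list" where
  "encode_rat q = [fst (quotient_of q), snd (quotient_of q)]"

definition encode :: "mab \<Rightarrow> int list" where
  "encode I =
     [int (arms I), int (actions I), int (default I), int (horizon I), int (nodes I)] @
     map (\<lambda>u. int (arm_of I u)) [0..<nodes I] @
     map (\<lambda>i. int (root I i)) [0..<arms I] @
     map (\<lambda>u. of_bool (bridge I u)) [0..<nodes I] @
     concat [encode_rat (rew I u a). u \<leftarrow> [0..<nodes I], a \<leftarrow> [0..<actions I]] @
     concat [encode_rat (trans I u a v).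
               u \<leftarrow> [0..<nodes I], a \<leftarrow> [0..<actions I], v \<leftarrow> [0..<nodes I]]"

definition input_size :: "mab \<Rightarrow> nat" where
  "input_size I = (\<Sum>z\<leftarrow>encode I. bits z)"

definition initial :: "mab \<Rightarrow> config" where
  "initial I =
     \<lparr>mem = (\<lambda>k. if k < length (encode I) then encode I ! k else 0),
      cost = 0, elapsed = 0, node = root I, reward = 0\<rparr>"

definition run :: "mab \<Rightarrow> com \<Rightarrow> config spmf" where
  "run I P = exec I P (initial I)"

text \<open>
  On every instance the program has to make a legal decision for each time step and to terminate, and
  the bound on its running time is worst-case, over all random choices and all transitions.
\<close>

definition polynomial_time_algorithm :: "com \<Rightarrow> bool" where
  "polynomial_time_algorithm P \<longleftrightarrow>
     (\<exists>q :: nat poly. \<forall>I. superprocess I \<longrightarrow>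
        lossless_spmf (run I P) \<and>
        (\<forall>c\<in>set_spmf (run I P).
           elapsed c = horizon I \<and> cost c \<le> poly q (input_size I)))"

definition expected_reward :: "mab \<Rightarrow> com \<Rightarrow> real" where
  "expected_reward I P = (\<integral>c. reward c \<partial>measure_spmf (run I P))"

end

theory Submission
  imports Defs
begin

text \<open>
  Subgradient descent on the prices of the time steps, carried out in exact integer arithmetic,
  yields deterministic policies of the single arms whose uniform mixture is a nearly optimal
  solution of $(\mathrm{PolyLP})$: the expected number of pulls per time step is at most $1 +
  1/(4B)$ and the reward at least $1 - 1/(4B)$ times the optimum. The dual value at every price
  vector is also at least the unpriced optimum divided by the number of arms, so polynomially many
  steps suffice.

  For the rounding, every arm takes part with probability $1/6$, with a random policy of the
  mixture, and follows it in a time of its own. A pull at own time \<open>t\<close> gets the key \<open>t\<close> if the arm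
  has been pulled at most \<open>t / 2\<close> times before, and otherwise or on a bridge node the key of its
  previous pull; the arm with the smallest key is pulled next. A pull with key \<open>k\<close> comes too late
  only if at own time \<open>k\<close> the other arms have at least \<open>k / 2\<close> pulls behind them or one of them is
  about to run through bridge nodes. Markov's inequality bounds the probability by \<open>(1 + 1 / (4 *
  B)) * (3 - 2 / k) / 6\<close>; that a pull at own time \<open>k\<close> itself is counted only once (the term \<open>- 2 /
  k\<close>) pays for the error of the approximate solution. The bound is linear in the trajectories of
  the other arms, so that it can be used as a potential for partial runs.
\<close>

section \<open>A program logic for expected values and running time\<close>

text \<open>Dualizing the constraint of one pull per time step decouples the arms, and the priced
  problem of a single arm is a dynamic program. Every dual value bounds \<open>OPT_PolyLP I\<close>
  from above, and the averaged policies are compared with a lower bound \<open>L\<close> of all dual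
  values met. The errors of the subgradient method are additive and proportional to the unpriced
  optimum \<open>R0\<close>; they become relative errors because \<open>L\<close> is at least
  \<open>R0 / n\<close>. The constant is 1/6 for taking part times 1/2 for being in time: the
  weights belonging to one key sum to just under 3, and p = 1/6 maximizes p (1 - 3 p). Instead of a
  joint distribution of trajectories, the analysis tracks collected reward plus potential, which
  does not fall in expectation. The potential is affine in the data of each arm separately, so
  independence of the arms is used one draw or one transition at a time. The horizon is written in
  binary; loops over it are polynomial because layering forces \<open>B < N\<close>.\<close>

primrec val_bits :: "nat \<Rightarrow> exp \<Rightarrow> nat" where
  "val_bits W (Const c) = nat \<bar>c\<bar>"
| "val_bits W (Mem e) = W"
| "val_bits W (Add e f) = val_bits W e + val_bits W f + 1"
| "val_bits W (Sub e f) = val_bits W e + val_bits W f + 1"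
| "val_bits W (Mul e f) = val_bits W e + val_bits W f + 1"
| "val_bits W (Div e f) = val_bits W e + val_bits W f + 1"

primrec cost_bound :: "nat \<Rightarrow> exp \<Rightarrow> nat" where
  "cost_bound W (Const c) = 1 + val_bits W (Const c)"
| "cost_bound W (Mem e) = 1 + val_bits W (Mem e) + cost_bound W e"
| "cost_bound W (Add e f) = 1 + val_bits W (Add e f) + cost_bound W e + cost_bound W f"
| "cost_bound W (Sub e f) = 1 + val_bits W (Sub e f) + cost_bound W e + cost_bound W f"
| "cost_bound W (Mul e f) = 1 + val_bits W (Mul e f) + cost_bound W e + cost_bound W f"
| "cost_bound W (Div e f) = 1 + val_bits W (Div e f) + cost_bound W e + cost_bound W f"

text \<open>\<open>W\<close> bounds the bit length of every memory cell and \<open>Z\<close> the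
  number of iterations of every single execution of a loop. A branch is charged for both
  alternatives, so the bound depends on the program text and on \<open>W\<close> and
  \<open>Z\<close> alone.\<close>

primrec time_bound :: "nat \<Rightarrow> nat \<Rightarrow> com \<Rightarrow> nat" where
  "time_bound W Z Skip = 0"
| "time_bound W Z (Assign x e) = 2 + W + cost_bound W x + cost_bound W e"
| "time_bound W Z (Seq P Q) = time_bound W Z P + time_bound W Z Q"
| "time_bound W Z (If e P Q) = 1 + cost_bound W e + time_bound W Z P + time_bound W Z Q"
| "time_bound W Z (While e P) =
     Z * (1 + cost_bound W e + time_bound W Z P) + 1 + cost_bound W e"
| "time_bound W Z (Random x k) = 2 + W + cost_bound W x + cost_bound W k"
| "time_bound W Z (Pull i a x) = 2 + W + cost_bound W i + cost_bound W a + cost_bound W x"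
| "time_bound W Z Idle = 1"

section \<open>Bit lengths of the values of expressions\<close>

lemma bits_le: "\<bar>z\<bar> < 2 ^ W \<Longrightarrow> bits z \<le> 1 + W"
  unfolding bits_def by (auto intro!: floorlog_leI simp: nat_less_iff)

lemma abs_less_power_bits: "\<bar>z\<bar> < 2 ^ bits z"
proof -
  have "nat \<bar>z\<bar> < 2 ^ floorlog 2 (nat \<bar>z\<bar>)"
    by (rule floorlog_leD) auto
  then have "\<bar>z\<bar> < 2 ^ floorlog 2 (nat \<bar>z\<bar>)"
    by (simp add: nat_less_iff)
  also have "\<dots> \<le> 2 ^ bits z"
    unfolding bits_def by (intro power_increasing) auto
  finally show ?thesis .
qed

lemma abs_div_le: "\<bar>a div b\<bar> \<le> \<bar>a\<bar>" for a b :: int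
proof -
  have nonneg: "\<bar>x div c\<bar> \<le> \<bar>x\<bar>" if "0 < c" for x c :: int
  proof (cases "0 \<le> x")
    case True
    have "x div c \<le> x div 1" using True that by (intro zdiv_mono2) auto
    moreover have "0 \<le> x div c" using True that by (simp add: pos_imp_zdiv_nonneg_iff)
    ultimately show ?thesis using True by simp
  next
    case False
    have "x div 1 \<le> x div c" using False that by (intro zdiv_mono2_neg) auto
    moreover have "x div c < 0" using False that by (simp add: pos_imp_zdiv_neg_iff)
    ultimately show ?thesis using False by simp
  qed
  consider "0 < b" | "b = 0" | "0 < - b" by linarith
  then show ?thesis
    by cases (use nonneg[of b a] nonneg[of "- b" "- a"] in auto)
qed

lemma abs_val_less:
  assumes "\<And>k. \<bar>m k\<bar> < 2 ^ W"
  shows "\<bar>val m e\<bar> < 2 ^ val_bits W e"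
proof (induction e)
  case (Const c)
  have "nat \<bar>c\<bar> < 2 ^ nat \<bar>c\<bar>" by (rule less_exp)
  then have "int (nat \<bar>c\<bar>) < int (2 ^ nat \<bar>c\<bar>)" by (simp only: of_nat_less_iff)
  then show ?case by simp
next
  case (Add e f)
  have "\<bar>val m e + val m f\<bar> < 2 ^ val_bits W e + 2 ^ val_bits W f"
    using Add by linarith
  also have "\<dots> \<le> 2 ^ (val_bits W e + val_bits W f) + (2::int) ^ (val_bits W e + val_bits W f)"
    by (intro add_mono power_increasing) auto
  finally show ?case by (simp add: power_add)
next
  case (Sub e f)
  have "\<bar>val m e - val m f\<bar> < 2 ^ val_bits W e + 2 ^ val_bits W f"
    using Sub by linarith
  also have "\<dots> \<le> 2 ^ (val_bits W e + val_bits W f) + (2::int) ^ (val_bits W e + val_bits W f)"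
    by (intro add_mono power_increasing) auto
  finally show ?case by (simp add: power_add)
next
  case (Mul e f)
  have "\<bar>val m e * val m f\<bar> < 2 ^ val_bits W e * 2 ^ val_bits W f"
    unfolding abs_mult using Mul by (intro mult_strict_mono) auto
  also have "\<dots> \<le> 2 ^ (val_bits W e + val_bits W f + 1)" by (simp add: power_add)
  finally show ?case by simp
next
  case (Div e f)
  have "\<bar>val m e div val m f\<bar> < 2 ^ val_bits W e"
    using Div(1) abs_div_le[of "val m e" "val m f"] by linarith
  also have "\<dots> \<le> 2 ^ (val_bits W e + val_bits W f + 1)" by (intro power_increasing) auto
  finally show ?case by simp
qed (use assms in auto)

lemma exp_cost_le:
  assumes "\<And>k. \<bar>m k\<bar> < 2 ^ W"
  shows "exp_cost m e \<le> cost_bound W e"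
proof (induction e)
  case (Const c)
  then show ?case using bits_le[OF abs_val_less[of m W "Const c", OF assms]] by simp
next
  case (Mem e)
  then show ?case using bits_le[OF abs_val_less[of m W "Mem e", OF assms]] by simp
next
  case (Add e f)
  then show ?case using bits_le[OF abs_val_less[of m W "Add e f", OF assms]] by simp
next
  case (Sub e f)
  then show ?case using bits_le[OF abs_val_less[of m W "Sub e f", OF assms]] by simp
next
  case (Mul e f)
  then show ?case using bits_le[OF abs_val_less[of m W "Mul e f", OF assms]] by simp
next
  case (Div e f)
  then show ?case using bits_le[OF abs_val_less[of m W "Div e f", OF assms]] by simp
qed

text \<open>One variable \<open>X\<close> above both arguments replaces polynomials in two
  variables. Sums and products of such bounds are again bounds by multiplying and adding the
  polynomials.\<close>

definition poly_bounded :: "(nat \<Rightarrow> nat \<Rightarrow> nat) \<Rightarrow> bool" where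
  "poly_bounded f \<longleftrightarrow> (\<exists>q :: nat poly. \<forall>W Z X. W \<le> X \<longrightarrow> Z \<le> X \<longrightarrow> f W Z \<le> poly q X)"

named_theorems poly_bounded

lemma poly_bounded_const [poly_bounded]: "poly_bounded (\<lambda>W Z. k)"
  unfolding poly_bounded_def by (intro exI[of _ "[:k:]"]) simp

lemma poly_bounded_fst [poly_bounded]: "poly_bounded (\<lambda>W Z. W)"
  and poly_bounded_snd [poly_bounded]: "poly_bounded (\<lambda>W Z. Z)"
  unfolding poly_bounded_def by (intro exI[of _ "[:0, 1:]"]; simp)+

lemma poly_bounded_add [poly_bounded]:
  "poly_bounded f \<Longrightarrow> poly_bounded g \<Longrightarrow> poly_bounded (\<lambda>W Z. f W Z + g W Z)"
  unfolding poly_bounded_def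
  by (elim exE, rule_tac x = "q + qa" in exI) (auto intro: add_mono)

lemma poly_bounded_mult [poly_bounded]:
  "poly_bounded f \<Longrightarrow> poly_bounded g \<Longrightarrow> poly_bounded (\<lambda>W Z. f W Z * g W Z)"
  unfolding poly_bounded_def
  by (elim exE, rule_tac x = "q * qa" in exI) (auto intro: mult_mono)

lemma poly_bounded_val_bits [poly_bounded]: "poly_bounded (\<lambda>W Z. val_bits W e)"
  by (induction e) (simp_all only: val_bits.simps, (intro poly_bounded; assumption)+)

lemma poly_bounded_cost_bound [poly_bounded]: "poly_bounded (\<lambda>W Z. cost_bound W e)"
  by (induction e) (simp_all only: cost_bound.simps, (intro poly_bounded; assumption)+)

lemma poly_bounded_time_bound: "poly_bounded (\<lambda>W Z. time_bound W Z P)"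
  by (induction P) (simp_all only: time_bound.simps, (intro poly_bounded; assumption)+)

section \<open>Outcomes of runs and weakest preconditions\<close>

definition mk :: "(nat \<Rightarrow> int) \<Rightarrow> nat \<Rightarrow> nat \<times> (nat \<Rightarrow> nat) \<times> real \<Rightarrow> config" where
  "mk m k e = \<lparr>mem = m, cost = k, elapsed = fst e, node = fst (snd e), reward = snd (snd e)\<rparr>"

text \<open>The input region keeps its contents throughout, because the rules below permit writes
  only to addresses behind it.\<close>

definition ok :: "mab \<Rightarrow> nat \<Rightarrow> (nat \<Rightarrow> int) \<Rightarrow> bool" where
  "ok I W m \<longleftrightarrow> (\<forall>k. \<bar>m k\<bar> < 2 ^ W) \<and> (\<forall>k < length (encode I). m k = encode I ! k)"

type_synonym env = "nat \<times> (nat \<Rightarrow> nat) \<times> real"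

text \<open>
  The labels \<open>x\<close> carry lower bounds for expected rewards. They are not functions of the outcome
  because they are computed from data which the program does not store.
\<close>

definition outcome :: "mab \<Rightarrow> nat \<Rightarrow> nat \<Rightarrow> ((nat \<Rightarrow> int) \<Rightarrow> env \<Rightarrow> real \<Rightarrow> bool) \<Rightarrow> real \<Rightarrow>
    config spmf \<Rightarrow> bool" where
  "outcome I W k Q b M \<longleftrightarrow> (\<exists>p :: (config \<times> real) pmf.
     M = spmf_of_pmf (map_pmf fst p) \<and> finite (set_pmf p) \<and>
     (\<forall>c x. (c, x) \<in> set_pmf p \<longrightarrow> (\<exists>m' k' e'. c = mk m' k' e' \<and> k' \<le> k \<and> ok I W m' \<and> Q m' e' x)) \<and>
     b \<le> measure_pmf.expectation p snd)"

text \<open>The initial cost \<open>k\<close> is universally quantified so that costs add up along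
  sequences. \<open>ok\<close> is assumed here and is part of \<open>outcome\<close>, so loop
  invariants need not repeat it. \<open>b\<close> is the expectation which the labels of the final
  states have to reach.\<close>

definition wp :: "mab \<Rightarrow> nat \<Rightarrow> nat \<Rightarrow> com \<Rightarrow> (nat \<Rightarrow> int) \<Rightarrow> env \<Rightarrow>
    ((nat \<Rightarrow> int) \<Rightarrow> env \<Rightarrow> real \<Rightarrow> bool) \<Rightarrow> real \<Rightarrow> bool" where
  "wp I W Z P m e Q b \<longleftrightarrow>
     (ok I W m \<longrightarrow> (\<forall>k. outcome I W (k + time_bound W Z P) Q b (exec I P (mk m k e))))"

lemma wp_ok: "(ok I W m \<Longrightarrow> wp I W Z P m e Q b) \<Longrightarrow> wp I W Z P m e Q b"
  unfolding wp_def by blast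

lemma outcome_mono:
  assumes "outcome I W k Q b M" "\<And>m' e' x. ok I W m' \<Longrightarrow> Q m' e' x \<Longrightarrow> R m' e' x" "k \<le> k'" "b' \<le> b"
  shows "outcome I W k' R b' M"
proof -
  from assms(1) obtain p where p: "M = spmf_of_pmf (map_pmf fst p)" "finite (set_pmf p)"
      "b \<le> measure_pmf.expectation p snd"
    and Q: "\<And>c x. (c, x) \<in> set_pmf p \<Longrightarrow> \<exists>m' k' e'. c = mk m' k' e' \<and> k' \<le> k \<and> ok I W m' \<and> Q m' e' x"
    unfolding outcome_def by blast
  have "\<exists>m' k'' e'. c = mk m' k'' e' \<and> k'' \<le> k' \<and> ok I W m' \<and> R m' e' x" if "(c, x) \<in> set_pmf p"
      for c x
    using Q[OF that] assms(2) order_trans[OF _ assms(3)] by blast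
  then show ?thesis unfolding outcome_def using p assms(4) by (intro exI[of _ p]) auto
qed

lemma wp_mono:
  assumes "wp I W Z P m e Q b" "\<And>m' e' x. ok I W m' \<Longrightarrow> Q m' e' x \<Longrightarrow> R m' e' x" "b' \<le> b"
  shows "wp I W Z P m e R b'"
  using assms(1) unfolding wp_def by (auto intro: outcome_mono[OF _ assms(2) _ assms(3)])

lemma outcome_return:
  assumes "k' \<le> k" "ok I W m" "Q m e b"
  shows "outcome I W k Q b (return_spmf (mk m k' e))"
  unfolding outcome_def
proof (intro exI[of _ "return_pmf (mk m k' e, b)"] conjI allI impI)
  fix c x assume "(c, x) \<in> set_pmf (return_pmf (mk m k' e, b))"
  then have "c = mk m k' e" "x = b" by simp_all
  then show "\<exists>m' k' e'. c = mk m' k' e' \<and> k' \<le> k \<and> ok I W m' \<and> Q m' e' x"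
    using assms by blast
qed simp_all

text \<open>The tower property: the label of an intermediate state is the bound demanded of the
  continuation started there, so averaging over the continuations can only raise the total. Finite
  supports turn all expectations into finite sums.\<close>

lemma outcome_bind:
  assumes M: "outcome I W k R b M"
    and f: "\<And>m' k' e' x. R m' e' x \<Longrightarrow> ok I W m' \<Longrightarrow> k' \<le> k \<Longrightarrow> outcome I W l Q x (f (mk m' k' e'))"
  shows "outcome I W l Q b (bind_spmf M f)"
proof -
  from M obtain p where p: "M = spmf_of_pmf (map_pmf fst p)" "finite (set_pmf p)"
      "b \<le> measure_pmf.expectation p snd"
    and R: "\<And>c x. (c, x) \<in> set_pmf p \<Longrightarrow> \<exists>m' k' e'. c = mk m' k' e' \<and> k' \<le> k \<and> ok I W m' \<and> R m' e' x"
    unfolding outcome_def by blast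
  have "outcome I W l Q (snd cx) (f (fst cx))" if "cx \<in> set_pmf p" for cx
    using R[of "fst cx" "snd cx"] that f by auto
  \<comment> \<open>The continuation is chosen per labelled state: equal configurations with
    different labels may be continued by different labelled distributions.\<close>
  then obtain g :: "config \<times> real \<Rightarrow> (config \<times> real) pmf" where
    g: "\<And>cx. cx \<in> set_pmf p \<Longrightarrow> f (fst cx) = spmf_of_pmf (map_pmf fst (g cx))"
      "\<And>cx. cx \<in> set_pmf p \<Longrightarrow> finite (set_pmf (g cx))"
      "\<And>cx. cx \<in> set_pmf p \<Longrightarrow> snd cx \<le> measure_pmf.expectation (g cx) snd"
    and Q: "\<And>cx c x. cx \<in> set_pmf p \<Longrightarrow> (c, x) \<in> set_pmf (g cx) \<Longrightarrow>
      \<exists>m' k' e'. c = mk m' k' e' \<and> k' \<le> l \<and> ok I W m' \<and> Q m' e' x"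
    unfolding outcome_def by metis
  have "bind_spmf M f = bind_pmf p (\<lambda>cx. f (fst cx))"
    by (simp add: p(1) bind_map_pmf)
  also have "\<dots> = bind_pmf p (\<lambda>cx. spmf_of_pmf (map_pmf fst (g cx)))"
    by (rule bind_pmf_cong) (use g in auto)
  also have "\<dots> = spmf_of_pmf (map_pmf fst (bind_pmf p g))"
    by (simp add: spmf_of_pmf_bind map_bind_pmf)
  finally have 1: "bind_spmf M f = spmf_of_pmf (map_pmf fst (bind_pmf p g))" .
  have "measure_pmf.expectation p snd = (\<Sum>a\<in>set_pmf p. pmf p a * snd a)"
    by (subst integral_measure_pmf_real[OF p(2)]) (auto simp: mult.commute)
  also have "\<dots> \<le> (\<Sum>a\<in>set_pmf p. pmf p a * measure_pmf.expectation (g a) snd)"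
    using g by (intro sum_mono mult_left_mono) auto
  also have "\<dots> = measure_pmf.expectation (bind_pmf p g) snd"
    by (subst pmf_expectation_bind[OF p(2)]) (use g in auto)
  finally have 2: "b \<le> measure_pmf.expectation (bind_pmf p g) snd" using p(3) by simp
  have "\<exists>m' k' e'. c = mk m' k' e' \<and> k' \<le> l \<and> ok I W m' \<and> Q m' e' x"
    if "(c, x) \<in> set_pmf (bind_pmf p g)" for c x
    using that Q by (simp only: set_bind_pmf) (elim UN_E)
  then show ?thesis unfolding outcome_def
    by (intro exI[of _ "bind_pmf p g"]) (use 1 2 g(2) p(2) in auto)
qed

section \<open>Rules for the commands of the machine\<close>

lemma wp_Skip: "Q m e b \<Longrightarrow> wp I W Z Skip m e Q b"
  by (simp add: wp_def outcome_return)

lemma ok_upd: "ok I W m \<Longrightarrow> \<bar>z\<bar> < 2 ^ W \<Longrightarrow> length (encode I) \<le> a \<Longrightarrow> ok I W (m(a := z))"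
  by (auto simp: ok_def)

lemma exp_cost_ok: "ok I W m \<Longrightarrow> exp_cost m e \<le> cost_bound W e"
  by (rule exp_cost_le) (simp add: ok_def)

lemma charge_mk: "charge es (mk m k e) = mk m (k + 1 + (\<Sum>e\<leftarrow>es. exp_cost m e)) e"
  by (simp add: charge_def mk_def)

lemma store_mk: "store x z (mk m k e) = mk (m(nat (val m x) := z)) (k + bits z) e"
  by (simp add: store_def mk_def)

lemma mem_mk [simp]: "mem (mk m k e) = m"
  and elapsed_mk [simp]: "elapsed (mk m k e) = fst e"
  and node_mk [simp]: "node (mk m k e) = fst (snd e)"
  and reward_mk [simp]: "reward (mk m k e) = snd (snd e)"
  and cost_mk [simp]: "cost (mk m k e) = k"
  by (simp_all add: mk_def)

lemma wp_Assign:
  assumes "ok I W m \<Longrightarrow> length (encode I) \<le> nat (val m x) \<and> \<bar>val m f\<bar> < 2 ^ W \<and>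
    Q (m(nat (val m x) := val m f)) e b"
  shows "wp I W Z (Assign x f) m e Q b"
  unfolding wp_def
proof (intro impI allI)
  fix k assume ok: "ok I W m"
  show "outcome I W (k + time_bound W Z (Assign x f)) Q b (exec I (Assign x f) (mk m k e))"
    using assms[OF ok] exp_cost_ok[OF ok, of x] exp_cost_ok[OF ok, of f] bits_le[of "val m f" W]
    by (simp add: charge_mk store_mk) (intro outcome_return ok_upd[OF ok]; simp)
qed

lemma wp_Seq:
  assumes "wp I W Z P m e (\<lambda>m' e' x. wp I W Z P' m' e' Q x) b"
  shows "wp I W Z (Seq P P') m e Q b"
  unfolding wp_def exec.simps
proof (intro impI allI)
  fix k assume ok: "ok I W m"
  show "outcome I W (k + time_bound W Z (Seq P P')) Q b (bind_spmf (exec I P (mk m k e))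
      (exec I P'))"
  proof (rule outcome_bind)
    show "outcome I W (k + time_bound W Z P) (\<lambda>m' e' x. wp I W Z P' m' e' Q x)
        b (exec I P (mk m k e))"
      using assms ok unfolding wp_def[of _ _ _ P] by blast
  next
    fix m' k' e' x assume "wp I W Z P' m' e' Q x" "ok I W m'" "k' \<le> k + time_bound W Z P"
    then show "outcome I W (k + time_bound W Z (Seq P P')) Q x (exec I P' (mk m' k' e'))"
      unfolding wp_def by (auto intro: outcome_mono)
  qed
qed

lemma wp_If:
  assumes "ok I W m \<Longrightarrow> 0 < val m f \<Longrightarrow> wp I W Z P m e Q b"
    "ok I W m \<Longrightarrow> \<not> 0 < val m f \<Longrightarrow> wp I W Z P' m e Q b"
  shows "wp I W Z (If f P P') m e Q b"
  unfolding wp_def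
proof (intro impI allI)
  fix k assume ok: "ok I W m"
  show "outcome I W (k + time_bound W Z (If f P P')) Q b (exec I (If f P P') (mk m k e))"
  proof (cases "0 < val m f")
    case True
    then have "outcome I W (k + 1 + exp_cost m f + time_bound W Z P) Q b
        (exec I P (mk m (k + 1 + exp_cost m f) e))"
      using assms(1)[OF ok True] ok unfolding wp_def by blast
    from outcome_mono[OF this] show ?thesis
      using True exp_cost_ok[OF ok, of f] by (simp add: charge_mk)
  next
    case False
    then have "outcome I W (k + 1 + exp_cost m f + time_bound W Z P') Q b
        (exec I P' (mk m (k + 1 + exp_cost m f) e))"
      using assms(2)[OF ok False] ok unfolding wp_def by blast
    from outcome_mono[OF this] show ?thesis
      using False exp_cost_ok[OF ok, of f] by (simp add: charge_mk)
  qed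
qed

text \<open>The invariant is indexed by a countdown that drops in every iteration on every random
  branch. Induction on it unrolls the fixed point and charges one test and one body per unit, so
  termination and the worst-case time bound come out together.\<close>

lemma wp_While:
  assumes "Inv n m e b" "n \<le> Z"
    and step: "\<And>n m e x. ok I W m \<Longrightarrow> Inv n m e x \<Longrightarrow> 0 < val m f \<Longrightarrow>
      \<exists>n'. n = Suc n' \<and> wp I W Z P m e (Inv n') x"
    and exit: "\<And>n m e x. ok I W m \<Longrightarrow> Inv n m e x \<Longrightarrow> \<not> 0 < val m f \<Longrightarrow> Q m e x"
  shows "wp I W Z (While f P) m e Q b"
proof -
  define T where "T = 1 + cost_bound W f + time_bound W Z P"
  define loop where "loop = while_spmf (\<lambda>c. 0 < val (mem c) f) (\<lambda>c. exec I P (charge [f] c))"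
  have loop: "loop c = (if 0 < val (mem c) f then bind_spmf (exec I P (charge [f] c)) loop
      else return_spmf c)" for c
    unfolding loop_def by (rule while_spmf.simps)
  have *: "outcome I W (k + n * T) (\<lambda>m e x. \<exists>n. Inv n m e x \<and> \<not> 0 < val m f) b (loop (mk m k e))"
    if "Inv n m e b" "ok I W m" for n m e b k
    using that
  proof (induction n arbitrary: m e b k rule: less_induct)
    case (less n)
    show ?case
    proof (cases "0 < val m f")
      case True
      from step[OF less.prems(2,1) True] obtain n' where n': "n = Suc n'"
        "wp I W Z P m e (Inv n') b" by blast
      have 1: "loop (mk m k e) = bind_spmf (exec I P (mk m (k + 1 + exp_cost m f) e)) loop"
        using True by (subst loop) (simp add: charge_mk)
      show ?thesis unfolding 1
      proof (rule outcome_bind)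
        show "outcome I W (k + 1 + exp_cost m f + time_bound W Z P) (Inv n') b
            (exec I P (mk m (k + 1 + exp_cost m f) e))"
          using n'(2) less.prems(2) unfolding wp_def by blast
      next
        fix m' k' e' x
        assume a: "Inv n' m' e' x" "ok I W m'" "k' \<le> k + 1 + exp_cost m f + time_bound W Z P"
        have "k' + n' * T \<le> k + n * T"
          using a(3) exp_cost_ok[OF less.prems(2), of f] by (simp add: n'(1) T_def)
        then show "outcome I W (k + n * T) (\<lambda>m e x. \<exists>n. Inv n m e x \<and> \<not> 0 < val m f) x
            (loop (mk m' k' e'))"
          using outcome_mono[OF less.IH[OF _ a(1,2), of k']] n'(1) by simp
      qed
    next
      case False
      then show ?thesis using less.prems
        by (subst loop) (auto intro!: outcome_return)
    qed
  qed
  show ?thesis unfolding wp_def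
  proof (intro impI allI)
    fix k assume ok: "ok I W m"
    have "exec I (While f P) (mk m k e) =
        bind_spmf (loop (mk m k e)) (\<lambda>c. return_spmf (charge [f] c))"
      by (simp add: loop_def map_spmf_conv_bind_spmf)
    moreover have "outcome I W (k + time_bound W Z (While f P)) Q b \<dots>"
    proof (rule outcome_bind[OF *[OF assms(1) ok, of k]])
      fix m' k' e' x
      assume a: "\<exists>n. Inv n m' e' x \<and> \<not> 0 < val m' f" "ok I W m'" "k' \<le> k + n * T"
      have "n * T \<le> Z * T" using \<open>n \<le> Z\<close> by simp
      then have "k' + 1 + exp_cost m' f \<le> k + time_bound W Z (While f P)"
        using a(3) exp_cost_ok[OF a(2), of f] by (simp add: T_def)
      then show "outcome I W (k + time_bound W Z (While f P)) Q x
          (return_spmf (charge [f] (mk m' k' e')))"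
        using a exit[of m' _ e' x] by (simp add: charge_mk) (blast intro: outcome_return)
    qed
    ultimately show "outcome I W (k + time_bound W Z (While f P)) Q b (exec I (While f P)
        (mk m k e))"
      by simp
  qed
qed

lemma outcome_map_pmf:
  assumes "finite (set_pmf p)" "b \<le> measure_pmf.expectation p X"
    "\<And>z. z \<in> set_pmf p \<Longrightarrow> \<exists>m' k' e'. h z = mk m' k' e' \<and> k' \<le> k \<and> ok I W m' \<and> Q m' e' (X z)"
  shows "outcome I W k Q b (spmf_of_pmf (map_pmf h p))"
  unfolding outcome_def
  by (rule exI[of _ "map_pmf (\<lambda>z. (h z, X z)) p"])
    (use assms in \<open>auto simp: pmf.map_comp o_def\<close>)

text \<open>The label splits into one bound \<open>X z\<close> per drawn value, and only the average
  of these has to reach the old label.\<close>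

lemma wp_Random:
  assumes "ok I W m \<Longrightarrow> length (encode I) \<le> nat (val m x) \<and> val m f = int N"
    "0 < N" "int N < 2 ^ W"
    "\<And>z. z < N \<Longrightarrow> Q (m(nat (val m x) := int z)) e (X z)" "b \<le> (\<Sum>z<N. X z) / real N"
  shows "wp I W Z (Random x f) m e Q b"
  unfolding wp_def
proof (intro impI allI)
  fix k assume ok: "ok I W m"
  have "{0..<int N} = int ` {..<N}"
    by (auto simp: image_def) (metis nonneg_int_cases of_nat_less_iff lessThan_iff)
  then have "spmf_of_set {0..<int N} = spmf_of_pmf (pmf_of_set (int ` {..<N}))"
    using \<open>0 < N\<close> by (simp add: spmf_of_pmf_pmf_of_set lessThan_empty_iff)
  also have "pmf_of_set (int ` {..<N}) = map_pmf int (pmf_of_set {..<N})"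
    using \<open>0 < N\<close> by (intro map_pmf_of_set_inj[symmetric]) (auto simp: lessThan_empty_iff)
  finally have "exec I (Random x f) (mk m k e) =
      spmf_of_pmf (map_pmf (\<lambda>z. store x (int z) (charge [x, f] (mk m k e))) (pmf_of_set {..<N}))"
    using assms(1)[OF ok] by (simp add: pmf.map_comp o_def)
  moreover have "outcome I W (k + time_bound W Z (Random x f)) Q b \<dots>"
  proof (rule outcome_map_pmf[where X = X])
    have set: "set_pmf (pmf_of_set {..<N}) = {..<N}"
      using \<open>0 < N\<close> by (intro set_pmf_of_set) (auto simp: lessThan_empty_iff)
    then show "finite (set_pmf (pmf_of_set {..<N}))" by simp
    show "b \<le> measure_pmf.expectation (pmf_of_set {..<N}) X"
      using assms(2,5) by (simp add: integral_pmf_of_set lessThan_empty_iff)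
    fix z assume "z \<in> set_pmf (pmf_of_set {..<N})"
    then have z: "z < N" "int z < 2 ^ W" using set assms(4)[of z] assms(3) by auto
    show "\<exists>m' k' e'. store x (int z) (charge [x, f] (mk m k e)) = mk m' k' e' \<and>
        k' \<le> k + time_bound W Z (Random x f) \<and> ok I W m' \<and> Q m' e' (X z)"
      using z assms(1)[OF ok] assms(4)[OF z(1)] exp_cost_ok[OF ok, of x] exp_cost_ok[OF ok, of f]
        bits_le[of "int z" W] ok_upd[OF ok, of "int z"]
      by (intro exI[of _ "m(nat (val m x) := int z)"]
          exI[of _ "k + 1 + exp_cost m x + exp_cost m f + bits (int z)"] exI[of _ e])
        (simp add: charge_mk store_mk)
  qed
  ultimately show "outcome I W (k + time_bound W Z (Random x f)) Q b (exec I (Random x f)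
      (mk m k e))"
    by simp
qed

lemma wp_Idle:
  assumes "el < horizon I" "\<And>j. j < arms I \<Longrightarrow> \<not> bridge I (nd j)" "Q m (el + 1, nd, rw) b"
  shows "wp I W Z Idle m (el, nd, rw) Q b"
  unfolding wp_def
proof (intro impI allI)
  fix k assume ok: "ok I W m"
  have "exec I Idle (mk m k (el, nd, rw)) = return_spmf (mk m (k + 1) (el + 1, nd, rw))"
    using assms(1,2) by (simp add: legal_idle_def charge_def mk_def)
  then show "outcome I W (k + time_bound W Z Idle) Q b (exec I Idle (mk m k (el, nd, rw)))"
    using assms(3) ok by (auto intro!: outcome_return)
qed

text \<open>\<open>embed_pmf\<close> gives the intended distribution for nonnegative weights of
  total mass 1. An instance guarantees the total mass at depths below the horizon only, so every
  pull has to be shown to happen there.\<close>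

lemma next_node:
  assumes "\<And>v. v < nodes I \<Longrightarrow> 0 \<le> trans I u a v" "(\<Sum>v<nodes I. trans I u a v) = 1"
  shows "set_pmf (next_node I u a) \<subseteq> {v. v < nodes I \<and> 0 < trans I u a v}"
    and "measure_pmf.expectation (next_node I u a) X = (\<Sum>v<nodes I. real_of_rat (trans I u a v)
        * X v)"
proof -
  let ?f = "\<lambda>v. if v < nodes I then real_of_rat (trans I u a v) else 0"
  have nonneg: "0 \<le> ?f v" for v using assms(1) by (cases "v < nodes I") simp_all
  have "(\<integral>\<^sup>+v. ennreal (?f v) \<partial>count_space UNIV) = (\<integral>\<^sup>+v. ennreal (?f v) \<partial>count_space {..<nodes I})"
    by (subst nn_integral_count_space_indicator[of "{..<nodes I}"])
      (auto intro!: nn_integral_cong simp: indicator_def)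
  also have "\<dots> = ennreal (\<Sum>v<nodes I. ?f v)"
    by (subst nn_integral_count_space_finite) (auto intro!: sum_ennreal simp: assms(1))
  also have "(\<Sum>v<nodes I. ?f v) = real_of_rat (\<Sum>v<nodes I. trans I u a v)"
    by (simp add: of_rat_sum)
  finally have pmf: "pmf (next_node I u a) v = ?f v" for v
    unfolding next_node_def using nonneg assms(2) by (intro pmf_embed_pmf) auto
  show set: "set_pmf (next_node I u a) \<subseteq> {v. v < nodes I \<and> 0 < trans I u a v}"
    using assms(1) by (auto simp: set_pmf_iff pmf split: if_splits) (metis order_le_less)
  show "measure_pmf.expectation (next_node I u a) X = (\<Sum>v<nodes I. real_of_rat (trans I u a v)
      * X v)"
    using set by (subst integral_measure_pmf_real[of "{..<nodes I}"]) (auto simp: pmf mult.commute)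
qed

lemma wp_Pull:
  assumes m: "ok I W m \<Longrightarrow> length (encode I) \<le> nat (val m x) \<and> val m f = int i \<and> val m g = int a"
    and legal: "el < horizon I" "i < arms I" "a < actions I"
      "\<And>j. j < arms I \<Longrightarrow> bridge I (nd j) \<Longrightarrow> i = j \<and> a = default I"
    and trans: "\<And>v. v < nodes I \<Longrightarrow> 0 \<le> trans I (nd i) a v" "(\<Sum>v<nodes I. trans I (nd i) a v) = 1"
    and W: "int (nodes I) < 2 ^ W"
    and Q: "\<And>v. v < nodes I \<Longrightarrow> 0 < trans I (nd i) a v \<Longrightarrow> Q (m(nat (val m x) := int v))
      (el + 1, nd(i := v), rw + real_of_rat (rew I (nd i) a)) (X v)"
    and b: "b \<le> (\<Sum>v<nodes I. real_of_rat (trans I (nd i) a v) * X v)"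
  shows "wp I W Z (Pull f g x) m (el, nd, rw) Q b"
  unfolding wp_def
proof (intro impI allI)
  fix k assume ok: "ok I W m"
  let ?c = "mk m k (el, nd, rw)" and ?p = "next_node I (nd i) a"
  let ?h = "\<lambda>v. advance I i a v (store x (int v) (charge [f, g, x] ?c))"
  have "legal_pull I ?c i a" using legal by (simp add: legal_pull_def)
  then have "exec I (Pull f g x) ?c = spmf_of_pmf (map_pmf ?h ?p)"
    using m[OF ok] by simp
  moreover have "outcome I W (k + time_bound W Z (Pull f g x)) Q b \<dots>"
  proof (rule outcome_map_pmf[where X = X])
    show "finite (set_pmf ?p)"
      using next_node(1)[OF trans] by (rule finite_subset) auto
    show "b \<le> measure_pmf.expectation ?p X" using b by (simp add: next_node(2)[OF trans])
    fix v assume "v \<in> set_pmf ?p"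
    then have v: "v < nodes I" "0 < trans I (nd i) a v" using next_node(1)[OF trans] by auto
    have v': "int v < 2 ^ W" using v(1) W by simp
    have "?h v = mk (m(nat (val m x) := int v))
        (k + 1 + exp_cost m f + exp_cost m g + exp_cost m x + bits (int v))
        (el + 1, nd(i := v), rw + real_of_rat (rew I (nd i) a))"
      by (simp add: charge_mk store_mk) (simp add: advance_def mk_def)
    then show "\<exists>m' k' e'. ?h v = mk m' k' e' \<and> k' \<le> k + time_bound W Z (Pull f g x) \<and> ok I W m' \<and>
        Q m' e' (X v)"
      using m[OF ok] Q[OF v] exp_cost_ok[OF ok, of x] exp_cost_ok[OF ok, of f]
        exp_cost_ok[OF ok, of g] bits_le[of "int v" W] v' ok_upd[OF ok, of "int v"]
      by (intro exI[of _ "m(nat (val m x) := int v)"] exI[of _ "k + 1 + exp_cost m f + exp_cost m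
          g +
          exp_cost m x + bits (int v)"] exI[of _ "(el + 1, nd(i := v),
              rw + real_of_rat (rew I (nd i) a))"])
        simp
  qed
  ultimately show "outcome I W (k + time_bound W Z (Pull f g x)) Q b (exec I (Pull f g x) ?c)"
    by simp
qed

section \<open>Memory layout\<close>

text \<open>
  The program keeps its input in place. Behind it, the cells form arrays \<open>r\<close> with three indices,
  scattered by a pairing function so that distinct cells have distinct addresses.
\<close>

definition pr :: "nat \<Rightarrow> nat \<Rightarrow> nat" where
  "pr x y = (x + y) * (x + y) + x"

text \<open>With d = x + y, the value lies between d^2 and d^2 + d and hence below (d + 1)^2. It
  therefore determines d, and then x.\<close>

lemma pr_eq_iff [simp]: "pr x y = pr x' y' \<longleftrightarrow> x = x' \<and> y = y'"
proof
  have *: "x + y = x' + y'" if "pr x y = pr x' y'" for x y x' y'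
  proof (rule ccontr)
    have less: "pr a b < pr c d" if "a + b < c + d" for a b c d
    proof -
      have "pr a b < (a + b + 1) * (a + b + 1)" by (simp add: pr_def algebra_simps)
      also have "\<dots> \<le> (c + d) * (c + d)" using that by (intro mult_mono) auto
      also have "\<dots> \<le> pr c d" by (simp add: pr_def)
      finally show ?thesis .
    qed
    assume "x + y \<noteq> x' + y'"
    then show False using less[of x y x' y'] less[of x' y' x y] that by linarith
  qed
  assume "pr x y = pr x' y'"
  with *[OF this] show "x = x' \<and> y = y'" by (simp add: pr_def)
qed auto

definition loc :: "mab \<Rightarrow> nat \<Rightarrow> nat \<Rightarrow> nat \<Rightarrow> nat \<Rightarrow> nat" where
  "loc I r i j k = length (encode I) + pr r (pr i (pr j k))"

lemma loc_eq_iff [simp]: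
  "loc I r i j k = loc I r' i' j' k' \<longleftrightarrow> r = r' \<and> i = i' \<and> j = j' \<and> k = k'"
  by (simp add: loc_def)

lemma loc_ge [simp]: "length (encode I) \<le> loc I r i j k"
  by (simp add: loc_def)

abbreviation "earms \<equiv> Mem (Const 0)"
abbreviation "eactions \<equiv> Mem (Const 1)"
abbreviation "edefault \<equiv> Mem (Const 2)"
abbreviation "ehorizon \<equiv> Mem (Const 3)"
abbreviation "enodes \<equiv> Mem (Const 4)"

text \<open>All rationals of the input in one list: the index of a reward or probability is a
  polynomial in its arguments, and its numerator and denominator sit at twice that index behind the
  header.\<close>

definition entries :: "mab \<Rightarrow> rat list" where
  "entries I = concat (map (\<lambda>u. map (rew I u) [0..<actions I]) [0..<nodes I]) @
     concat (map (\<lambda>u. concat (map (\<lambda>a. map (trans I u a) [0..<nodes I]) [0..<actions I]))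
         [0..<nodes I])"

definition header :: "mab \<Rightarrow> int list" where
  "header I = [int (arms I), int (actions I), int (default I), int (horizon I), int (nodes I)] @
     map (\<lambda>u. int (arm_of I u)) [0..<nodes I] @
     map (\<lambda>i. int (root I i)) [0..<arms I] @
     map (\<lambda>u. of_bool (bridge I u)) [0..<nodes I]"

lemma concat_concat: "concat (concat xsss) = concat (map concat xsss)"
  by (induction xsss) auto

lemma encode_eq: "encode I = header I @ concat (map encode_rat (entries I))"
  by (simp add: encode_def header_def entries_def map_concat o_def concat_concat)

lemma length_concat_upt: "(\<And>i. i < n \<Longrightarrow> length (f i) = L) \<Longrightarrow> length (concat (map f [0..<n])) = n * L"
  by (induction n) auto

lemma nth_concat_upt:
  assumes "\<And>i. i < n \<Longrightarrow> length (f i) = L" "i < n" "j < L"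
  shows "concat (map f [0..<n]) ! (i * L + j) = f i ! j"
  using assms
proof (induction n)
  case (Suc n)
  have len: "length (concat (map f [0..<n])) = n * L"
    using Suc.prems(1) by (intro length_concat_upt) simp
  show ?case
  proof (cases "i = n")
    case True
    then show ?thesis using len by (simp add: nth_append)
  next
    case False
    then have i: "i < n" using Suc.prems(2) by simp
    then have "Suc i * L \<le> n * L" by (intro mult_right_mono) auto
    then have "i * L + j < n * L" using Suc.prems(3) by simp
    then show ?thesis using Suc.IH[OF _ i Suc.prems(3)] Suc.prems(1) len by (simp add: nth_append)
  qed
qed simp

definition "nentries I = nodes I * actions I + nodes I * (actions I * nodes I)"

lemma length_entries: "length (entries I) = nentries I"
  by (simp add: entries_def nentries_def length_concat_upt)

lemma nth_entries_rew:
  assumes "u < nodes I" "a < actions I"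
  shows "u * actions I + a < nodes I * actions I" "entries I ! (u * actions I + a) = rew I u a"
proof -
  have "Suc u * actions I \<le> nodes I * actions I" using assms(1) by (intro mult_right_mono) auto
  then show *: "u * actions I + a < nodes I * actions I" using assms(2) by simp
  show "entries I ! (u * actions I + a) = rew I u a"
    using * assms nth_concat_upt[of "nodes I" "\<lambda>u. map (rew I u) [0..<actions I]" "actions I" u a]
    by (simp add: entries_def nth_append length_concat_upt)
qed

lemma nth_entries_trans:
  assumes "u < nodes I" "a < actions I" "v < nodes I"
  shows "nodes I * actions I + ((u * actions I + a) * nodes I + v) < nentries I"
    "entries I ! (nodes I * actions I + ((u * actions I + a) * nodes I + v)) = trans I u a v"
proof -
  have eq: "(u * actions I + a) * nodes I + v = u * (actions I * nodes I) + (a * nodes I + v)"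
    by (simp add: algebra_simps)
  have "Suc a * nodes I \<le> actions I * nodes I" using assms(2) by (intro mult_right_mono) auto
  then have 1: "a * nodes I + v < actions I * nodes I" using assms(3) by simp
  have "Suc u * (actions I * nodes I) \<le> nodes I * (actions I * nodes I)"
    using assms(1) by (intro mult_right_mono) auto
  then show "nodes I * actions I + ((u * actions I + a) * nodes I + v) < nentries I"
    using 1 unfolding eq nentries_def by simp
  show "entries I ! (nodes I * actions I + ((u * actions I + a) * nodes I + v)) = trans I u a v"
    using assms 1 unfolding eq entries_def
    by (simp add: nth_append length_concat_upt nth_concat_upt[where L = "actions I * nodes I"]
        nth_concat_upt[where L = "nodes I"])
qed

lemma length_header: "length (header I) = 5 + 2 * nodes I + arms I"
  by (simp add: header_def)

lemma length_concat_encode_rat: "length (concat (map encode_rat xs)) = 2 * length xs"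
  by (induction xs) (auto simp: encode_rat_def)

lemma length_encode: "length (encode I) = 5 + 2 * nodes I + arms I + 2 * nentries I"
  by (simp add: encode_eq length_header length_concat_encode_rat length_entries)

lemma nth_concat_encode_rat:
  "j < length xs \<Longrightarrow> concat (map encode_rat xs) ! (2 * j) = fst (quotient_of (xs ! j)) \<and>
    concat (map encode_rat xs) ! (Suc (2 * j)) = snd (quotient_of (xs ! j))"
proof (induction xs arbitrary: j)
  case (Cons x xs)
  then show ?case by (cases j) (auto simp: encode_rat_def nth_append)
qed simp

text \<open>Evaluates to the length of the input, so the first free cell is found from the header
  alone.\<close>

definition ebase :: exp where
  "ebase = Add (Add (Add (Const 5) (Mul (Const 2) enodes)) earms)
     (Mul (Const 2) (Add (Mul enodes eactions) (Mul enodes (Mul eactions enodes))))"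

definition Pr :: "exp \<Rightarrow> exp \<Rightarrow> exp" where
  "Pr e f = Add (Mul (Add e f) (Add e f)) e"

definition Cell :: "nat \<Rightarrow> exp \<Rightarrow> exp \<Rightarrow> exp \<Rightarrow> exp" where
  "Cell r i j k = Add ebase (Pr (Const (int r)) (Pr i (Pr j k)))"

definition Rd :: "nat \<Rightarrow> exp \<Rightarrow> exp \<Rightarrow> exp \<Rightarrow> exp" where
  "Rd r i j k = Mem (Cell r i j k)"

abbreviation "Var r \<equiv> Rd r (Const 0) (Const 0) (Const 0)"

abbreviation "reg I r \<equiv> loc I r 0 0 0"

definition "eroot i = Mem (Add (Add (Const 5) enodes) i)"
definition "ebridge u = Mem (Add (Add (Add (Const 5) enodes) earms) u)"
definition "enum j = Mem (Add (Add (Add (Const 5) (Mul (Const 2) enodes)) earms) (Mul (Const 2) j))"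
definition "eden j = Mem (Add (Add (Add (Const 6) (Mul (Const 2) enodes)) earms) (Mul (Const 2) j))"

definition "nums I j = fst (quotient_of (entries I ! j))"
definition "dens I j = snd (quotient_of (entries I ! j))"

lemma ok_nth: "ok I W m \<Longrightarrow> k < length (encode I) \<Longrightarrow> m k = encode I ! k"
  by (simp add: ok_def)

lemma ok_header: "ok I W m \<Longrightarrow> k < length (header I) \<Longrightarrow> m k = header I ! k"
  by (simp add: ok_nth encode_eq nth_append)

lemma val_params [simp]:
  assumes "ok I W m"
  shows "m 0 = int (arms I)" "m (Suc 0) = int (actions I)" "m 2 = int (default I)"
    "m 3 = int (horizon I)" "m 4 = int (nodes I)"
  using ok_header[OF assms] by (simp_all add: header_def)

lemma val_sizes [simp]:
  assumes "ok I W m"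
  shows "val m earms = int (arms I)" "val m eactions = int (actions I)"
    "val m edefault = int (default I)" "val m ehorizon = int (horizon I)" "val m enodes =
        int (nodes I)"
  using val_params[OF assms] by simp_all

lemma val_root:
  assumes "ok I W m" "val m i = int i'" "i' < arms I"
  shows "val m (eroot i) = int (root I i')"
proof -
  have "m (5 + nodes I + i') = header I ! (5 + nodes I + i')"
    using assms by (intro ok_header) (simp_all add: length_header)
  also have "\<dots> = int (root I i')" using assms(3) by (simp add: header_def nth_append)
  moreover have "nat (5 + int (nodes I) + int i') = 5 + nodes I + i'" by simp
  ultimately show ?thesis using assms by (simp add: eroot_def)
qed

lemma val_bridge:
  assumes "ok I W m" "val m u = int u'" "u' < nodes I"
  shows "val m (ebridge u) = of_bool (bridge I u')"
proof -
  have "m (5 + nodes I + arms I + u') = header I ! (5 + nodes I + arms I + u')"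
    using assms by (intro ok_header) (simp_all add: length_header)
  also have "\<dots> = of_bool (bridge I u')" using assms(3) by (simp add: header_def nth_append)
  moreover have "nat (5 + int (nodes I) + int (arms I) + int u') = 5 + nodes I + arms I + u'"
      by simp
  ultimately show ?thesis using assms by (simp add: ebridge_def)
qed

lemma val_num_den:
  assumes "ok I W m" "val m j = int j'" "j' < nentries I"
  shows "val m (enum j) = nums I j'" "val m (eden j) = dens I j'"
proof -
  let ?k = "length (header I)"
  have "m (?k + 2 * j') = encode I ! (?k + 2 * j')" "m (?k + Suc (2 * j')) =
      encode I ! (?k + Suc (2 * j'))"
    using assms by (intro ok_nth; simp add: length_header length_encode)+
  moreover have "encode I ! (?k + 2 * j') = nums I j'" "encode I ! (?k + Suc (2 * j')) = dens I j'"
    using nth_concat_encode_rat[of j' "entries I"] assms(3)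
    unfolding encode_eq nth_append_length_plus nums_def dens_def length_entries by simp_all
  moreover have "nat (5 + 2 * int (nodes I) + int (arms I) + 2 * int j') = ?k + 2 * j'"
    "nat (6 + 2 * int (nodes I) + int (arms I) + 2 * int j') = ?k + Suc (2 * j')"
    by (simp_all add: length_header)
  ultimately show "val m (enum j) = nums I j'" "val m (eden j) = dens I j'"
    using assms by (simp_all add: enum_def eden_def)
qed

lemma val_Cell:
  assumes "ok I W m" "val m i = int i'" "val m j = int j'" "val m k = int k'"
  shows "val m (Cell r i j k) = int (loc I r i' j' k')"
  using assms by (simp add: Cell_def ebase_def Pr_def loc_def pr_def length_encode nentries_def)

lemma val_Rd:
  assumes "ok I W m" "val m i = int i'" "val m j = int j'" "val m k = int k'"
  shows "val m (Rd r i j k) = m (loc I r i' j' k')"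
  by (simp add: Rd_def val_Cell[OF assms])

lemma val_Var [simp]: "ok I W m \<Longrightarrow> val m (Var r) = m (reg I r)"
  by (rule val_Rd) simp_all

definition Asg :: "nat \<Rightarrow> exp \<Rightarrow> exp \<Rightarrow> exp \<Rightarrow> exp \<Rightarrow> com" where
  "Asg r i j k f = Assign (Cell r i j k) f"

abbreviation "Set r f \<equiv> Asg r (Const 0) (Const 0) (Const 0) f"

lemma wp_Asg:
  assumes "ok I W m \<Longrightarrow> val m i = int i' \<and> val m j = int j' \<and> val m k = int k' \<and> val m f = z"
    "ok I W m \<Longrightarrow> \<bar>z\<bar> < 2 ^ W" "ok I W m \<Longrightarrow> Q (m(loc I r i' j' k' := z)) e b"
  shows "wp I W Z (Asg r i j k f) m e Q b"
  unfolding Asg_def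
  by (rule wp_Assign) (use assms val_Cell[of I W m i i' j j' k k' r] in auto)

lemma wp_Set:
  assumes "ok I W m \<Longrightarrow> val m f = z" "ok I W m \<Longrightarrow> \<bar>z\<bar> < 2 ^ W"
    "ok I W m \<Longrightarrow> Q (m(reg I r := z)) e b"
  shows "wp I W Z (Set r f) m e Q b"
  by (rule wp_Asg[where z = z]) (use assms in auto)

text \<open>The frame condition. \<open>R\<close> is a set of array numbers rather than of
  addresses, so the frame of a loop does not depend on which entries it reaches.\<close>

definition agree :: "mab \<Rightarrow> nat set \<Rightarrow> (nat \<Rightarrow> int) \<Rightarrow> (nat \<Rightarrow> int) \<Rightarrow> bool" where
  "agree I R m m' \<longleftrightarrow> (\<forall>k. (\<forall>r\<in>R. \<forall>i j l. k \<noteq> loc I r i j l) \<longrightarrow> m' k = m k)"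

lemma agree_refl [simp]: "agree I R m m"
  by (simp add: agree_def)

lemma agree_trans: "agree I R m m' \<Longrightarrow> agree I R m' m'' \<Longrightarrow> agree I R m m''"
  by (simp add: agree_def)

lemma agree_mono: "agree I R m m' \<Longrightarrow> R \<subseteq> R' \<Longrightarrow> agree I R' m m'"
  unfolding agree_def by blast

lemma agree_upd [simp]: "agree I R m m' \<Longrightarrow> r \<in> R \<Longrightarrow> agree I R m (m'(loc I r i j k := z))"
  by (auto simp: agree_def)

lemma agree_loc: "agree I R m m' \<Longrightarrow> r \<notin> R \<Longrightarrow> m' (loc I r i j k) = m (loc I r i j k)"
  unfolding agree_def by (metis loc_eq_iff)

section \<open>Counting loops\<close>

definition For :: "nat \<Rightarrow> exp \<Rightarrow> com \<Rightarrow> com" where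
  "For r h P = Seq (Set r (Const 0))
     (While (Sub h (Var r)) (Seq P (Set r (Add (Var r) (Const 1)))))"

text \<open>The bound \<open>h\<close> is evaluated again before every iteration, hence
  \<open>bound\<close> ranges over all states of the invariant. The body must leave the counter
  alone, which is why its postcondition repeats the value of \<open>reg I r\<close>.\<close>

lemma wp_For:
  assumes n: "n \<le> Z" "int n < 2 ^ W"
    and init: "Inv 0 (m(reg I r := 0)) e b"
    and bound: "\<And>i m e x. i \<le> n \<Longrightarrow> ok I W m \<Longrightarrow> Inv i m e x \<Longrightarrow> m (reg I r) = int i \<Longrightarrow> val m h = int n"
    and step: "\<And>i m e x. i < n \<Longrightarrow> ok I W m \<Longrightarrow> Inv i m e x \<Longrightarrow> m (reg I r) = int i \<Longrightarrow>
      wp I W Z P m e (\<lambda>m' e' x'. m' (reg I r) = int i \<and> Inv (Suc i) (m'(reg I r := int (Suc i)))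
          e' x') x"
    and fin: "\<And>m e x. ok I W m \<Longrightarrow> Inv n m e x \<Longrightarrow> m (reg I r) = int n \<Longrightarrow> Q m e x"
  shows "wp I W Z (For r h P) m e Q b"
  unfolding For_def
proof (rule wp_Seq, rule wp_Set[where z = 0])
  define Inv' where "Inv' k m e x \<longleftrightarrow> (\<exists>i\<le>n. k = n - i \<and> Inv i m e x \<and> m (reg I r) = int i)"
      for k m e x
  show "wp I W Z (While (Sub h (Var r)) (Seq P (Set r (Add (Var r) (Const 1))))) (m(reg I r := 0))
      e Q b"
  proof (rule wp_While[where Inv = Inv' and n = n])
    show "Inv' n (m(reg I r := 0)) e b" using init by (auto simp: Inv'_def intro!: exI[of _ 0])
    show "n \<le> Z" by fact
  next
    fix k m e x assume ok: "ok I W m" and "Inv' k m e x" and pos: "0 < val m (Sub h (Var r))"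
    then obtain i where i: "i \<le> n" "k = n - i" "Inv i m e x" "m (reg I r) = int i"
      by (auto simp: Inv'_def)
    from bound[OF i(1) ok i(3,4)] pos ok i(4) have "i < n" by simp
    from step[OF this ok i(3,4)]
    have "wp I W Z (Seq P (Set r (Add (Var r) (Const 1)))) m e (Inv' (n - Suc i)) x"
    proof (intro wp_Seq, elim wp_mono)
      fix m' e' x'
      assume *: "m' (reg I r) = int i \<and> Inv (Suc i) (m'(reg I r := int (Suc i))) e' x'"
      show "wp I W Z (Set r (Add (Var r) (Const 1))) m' e' (Inv' (n - Suc i)) x'"
      proof (rule wp_Set)
        assume ok': "ok I W m'"
        show "val m' (Add (Var r) (Const 1)) = int (Suc i)" using * ok' by simp
        show "\<bar>int (Suc i)\<bar> < 2 ^ W" using \<open>i < n\<close> n(2) by linarith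
        show "Inv' (n - Suc i) (m'(reg I r := int (Suc i))) e' x'"
          unfolding Inv'_def by (rule exI[of _ "Suc i"]) (use * \<open>i < n\<close> in auto)
      qed
    qed simp
    moreover have "k = Suc (n - Suc i)" using i(2) \<open>i < n\<close> by simp
    ultimately show "\<exists>k'. k = Suc k' \<and> wp I W Z (Seq P (Set r (Add (Var r) (Const 1))))
        m e (Inv' k') x"
      by blast
  next
    fix k m e x assume ok: "ok I W m" and "Inv' k m e x" and neg: "\<not> 0 < val m (Sub h (Var r))"
    then obtain i where i: "i \<le> n" "Inv i m e x" "m (reg I r) = int i"
      by (auto simp: Inv'_def)
    from bound[OF i(1) ok i(2,3)] neg ok i(1,3) have "i = n" by simp
    with i fin[OF ok] show "Q m e x" by simp
  qed
qed simp_all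

text \<open>For loops that neither draw nor pull: environment and label are fixed, and the invariant
  speaks of memory only.\<close>

lemma wp_For_det:
  assumes n: "n \<le> Z" "int n < 2 ^ W"
    and init: "ok I W m \<Longrightarrow> Inv 0 (m(reg I r := 0))"
    and bound: "\<And>i m. i \<le> n \<Longrightarrow> ok I W m \<Longrightarrow> Inv i m \<Longrightarrow> m (reg I r) = int i \<Longrightarrow> val m h = int n"
    and step: "\<And>i m. i < n \<Longrightarrow> ok I W m \<Longrightarrow> Inv i m \<Longrightarrow> m (reg I r) = int i \<Longrightarrow>
      wp I W Z P m e (\<lambda>m' e' x'. e' = e \<and> x' = b \<and> m' (reg I r) = int i \<and>
        Inv (Suc i) (m'(reg I r := int (Suc i)))) b"
    and fin: "\<And>m. ok I W m \<Longrightarrow> Inv n m \<Longrightarrow> m (reg I r) = int n \<Longrightarrow> Q m e b"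
  shows "wp I W Z (For r h P) m e Q b"
proof (rule wp_ok)
  assume "ok I W m"
  show ?thesis
    by (rule wp_For[where Inv = "\<lambda>i m e' x'. e' = e \<and> x' = b \<and> Inv i m", OF n])
      (use init[OF \<open>ok I W m\<close>] bound fin in \<open>auto intro: wp_mono[OF step]\<close>)
qed

definition SumLoop :: "nat \<Rightarrow> nat \<Rightarrow> exp \<Rightarrow> exp \<Rightarrow> com" where
  "SumLoop acc r h f = For r h (Set acc (Add (Var acc) f))"

text \<open>The sum of the absolute values dominates all partial sums, so a single size estimate
  covers every intermediate content of the accumulator.\<close>

lemma wp_SumLoop:
  assumes "acc \<noteq> r" "n \<le> Z" "int n < 2 ^ W" "m (reg I acc) = z" "\<bar>z\<bar> + (\<Sum>i<n. \<bar>g i\<bar>) < 2 ^ W"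
    and bound: "\<And>m'. ok I W m' \<Longrightarrow> agree I {acc, r} m m' \<Longrightarrow> val m' h = int n"
    and summand: "\<And>i m'. i < n \<Longrightarrow> ok I W m' \<Longrightarrow> agree I {acc, r} m m' \<Longrightarrow> m' (reg I r) = int i \<Longrightarrow>
      val m' f = g i"
    and fin: "\<And>m'. agree I {acc, r} m m' \<Longrightarrow> m' (reg I acc) = z + (\<Sum>i<n. g i) \<Longrightarrow> Q m' e b"
  shows "wp I W Z (SumLoop acc r h f) m e Q b"
  unfolding SumLoop_def
proof (rule wp_For_det[where Inv = "\<lambda>i m'. agree I {acc, r} m m' \<and> m' (reg I acc) =
    z + (\<Sum>i<i. g i)",
      OF assms(2,3)])
  fix i m' assume i: "i < n" and ok: "ok I W m'"
    and inv: "agree I {acc, r} m m' \<and> m' (reg I acc) = z + (\<Sum>i<i. g i)" and r: "m' (reg I r) =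
        int i"
  show "wp I W Z (Set acc (Add (Var acc) f)) m' e (\<lambda>m'' e' x'. e' = e \<and> x' = b \<and> m'' (reg I r) =
      int i \<and>
      agree I {acc, r} m (m''(reg I r := int (Suc i))) \<and>
      (m''(reg I r := int (Suc i))) (reg I acc) = z + (\<Sum>i<Suc i. g i)) b"
  proof (rule wp_Set)
    show "val m' (Add (Var acc) f) = z + (\<Sum>i<Suc i. g i)"
      using inv ok summand[OF i ok _ r] by simp
    have "\<bar>z + (\<Sum>i<Suc i. g i)\<bar> \<le> \<bar>z\<bar> + (\<Sum>i<Suc i. \<bar>g i\<bar>)"
      using sum_abs[of g "{..<Suc i}"] abs_triangle_ineq[of z "\<Sum>i<Suc i. g i"] by linarith
    also have "(\<Sum>i<Suc i. \<bar>g i\<bar>) \<le> (\<Sum>i<n. \<bar>g i\<bar>)"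
      using i by (intro sum_mono2) auto
    finally show "\<bar>z + (\<Sum>i<Suc i. g i)\<bar> < 2 ^ W" using assms(5) by simp
  qed (use inv r \<open>acc \<noteq> r\<close> in auto)
qed (use assms in auto)

text \<open>From here on reads are evaluated by lemmas such as \<open>val_Rd\<close>; unfolding them
  would expose the address arithmetic.\<close>

declare val.simps(2) [simp del]

section \<open>Policies of a single arm\<close>

text \<open>
  Slot \<open>s\<close> stands for time \<open>B - s\<close>, so that \<open>s\<close> slots remain after it. Negative values of \<open>act\<close>
  mean idling. In \<open>Ev I act g s u\<close>, the slots below \<open>s\<close> remain and the arm is on node \<open>u\<close>.
\<close>

abbreviation "rp I u a v \<equiv> real_of_rat (trans I u a v)"
abbreviation "rr I u a \<equiv> real_of_rat (rew I u a)"

primrec Ev :: "mab \<Rightarrow> (nat \<Rightarrow> nat \<Rightarrow> int) \<Rightarrow> (nat \<Rightarrow> nat \<Rightarrow> nat \<Rightarrow> real) \<Rightarrow> nat \<Rightarrow> nat \<Rightarrow> real" where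
  "Ev I act g 0 = (\<lambda>u. 0)"
| "Ev I act g (Suc s) = (\<lambda>u. if act s u < 0 then Ev I act g s u
     else g s u (nat (act s u)) + (\<Sum>v<nodes I. rp I u (nat (act s u)) v * Ev I act g s v))"

text \<open>As a gain function it turns \<open>Ev\<close> into the probability of a pull in slot
  \<open>q\<close>.\<close>

abbreviation "at_slot q s (u :: nat) (a :: nat) \<equiv> (of_bool (q = s) :: real)"

text \<open>The equation on bridge nodes is the counterpart of the bridge constraint in the linear
  program.\<close>

definition policy :: "mab \<Rightarrow> (nat \<Rightarrow> nat \<Rightarrow> int) \<Rightarrow> bool" where
  "policy I act \<longleftrightarrow> (\<forall>s u. u < nodes I \<longrightarrow>
     (if bridge I u then act s u = int (default I) else act s u < int (actions I)))"

locale superprocess_instance =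
  fixes I :: mab
  assumes superprocess: "superprocess I"
begin

abbreviation "N \<equiv> nodes I"
abbreviation "A \<equiv> actions I"
abbreviation "n \<equiv> arms I"
abbreviation "B \<equiv> horizon I"

lemma params_pos: "0 < n" "0 < B" "default I < A"
  and roots: "\<And>i. i < n \<Longrightarrow> root I i < N" "\<And>i. i < n \<Longrightarrow> arm_of I (root I i) = i"
    "\<And>i. i < n \<Longrightarrow> \<not> bridge I (root I i)"
  and rew_nonneg: "\<And>u a. u < N \<Longrightarrow> a < A \<Longrightarrow> 0 \<le> rew I u a"
  and trans_nonneg: "\<And>u a v. u < N \<Longrightarrow> a < A \<Longrightarrow> v < N \<Longrightarrow> 0 \<le> trans I u a v"
proof -
  note sp = superprocess[unfolded superprocess_def]
  show "0 < n" "0 < B" "default I < A" using sp by simp_all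
  note sp = sp[THEN conjunct2, THEN conjunct2, THEN conjunct2, THEN conjunct2]
  show "\<And>i. i < n \<Longrightarrow> root I i < N" "\<And>i. i < n \<Longrightarrow> arm_of I (root I i) = i"
    "\<And>i. i < n \<Longrightarrow> \<not> bridge I (root I i)"
    using sp[THEN conjunct1] by simp_all
  show "\<And>u a. u < N \<Longrightarrow> a < A \<Longrightarrow> 0 \<le> rew I u a"
    using sp[THEN conjunct2, THEN conjunct1] by simp
  show "\<And>u a v. u < N \<Longrightarrow> a < A \<Longrightarrow> v < N \<Longrightarrow> 0 \<le> trans I u a v"
    using sp[THEN conjunct2, THEN conjunct2, THEN conjunct1] by simp
qed

definition depth :: "nat \<Rightarrow> nat" where
  "depth = (SOME depth. (\<forall>i<n. depth (root I i) = 0) \<and>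
        (\<forall>u<N. \<forall>a<A. \<forall>v<N. 0 < trans I u a v \<longrightarrow> depth v = depth u + 1) \<and>
        (\<forall>u<N. depth u < B \<longrightarrow> (\<forall>a<A. (\<Sum>v<N. trans I u a v) = 1)))"

lemma depth: "i < n \<Longrightarrow> depth (root I i) = 0"
    "u < N \<Longrightarrow> a < A \<Longrightarrow> v < N \<Longrightarrow> 0 < trans I u a v \<Longrightarrow> depth v = depth u + 1"
    "u < N \<Longrightarrow> depth u < B \<Longrightarrow> a < A \<Longrightarrow> (\<Sum>v<N. trans I u a v) = 1"
proof -
  have "\<exists>depth. (\<forall>i<n. depth (root I i) = 0) \<and>
        (\<forall>u<N. \<forall>a<A. \<forall>v<N. 0 < trans I u a v \<longrightarrow> depth v = depth u + 1) \<and>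
        (\<forall>u<N. depth u < B \<longrightarrow> (\<forall>a<A. (\<Sum>v<N. trans I u a v) = (1 :: rat)))"
    using superprocess[unfolded superprocess_def, THEN conjunct2, THEN conjunct2, THEN conjunct2,
      THEN conjunct2, THEN conjunct2, THEN conjunct2, THEN conjunct2, THEN conjunct2] .
  from someI_ex[OF this, folded depth_def] show "i < n \<Longrightarrow> depth (root I i) = 0"
    "u < N \<Longrightarrow> a < A \<Longrightarrow> v < N \<Longrightarrow> 0 < trans I u a v \<Longrightarrow> depth v = depth u + 1"
    "u < N \<Longrightarrow> depth u < B \<Longrightarrow> a < A \<Longrightarrow> (\<Sum>v<N. trans I u a v) = 1"
    by blast+
qed

lemma rp_nonneg: "u < N \<Longrightarrow> a < A \<Longrightarrow> v < N \<Longrightarrow> 0 \<le> rp I u a v"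
  using trans_nonneg by simp

lemma rr_nonneg: "u < N \<Longrightarrow> a < A \<Longrightarrow> 0 \<le> rr I u a"
  using rew_nonneg by simp

lemma sum_rp: "u < N \<Longrightarrow> depth u < B \<Longrightarrow> a < A \<Longrightarrow> (\<Sum>v<N. rp I u a v) = 1"
  using depth(3) by (metis of_rat_1 of_rat_sum)

text \<open>Transition probabilities summing to 1 force a node at every depth up to the horizon.\<close>

lemma horizon_less_nodes: "B < N"
proof -
  have "\<exists>u<N. depth u = d" if "d \<le> B" for d
    using that
  proof (induction d)
    case 0
    then show ?case using depth(1) roots(1) params_pos(1) by blast
  next
    case (Suc d)
    then obtain u where u: "u < N" "depth u = d" by auto
    then have "(\<Sum>v<N. trans I u (default I) v) = 1"
      using Suc.prems params_pos depth(3) by simp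
    then obtain v where "v < N" "trans I u (default I) v \<noteq> 0"
      by (metis lessThan_iff sum.neutral zero_neq_one)
    then have "v < N" "0 < trans I u (default I) v"
      using trans_nonneg[of u "default I" v] u params_pos by auto
    then show ?case using depth(2)[of u "default I" v] u params_pos by auto
  qed
  then have "{..B} \<subseteq> depth ` {..<N}" by (auto simp: image_iff)
  then have "card {..B} \<le> card {..<N}" by (rule surj_card_le[OF finite_lessThan])
  then show ?thesis by simp
qed

lemma policy_action:
  assumes "policy I act" "u < N" "\<not> act s u < 0"
  shows "nat (act s u) < A" "bridge I u \<Longrightarrow> nat (act s u) = default I"
proof -
  have *: "if bridge I u then act s u = int (default I) else act s u < int A"
    using assms(1,2) unfolding policy_def by blast
  then show "bridge I u \<Longrightarrow> nat (act s u) = default I" by simp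
  from * show "nat (act s u) < A" using assms(3) params_pos(3) by (auto split: if_splits)
qed

lemma Ev_nonneg:
  assumes "policy I act" "\<And>s u a. u < N \<Longrightarrow> a < A \<Longrightarrow> 0 \<le> g s u a" "u < N"
  shows "0 \<le> Ev I act g s u"
  using assms(3)
proof (induction s arbitrary: u)
  case (Suc s)
  then show ?case
    using policy_action[OF assms(1) Suc.prems, of s] assms(2)
    by (auto intro!: add_nonneg_nonneg sum_nonneg mult_nonneg_nonneg rp_nonneg)
qed simp

lemma Ev_cong:
  "(\<And>s' u a. s' < s \<Longrightarrow> g s' u a = g' s' u a) \<Longrightarrow> Ev I act g s u = Ev I act g' s u"
  by (induction s arbitrary: u) auto

lemma Ev_diff: "Ev I act (\<lambda>s u a. g s u a - g' s u a) s u = Ev I act g s u - Ev I act g' s u"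
  by (induction s arbitrary: u) (auto simp: right_diff_distrib sum_subtractf)

lemma Ev_scale: "Ev I act (\<lambda>s u a. c * g s u a) s u = c * Ev I act g s u"
  by (induction s arbitrary: u) (auto simp: distrib_left sum_distrib_left mult.left_commute)

lemma Ev_sum: "Ev I act (\<lambda>s u a. \<Sum>q\<in>S. g q s u a) s u = (\<Sum>q\<in>S. Ev I act (g q) s u)"
proof (induction s arbitrary: u)
  case (Suc s)
  have "(\<Sum>v<N. rp I u (nat (act s u)) v * (\<Sum>q\<in>S. Ev I act (g q) s v)) =
      (\<Sum>q\<in>S. \<Sum>v<N. rp I u (nat (act s u)) v * Ev I act (g q) s v)"
    by (simp add: sum_distrib_left) (rule sum.swap)
  then show ?case using Suc by (simp add: sum.distrib)
qed simp

text \<open>A gain that depends on the slot only is a combination of slot indicators. In this way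
  the prices paid by a policy become a linear function of its pull probabilities.\<close>

lemma Ev_slots:
  assumes "s \<le> m"
  shows "Ev I act (\<lambda>s u a. c s) s u = (\<Sum>q<m. c q * Ev I act (at_slot q) s u)"
proof -
  have "Ev I act (\<lambda>s u a. c s) s u = Ev I act (\<lambda>s u a. \<Sum>q<m. c q * at_slot q s u a) s u"
  proof (rule Ev_cong)
    fix s' u a assume "s' < s"
    then have "s' < m" using assms by simp
    then have "(\<Sum>q<m. if q = s' then c q else 0) = c s'" by (subst sum.delta) auto
    moreover have "(\<Sum>q<m. if q = s' then c q else 0) = (\<Sum>q<m. c q * at_slot q s' u a)"
      by (intro sum.cong) auto
    ultimately show "c s' = (\<Sum>q<m. c q * at_slot q s' u a)" by simp
  qed
  then show ?thesis by (simp only: Ev_sum Ev_scale)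
qed

lemma Ev_at_slot_eq_0: "s \<le> q \<Longrightarrow> Ev I act (at_slot q) s u = 0"
  by (induction s arbitrary: u) auto

text \<open>Each pull uses up a slot and raises the depth by one, so \<open>depth u + s <= B\<close>
  persists and keeps all pulled nodes at depths where the transition probabilities sum to 1.\<close>

lemma Ev_at_slot_le_1:
  assumes "policy I act" "u < N" "depth u + s \<le> B"
  shows "Ev I act (at_slot q) s u \<le> 1"
  using assms(2,3)
proof (induction s arbitrary: u)
  case (Suc s)
  show ?case
  proof (cases "act s u < 0")
    case True
    then show ?thesis using Suc by simp
  next
    case False
    let ?a = "nat (act s u)"
    note a = policy_action(1)[OF assms(1) Suc.prems(1) False]
    show ?thesis
    proof (cases "q = s")
      case True
      then show ?thesis using False by (simp add: Ev_at_slot_eq_0)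
    next
      case q: False
      have "(\<Sum>v<N. rp I u ?a v * Ev I act (at_slot q) s v) \<le> (\<Sum>v<N. rp I u ?a v * 1)"
      proof (rule sum_mono)
        fix v assume "v \<in> {..<N}"
        then have v: "v < N" by simp
        show "rp I u ?a v * Ev I act (at_slot q) s v \<le> rp I u ?a v * 1"
        proof (cases "trans I u ?a v = 0")
          case False
          then have "0 < trans I u ?a v"
            using trans_nonneg[OF Suc.prems(1) a v] by simp
          from depth(2)[OF Suc.prems(1) a v this] have "depth v + s \<le> B" using Suc.prems(2) by simp
          then show ?thesis using Suc.IH[OF v] rp_nonneg[OF Suc.prems(1) a v]
            by (intro mult_left_mono) auto
        qed simp
      qed
      also have "\<dots> = 1" using sum_rp[OF Suc.prems(1) _ a] Suc.prems(2) by simp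
      finally show ?thesis using False q by simp
    qed
  qed
qed simp

section \<open>The Lagrangian dual\<close>

text \<open>The Bellman equations at prices \<open>lam\<close>. The optimality inequalities are
  restricted to ordinary nodes: a bridge node offers no choice, and its value may be
  negative.\<close>

definition optimal_policy :: "(nat \<Rightarrow> real) \<Rightarrow> (nat \<Rightarrow> nat \<Rightarrow> real) \<Rightarrow> (nat \<Rightarrow> nat \<Rightarrow> int) \<Rightarrow> bool" where
  "optimal_policy lam V act \<longleftrightarrow> policy I act \<and>
     (\<forall>u. V 0 u = 0) \<and>
     (\<forall>s. \<forall>u<N. V (Suc s) u = (if act s u < 0 then V s u else
        rr I u (nat (act s u)) - lam s + (\<Sum>v<N. rp I u (nat (act s u)) v * V s v))) \<and>
     (\<forall>s. \<forall>u<N. \<not> bridge I u \<longrightarrow> V s u \<le> V (Suc s) u \<and>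
        (\<forall>a<A. rr I u a - lam s + (\<Sum>v<N. rp I u a v * V s v) \<le> V (Suc s) u))"

lemma optimal_policyD:
  assumes "optimal_policy lam V act"
  shows "policy I act" "V 0 u = 0"
    "u < N \<Longrightarrow> V (Suc s) u = (if act s u < 0 then V s u else
        rr I u (nat (act s u)) - lam s + (\<Sum>v<N. rp I u (nat (act s u)) v * V s v))"
    "u < N \<Longrightarrow> \<not> bridge I u \<Longrightarrow> V s u \<le> V (Suc s) u"
    "u < N \<Longrightarrow> \<not> bridge I u \<Longrightarrow> a < A \<Longrightarrow>
      rr I u a - lam s + (\<Sum>v<N. rp I u a v * V s v) \<le> V (Suc s) u"
proof -
  note opt = assms[unfolded optimal_policy_def]
  show "policy I act" by (rule opt[THEN conjunct1])
  show "V 0 u = 0" by (rule opt[THEN conjunct2, THEN conjunct1, rule_format])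
  show "u < N \<Longrightarrow> V (Suc s) u = (if act s u < 0 then V s u else
        rr I u (nat (act s u)) - lam s + (\<Sum>v<N. rp I u (nat (act s u)) v * V s v))"
    by (rule opt[THEN conjunct2, THEN conjunct2, THEN conjunct1, rule_format])
  note opt = opt[THEN conjunct2, THEN conjunct2, THEN conjunct2, rule_format]
  show "u < N \<Longrightarrow> \<not> bridge I u \<Longrightarrow> V s u \<le> V (Suc s) u"
    by (rule opt[THEN conjunct1])
  show "u < N \<Longrightarrow> \<not> bridge I u \<Longrightarrow> a < A \<Longrightarrow>
      rr I u a - lam s + (\<Sum>v<N. rp I u a v * V s v) \<le> V (Suc s) u"
    by (rule opt[THEN conjunct2, rule_format])
qed

lemma optimal_policy_bridge:
  assumes "optimal_policy lam V act" "u < N" "bridge I u"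
  shows "V (Suc s) u =
    rr I u (default I) - lam s + (\<Sum>v<N. rp I u (default I) v * V s v)"
proof -
  have "act s u = int (default I)"
    using optimal_policyD(1)[OF assms(1)] assms(2,3) by (auto simp: policy_def)
  then show ?thesis using optimal_policyD(3)[OF assms(1,2)] by simp
qed

lemma optimal_policy_Ev:
  assumes "optimal_policy lam V act" "u < N"
  shows "V s u = Ev I act (\<lambda>s u a. rr I u a - lam s) s u"
  using assms(2)
proof (induction s arbitrary: u)
  case (Suc s)
  then show ?case using optimal_policyD(3)[OF assms(1) Suc.prems] by simp
qed (simp add: optimal_policyD(2)[OF assms(1)])

lemma optimal_value_nonneg:
  assumes "optimal_policy lam V act" "u < N" "\<not> bridge I u"
  shows "0 \<le> V s u"
proof (induction s)
  case 0
  then show ?case by (simp add: optimal_policyD(2)[OF assms(1)])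
next
  case (Suc s)
  then show ?case using optimal_policyD(4)[OF assms, of s] by simp
qed

lemma Ev_le_optimal:
  assumes "optimal_policy (\<lambda>_. 0) V act0" "policy I act" "u < N"
  shows "Ev I act (\<lambda>s. rr I) s u \<le> V s u"
  using assms(3)
proof (induction s arbitrary: u)
  case 0
  then show ?case by (simp add: optimal_policyD(2)[OF assms(1)])
next
  case (Suc s)
  show ?case
  proof (cases "act s u < 0")
    case True
    then have "\<not> bridge I u" using assms(2) Suc.prems by (auto simp: policy_def)
    then show ?thesis using True Suc.IH[OF Suc.prems] optimal_policyD(4)[OF assms(1) Suc.prems,
        of s] by simp
  next
    case False
    note a = policy_action[OF assms(2) Suc.prems False]
    have "Ev I act (\<lambda>s. rr I) (Suc s) u \<le>
        rr I u (nat (act s u)) - 0 + (\<Sum>v<N. rp I u (nat (act s u)) v * V s v)"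
      using False Suc.IH rp_nonneg[OF Suc.prems a(1)] by (auto intro!: sum_mono mult_left_mono)
    also have "\<dots> \<le> V (Suc s) u"
    proof (cases "bridge I u")
      case True
      then show ?thesis using optimal_policy_bridge[OF assms(1) Suc.prems True, of s] a(2) by simp
    next
      case False
      then show ?thesis using optimal_policyD(5)[OF assms(1) Suc.prems False a(1), of s] by simp
    qed
    finally show ?thesis .
  qed
qed

text \<open>The policy that is optimal without prices remains a candidate when they are charged, and
  it pays each of them at most once since a slot sees at most one pull of the arm.\<close>

lemma optimal_le_priced:
  assumes "optimal_policy (\<lambda>_. 0) V act" "optimal_policy lam V' act'" "\<And>s. 0 \<le> lam s"
    "u < N" "depth u + s \<le> B"
  shows "V s u \<le> V' s u + (\<Sum>q<s. lam q)"
  using assms(4,5)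
proof (induction s arbitrary: u)
  case 0
  then show ?case by (simp add: optimal_policyD(2)[OF assms(1)] optimal_policyD(2)[OF assms(2)])
next
  case (Suc s)
  show ?case
  proof (cases "act s u < 0")
    case True
    then have b: "\<not> bridge I u"
      using optimal_policyD(1)[OF assms(1)] Suc.prems by (auto simp: policy_def)
    show ?thesis
      using optimal_policyD(3)[OF assms(1) Suc.prems(1),
          of s] True Suc.IH[OF Suc.prems(1)] Suc.prems(2)
        optimal_policyD(4)[OF assms(2) Suc.prems(1) b, of s] assms(3)[of s] by simp
  next
    case False
    define a where "a = nat (act s u)"
    note a = policy_action[OF optimal_policyD(1)[OF assms(1)] Suc.prems(1) False, folded a_def]
    let ?L = "\<Sum>q<s. lam q"
    \<comment> \<open>The sum of the later prices passes through the transition unchanged because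
      the probabilities sum to 1 at this depth.\<close>
    have L: "(\<Sum>v<N. rp I u a v * ?L) = ?L"
      using sum_rp[OF Suc.prems(1) _ a(1)] Suc.prems(2) by (simp flip: sum_distrib_right)
    have "(\<Sum>v<N. rp I u a v * V s v) \<le> (\<Sum>v<N. rp I u a v * (V' s v + ?L))"
    proof (rule sum_mono)
      fix v assume "v \<in> {..<N}"
      then have v: "v < N" by simp
      show "rp I u a v * V s v \<le> rp I u a v * (V' s v + ?L)"
      proof (cases "trans I u a v = 0")
        case False
        then have "0 < trans I u a v"
          using trans_nonneg[OF Suc.prems(1) a(1) v] by simp
        from depth(2)[OF Suc.prems(1) a(1) v this] have "depth v + s \<le> B" using Suc.prems(2) by simp
        then show ?thesis using Suc.IH[OF v] rp_nonneg[OF Suc.prems(1) a(1) v]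
          by (intro mult_left_mono) auto
      qed simp
    qed
    also have "\<dots> = (\<Sum>v<N. rp I u a v * V' s v) + ?L"
      using L by (simp add: algebra_simps sum.distrib)
    finally have "V (Suc s) u \<le> rr I u a - lam s + (\<Sum>v<N. rp I u a v * V' s v) + (\<Sum>q<Suc s. lam q)"
      using optimal_policyD(3)[OF assms(1) Suc.prems(1), of s] False a_def by simp
    also have "rr I u a - lam s + (\<Sum>v<N. rp I u a v * V' s v) \<le> V' (Suc s) u"
    proof (cases "bridge I u")
      case True
      then show ?thesis using optimal_policy_bridge[OF assms(2) Suc.prems(1) True, of s] a(2)
          by simp
    next
      case False
      then show ?thesis using optimal_policyD(5)[OF assms(2) Suc.prems(1) False a(1), of s] by simp
    qed
    finally show ?thesis by simp
  qed
qed

section \<open>Weak duality for the linear program\<close>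

lemma sum_Par:
  assumes "u < N"
  shows "(\<Sum>(v, a)\<in>Par I u. f v a * rp I v a u) = (\<Sum>v<N. \<Sum>a<A. f v a * rp I v a u)"
proof -
  have "(\<Sum>(v, a)\<in>Par I u. f v a * rp I v a u) = (\<Sum>(v, a)\<in>{..<N} \<times> {..<A}. f v a * rp I v a u)"
  proof (rule sum.mono_neutral_left)
    show "\<forall>va\<in>{..<N} \<times> {..<A} - Par I u. (case va of (v, a) \<Rightarrow> f v a * rp I v a u) = 0"
      using trans_nonneg[OF _ _ assms] by (fastforce simp: Par_def)
  qed (auto simp: Par_def)
  then show ?thesis by (simp add: sum.cartesian_product)
qed

lemma root_sum: "(\<Sum>u<N. (if u \<in> root I ` {..<n} then 1 else 0) * f u) = (\<Sum>i<n. f (root I i)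
    :: real)"
proof -
  have inj: "inj_on (root I) {..<n}" by (intro inj_onI) (metis lessThan_iff roots(2))
  have "(\<Sum>u<N. (if u \<in> root I ` {..<n} then 1 else 0) * f u) = (\<Sum>u\<in>root I ` {..<n}. f u)"
    by (rule sum.mono_neutral_cong_right) (use roots(1) in auto)
  then show ?thesis by (simp add: sum.reindex[OF inj])
qed

text \<open>Lagrangian relaxation combined with backward induction over time: the priced reward
  collected from time \<open>Suc B - s\<close> on is at most the mass present at that time, weighted
  with the values for \<open>s\<close> remaining slots.\<close>

lemma weak_duality:
  assumes feas: "PolyLP_feasible I x st" and opt: "optimal_policy lam V act" and lam: "\<And>s. 0 \<le>
      lam s"
  shows "PolyLP_objective I x \<le> (\<Sum>s<B. lam s) + (\<Sum>i<n. V B (root I i))"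
proof -
  have f1: "(\<Sum>u<N. \<Sum>a<A. x u a t) \<le> 1" if "1 \<le> t" "t \<le> B" for t
    using feas that unfolding PolyLP_feasible_def by auto
  have f2: "(\<Sum>a<A. x u a t) \<le> st u t" if "u < N" "1 \<le> t" "t \<le> B" for u t
    using feas that unfolding PolyLP_feasible_def by auto
  have f3: "x u (default I) t = st u t" if "u < N" "bridge I u" "1 \<le> t" "t \<le> B" for u t
    using feas that unfolding PolyLP_feasible_def by auto
  have f4: "0 \<le> x u a t" if "u < N" "a < A" "1 \<le> t" "t \<le> B" for u a t
    using feas that unfolding PolyLP_feasible_def by auto
  have f5: "st u 1 = (if u \<in> root I ` {..<n} then 1 else 0)" if "u < N" for u
    using feas that unfolding PolyLP_feasible_def by auto
  have f6: "st u (Suc t) = st u t - (\<Sum>a<A. x u a t) + (\<Sum>v<N. \<Sum>a<A. x v a t * rp I v a u)"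
    if "u < N" "1 \<le> t" "Suc t \<le> B" for u t
  proof -
    have "\<forall>t\<in>{2..B}. st u t = st u (t - 1) - (\<Sum>a<A. x u a (t - 1))
                + (\<Sum>(v, a)\<in>Par I u. x v a (t - 1) * rp I v a u)"
      using feas that(1) unfolding PolyLP_feasible_def by blast
    from bspec[OF this, of "Suc t"] that show ?thesis by (simp add: sum_Par)
  qed
  define val where "val t = (\<Sum>u<N. \<Sum>a<A. x u a t * (rr I u a - lam (B - t)))" for t
  \<comment> \<open>One node at one time: the pulled mass earns the value of its action, the
    remaining mass idles, and the Bellman value of the node dominates both.\<close>
  have node: "(\<Sum>a<A. x u a t * (rr I u a - lam s + (\<Sum>v<N. rp I u a v * V s v))) +
      (st u t - (\<Sum>a<A. x u a t)) * V s u \<le> st u t * V (Suc s) u"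
    if u: "u < N" and t: "1 \<le> t" "t \<le> B" for u t s
  proof (cases "bridge I u")
    case True
    define R where "R = {..<A} - {default I}"
    have split: "(\<Sum>a<A. h a) = h (default I) + (\<Sum>a\<in>R. h a)" for h :: "nat \<Rightarrow> real"
      unfolding R_def using params_pos by (intro sum.remove) auto
    \<comment> \<open>On a bridge node the default action already takes the whole mass, which leaves
      nothing for the other actions.\<close>
    have "(\<Sum>a\<in>R. x u a t) \<le> 0"
      using f2[OF u t] f3[OF u True t] split[of "\<lambda>a. x u a t"] by simp
    moreover have nn: "\<forall>a\<in>R. 0 \<le> x u a t" using f4[OF u _ t] by (auto simp: R_def)
    ultimately have "(\<Sum>a\<in>R. x u a t) = 0" by (meson sum_nonneg order_antisym)
    then have z: "\<forall>a\<in>R. x u a t = 0" using nn by (subst (asm) sum_nonneg_eq_0_iff)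
        (auto simp: R_def)
    then show ?thesis
      using optimal_policy_bridge[OF opt u True, of s] f3[OF u True t] by (simp add: split)
  next
    case False
    have "(\<Sum>a<A. x u a t * (rr I u a - lam s + (\<Sum>v<N. rp I u a v * V s v))) \<le>
        (\<Sum>a<A. x u a t * V (Suc s) u)"
      using optimal_policyD(5)[OF opt u False] f4[OF u _ t] by (intro sum_mono mult_left_mono) auto
    moreover have "(st u t - (\<Sum>a<A. x u a t)) * V s u \<le> (st u t - (\<Sum>a<A. x u a t)) * V (Suc s) u"
      using optimal_policyD(4)[OF opt u False] f2[OF u t] by (intro mult_left_mono) auto
    ultimately show ?thesis by (simp add: algebra_simps sum_distrib_left)
  qed
  have main: "(\<Sum>t = Suc B - s..B. val t) \<le> (\<Sum>u<N. st u (Suc B - s) * V s u)" if "1 \<le> s" "s \<le> B"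
      for s
    using that
  proof (induction s)
    case (Suc s)
    let ?t = "B - s"
    have t: "1 \<le> ?t" "?t \<le> B" "B - ?t = s" using Suc.prems by auto
    \<comment> \<open>Inflow summed over the receiving nodes equals outflow summed over the sending
      ones.\<close>
    have flow: "(\<Sum>u<N. (st u ?t - (\<Sum>a<A. x u a ?t) + (\<Sum>v<N. \<Sum>a<A. x v a ?t * rp I v a u)) * V s u) =
        (\<Sum>u<N. (st u ?t - (\<Sum>a<A. x u a ?t)) * V s u) +
        (\<Sum>u<N. \<Sum>a<A. x u a ?t * (\<Sum>v<N. rp I u a v * V s v))"
    proof -
      have "(\<Sum>u<N. (\<Sum>v<N. \<Sum>a<A. x v a ?t * rp I v a u) * V s u) =
          (\<Sum>u<N. \<Sum>v<N. \<Sum>a<A. x v a ?t * (rp I v a u * V s u))"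
        by (simp add: sum_distrib_right mult.assoc)
      also have "\<dots> = (\<Sum>v<N. \<Sum>a<A. \<Sum>u<N. x v a ?t * (rp I v a u * V s u))"
        by (rule trans[OF sum.swap], rule sum.cong[OF refl], rule sum.swap)
      finally show ?thesis by (simp add: distrib_right sum.distrib sum_distrib_left)
    qed
    have "(\<Sum>t = Suc ?t..B. val t) \<le> (\<Sum>u<N. (st u ?t - (\<Sum>a<A. x u a ?t) +
        (\<Sum>v<N. \<Sum>a<A. x v a ?t * rp I v a u)) * V s u)"
    \<comment> \<open>At time \<open>B\<close> the linear program has no flow equation into the next
      time step, but the values for 0 remaining slots vanish anyway.\<close>
    proof (cases "s = 0")
      case True
      then show ?thesis by (simp add: optimal_policyD(2)[OF opt])
    next
      case False
      then have "(\<Sum>t = Suc ?t..B. val t) \<le> (\<Sum>u<N. st u (Suc ?t) * V s u)"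
        using Suc by (simp add: Suc_diff_le)
      also have "\<dots> = (\<Sum>u<N. (st u ?t - (\<Sum>a<A. x u a ?t) +
        (\<Sum>v<N. \<Sum>a<A. x v a ?t * rp I v a u)) * V s u)"
        using f6[of _ ?t] t False Suc.prems by (intro sum.cong refl) auto
      finally show ?thesis .
    qed
    moreover have "(\<Sum>t = ?t..B. val t) = val ?t + (\<Sum>t = Suc ?t..B. val t)"
      using t by (intro sum.atLeast_Suc_atMost) auto
    ultimately have "(\<Sum>t = ?t..B. val t) \<le> (\<Sum>u<N. \<Sum>a<A. x u a ?t * (rr I u a - lam s)) +
        ((\<Sum>u<N. (st u ?t - (\<Sum>a<A. x u a ?t)) * V s u) +
        (\<Sum>u<N. \<Sum>a<A. x u a ?t * (\<Sum>v<N. rp I u a v * V s v)))"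
      unfolding flow by (simp add: val_def t(3))
    also have "\<dots> = (\<Sum>u<N. (\<Sum>a<A. x u a ?t * (rr I u a - lam s + (\<Sum>v<N. rp I u a v * V s v))) +
      (st u ?t - (\<Sum>a<A. x u a ?t)) * V s u)"
      by (simp add: distrib_left sum.distrib)
    also have "\<dots> \<le> (\<Sum>u<N. st u ?t * V (Suc s) u)"
      using node[OF _ t(1,2)] by (intro sum_mono) auto
    finally show ?case by simp
  qed simp
  have "PolyLP_objective I x - (\<Sum>s<B. lam s) \<le> (\<Sum>t = 1..B. val t)"
  proof -
    have "(\<Sum>t = 1..B. val t) = (\<Sum>t = 1..B. \<Sum>u<N. \<Sum>a<A. rr I u a * x u a t) -
        (\<Sum>t = 1..B. lam (B - t) * (\<Sum>u<N. \<Sum>a<A. x u a t))"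
      unfolding val_def by (simp add: right_diff_distrib sum_subtractf sum_distrib_left
          mult.commute)
    also have "(\<Sum>t = 1..B. \<Sum>u<N. \<Sum>a<A. rr I u a * x u a t) = PolyLP_objective I x"
      unfolding PolyLP_objective_def sum_distrib_left
      by (rule trans[OF sum.swap], rule sum.cong[OF refl], rule sum.swap)
    finally have "PolyLP_objective I x - (\<Sum>t = 1..B. lam (B - t) * (\<Sum>u<N. \<Sum>a<A. x u a t)) = (\<Sum>t =
        1..B. val t)"
      by simp
    moreover have "(\<Sum>t = 1..B. lam (B - t) * (\<Sum>u<N. \<Sum>a<A. x u a t)) \<le> (\<Sum>t = 1..B. lam (B - t) * 1)"
      using f1 lam by (intro sum_mono mult_left_mono) auto
    moreover have "(\<Sum>t = 1..B. lam (B - t)) = (\<Sum>s<B. lam s)"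
      by (rule sum.reindex_bij_witness[of _ "\<lambda>s. B - s" "\<lambda>t. B - t"]) auto
    ultimately show ?thesis by simp
  qed
  also have "(\<Sum>t = 1..B. val t) \<le> (\<Sum>u<N. st u 1 * V B u)"
    using main[of B] params_pos by simp
  also have "\<dots> = (\<Sum>i<n. V B (root I i))"
    using f5 by (simp flip: root_sum)
  finally show ?thesis by simp
qed

text \<open>Never pulling is feasible because roots are not bridge nodes. So the supremum in
  \<open>OPT_PolyLP\<close> is taken over a nonempty set, as the least-upper-bound argument
  requires.\<close>

lemma PolyLP_feasible_zero: "\<exists>x st. PolyLP_feasible I x st"
proof (intro exI)
  show "PolyLP_feasible I (\<lambda>_ _ _. 0) (\<lambda>u t. if u \<in> root I ` {..<n} then 1 else 0)"
    using roots(3) by (auto simp: PolyLP_feasible_def)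
qed

lemma OPT_le_dual:
  assumes "optimal_policy lam V act" "\<And>s. 0 \<le> lam s"
  shows "OPT_PolyLP I \<le> (\<Sum>s<B. lam s) + (\<Sum>i<n. V B (root I i))"
  unfolding OPT_PolyLP_def
  by (rule cSup_least) (use PolyLP_feasible_zero weak_duality[OF _ assms] in auto)

end

section \<open>Solving the dual by projected subgradient steps in integer arithmetic\<close>

text \<open>A common denominator of all data. The plain product takes one multiplication per entry,
  and its bit length is still polynomial.\<close>

definition DD :: "mab \<Rightarrow> int" where
  "DD I = (\<Prod>j<nentries I. dens I j)"

definition scaled :: "mab \<Rightarrow> nat \<Rightarrow> int" where
  "scaled I j = nums I j * (DD I div dens I j)"

definition "Rh I u a = scaled I (u * actions I + a)"
definition "Ph I u a v = scaled I (nodes I * actions I + ((u * actions I + a) * nodes I + v))"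

text \<open>The running maximum in the form in which the program computes it, starting from idling
  with value \<open>z\<close> and action -1. On a bridge node the test for the default action takes
  the place of the comparison.\<close>

primrec scan :: "(nat \<Rightarrow> int) \<Rightarrow> bool \<Rightarrow> nat \<Rightarrow> int \<Rightarrow> nat \<Rightarrow> int \<times> int" where
  "scan c br d z 0 = (z, -1)"
| "scan c br d z (Suc a) = (if (if br then a = d else fst (scan c br d z a) < c a) then (c a, int a)
     else scan c br d z a)"

text \<open>The Bellman value of action \<open>a\<close>, multiplied by
  \<open>G * DD I ^ Suc s\<close> to clear all denominators.\<close>

definition cand :: "mab \<Rightarrow> int \<Rightarrow> int \<Rightarrow> (nat \<Rightarrow> int) \<Rightarrow> nat \<Rightarrow> (nat \<Rightarrow> int) \<Rightarrow> nat \<Rightarrow> nat \<Rightarrow> int" where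
  "cand I G Z y s V u a = G * DD I ^ s * Rh I u a - DD I ^ Suc s * Z * y s + (\<Sum>v<nodes I. Ph I u a
      v * V v)"

text \<open>
  \<open>Vh\<close> is the optimal value for the prices \<open>Z * y s / G\<close>, scaled by \<open>G * DD I ^ s\<close>, and \<open>Qh q\<close> is
  the probability of a pull in slot \<open>q\<close>, scaled by \<open>DD I ^ s\<close>.
\<close>

primrec Vh :: "mab \<Rightarrow> int \<Rightarrow> int \<Rightarrow> (nat \<Rightarrow> int) \<Rightarrow> nat \<Rightarrow> nat \<Rightarrow> int" where
  "Vh I G Z y 0 = (\<lambda>u. 0)"
| "Vh I G Z y (Suc s) = (\<lambda>u. fst (scan (cand I G Z y s (Vh I G Z y s) u) (bridge I u) (default I)
     (DD I * Vh I G Z y s u) (actions I)))"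

definition best_act :: "mab \<Rightarrow> int \<Rightarrow> int \<Rightarrow> (nat \<Rightarrow> int) \<Rightarrow> nat \<Rightarrow> nat \<Rightarrow> int" where
  "best_act I G Z y s u = snd (scan (cand I G Z y s (Vh I G Z y s) u) (bridge I u) (default I)
     (DD I * Vh I G Z y s u) (actions I))"

primrec Qh :: "mab \<Rightarrow> (nat \<Rightarrow> nat \<Rightarrow> int) \<Rightarrow> nat \<Rightarrow> nat \<Rightarrow> nat \<Rightarrow> int" where
  "Qh I act q 0 = (\<lambda>u. 0)"
| "Qh I act q (Suc s) = (\<lambda>u. if act s u < 0 then DD I * Qh I act q s u
     else (if q = s then DD I ^ Suc s else 0) + (\<Sum>v<nodes I. Ph I u (nat (act s u))
         v * Qh I act q s v))"

text \<open>A subgradient step followed by the projection to nonnegative prices, in units of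
  \<open>1 / DD I ^ horizon I\<close>: the price moves by the excess of the expected number of pulls
  over 1. The actual step size enters through the ratio of \<open>ZZ I\<close> to
  \<open>GG I\<close>.\<close>

definition price_step :: "mab \<Rightarrow> (nat \<Rightarrow> nat \<Rightarrow> int) \<Rightarrow> (nat \<Rightarrow> int) \<Rightarrow> nat \<Rightarrow> int" where
  "price_step I act y q =
     max 0 (y q - DD I ^ horizon I + (\<Sum>i<arms I. Qh I act q (horizon I) (root I i)))"

primrec prices :: "mab \<Rightarrow> int \<Rightarrow> int \<Rightarrow> nat \<Rightarrow> nat \<Rightarrow> int" where
  "prices I G Z 0 = (\<lambda>q. 0)"
| "prices I G Z (Suc k) = price_step I (best_act I G Z (prices I G Z k)) (prices I G Z k)"

text \<open>With the step size \<open>eta = R0 / HH I\<close>, the error per step,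
  \<open>eta * B * n^2 / 2\<close>, is exactly \<open>1 / (4 * B)\<close> times
  \<open>R0 / n\<close>.\<close>

definition "HH I = 2 * horizon I ^ 2 * arms I ^ 3"
text \<open>Solves \<open>K * (2 * HH I + B * n^2) = (K / (4 * B))^2\<close>, so that a final price
  is at most \<open>K / (4 * B)\<close>.\<close>

definition "KK I = 16 * horizon I ^ 2 * (2 * HH I + horizon I * arms I ^ 2)"
text \<open>The unpriced optimum \<open>R0\<close>, multiplied by \<open>DD I ^ horizon I\<close>.
  It fixes the unit of money.\<close>

definition "ZZ I = (\<Sum>i<arms I. Vh I 1 0 (\<lambda>_. 0) (horizon I) (root I i))"
text \<open>One power of the common denominator belongs to \<open>ZZ I\<close>, the other to the
  integer prices; \<open>HH I\<close> is the denominator of the step size.\<close>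

definition "GG I = int (HH I) * (DD I ^ horizon I * DD I ^ horizon I)"

definition learned :: "mab \<Rightarrow> nat \<Rightarrow> nat \<Rightarrow> nat \<Rightarrow> int" where
  "learned I k = best_act I (GG I) (ZZ I) (prices I (GG I) (ZZ I) k)"

section \<open>The integer recursions represent the rational ones exactly\<close>

lemma dens_pos: "0 < dens I j"
  by (simp add: dens_def quotient_of_denom_pos')

lemma DD_pos: "0 < DD I"
  unfolding DD_def by (intro prod_pos dens_pos)

lemma real_scaled:
  assumes "j < nentries I"
  shows "real_of_int (scaled I j) = DD I * real_of_rat (entries I ! j)"
proof -
  have "dens I j dvd DD I" unfolding DD_def using assms by (intro dvd_prodI) auto
  then have "real_of_int (DD I div dens I j) = DD I / dens I j" by (rule real_of_int_div)
  moreover have "entries I ! j = of_int (nums I j) / of_int (dens I j)"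
    unfolding nums_def dens_def by (rule quotient_of_div) simp
  then have "real_of_rat (entries I ! j) = nums I j / dens I j" by (simp add: of_rat_divide)
  ultimately show ?thesis by (simp add: scaled_def)
qed

lemma real_Rh: "u < nodes I \<Longrightarrow> a < actions I \<Longrightarrow> real_of_int (Rh I u a) = DD I * rr I u a"
  unfolding Rh_def using nth_entries_rew[of u I a] by (subst real_scaled) (auto simp: nentries_def)

lemma real_Ph: "u < nodes I \<Longrightarrow> a < actions I \<Longrightarrow> v < nodes I \<Longrightarrow>
    real_of_int (Ph I u a v) = DD I * rp I u a v"
  unfolding Ph_def using nth_entries_trans[of u I a v] by (subst real_scaled) auto

lemma scan_bridge: "scan c True d z m = (if d < m then (c d, int d) else (z, -1))"
  by (induction m) auto

lemma scan_max:
  "(scan c False d z m = (z, -1) \<or> (\<exists>a<m. scan c False d z m = (c a, int a))) \<and>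
   z \<le> fst (scan c False d z m) \<and> (\<forall>a<m. c a \<le> fst (scan c False d z m))"
proof (induction m)
  case (Suc m)
  let ?b = "fst (scan c False d z m)"
  show ?case
  proof (cases "?b < c m")
    case True
    then have "scan c False d z (Suc m) = (c m, int m)" by simp
    moreover have "\<forall>a<m. c a \<le> c m" using Suc True by (meson order.strict_implies_order order.trans)
    moreover have "z \<le> c m" using Suc True by linarith
    ultimately show ?thesis by (auto simp: less_Suc_eq)
  next
    case False
    then have eq: "scan c False d z (Suc m) = scan c False d z m" by simp
    show ?thesis unfolding eq using Suc False by (auto simp: less_Suc_eq)
  qed
qed simp

context superprocess_instance
begin

text \<open>Values for \<open>s\<close> remaining slots are multiplied by
  \<open>G * DD I ^ s\<close> without any rounding, so the integer maximization is an exact Bellman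
  step.\<close>

lemma optimal_best_act:
  assumes "0 < G"
  shows "optimal_policy (\<lambda>s. Z * y s / G) (\<lambda>s u. Vh I G Z y s u / (G * DD I ^ s))
      (best_act I G Z y)"
proof -
  define V where "V s u = Vh I G Z y s u / (G * DD I ^ s)" for s u
  define lam where "lam s = real_of_int Z * real_of_int (y s) / real_of_int G" for s
  have D: "0 < real_of_int (DD I)" using DD_pos by simp
  let ?c = "\<lambda>s u a. rr I u a - lam s + (\<Sum>v<N. rp I u a v * V s v)"
  have cand: "cand I G Z y s (Vh I G Z y s) u a / (G * DD I ^ Suc s) = ?c s u a"
    if "u < N" "a < A" for s u a
  proof -
    have "real_of_int (cand I G Z y s (Vh I G Z y s) u a) = G * DD I ^ s * (DD I * rr I u a) -
        DD I ^ Suc s * Z * y s + (\<Sum>v<N. DD I * rp I u a v * Vh I G Z y s v)"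
      using that by (simp add: cand_def real_Rh real_Ph)
    also have "(\<Sum>v<N. DD I * rp I u a v * Vh I G Z y s v) =
        (G * DD I ^ Suc s) * (\<Sum>v<N. rp I u a v * V s v)"
      unfolding sum_distrib_left V_def using D assms by (intro sum.cong refl)
          (simp add: field_simps)
    also have "G * DD I ^ s * (DD I * rr I u a) - DD I ^ Suc s * Z * y s = (G * DD I ^ Suc s)
        * (rr I u a - lam s)"
      using assms by (simp add: lam_def field_simps)
    finally show ?thesis using D assms by (simp add: field_simps)
  qed
  have keep: "real_of_int (DD I * Vh I G Z y s u) / (G * DD I ^ Suc s) = V s u" for s u
    using D by (simp add: V_def)
  have V: "V (Suc s) u = fst (scan (cand I G Z y s (Vh I G Z y s) u) (bridge I u) (default I)
     (DD I * Vh I G Z y s u) A) / (G * DD I ^ Suc s)" for s u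
    by (simp add: V_def)
  have mono: "z \<le> z' \<Longrightarrow> z / (G * DD I ^ Suc s) \<le> z' / (G * DD I ^ Suc s)" for z z' :: real and s
    using D assms by (intro divide_right_mono) auto
  have "policy I (best_act I G Z y)"
    unfolding policy_def best_act_def
  proof (intro allI impI)
    fix s u assume "u < N"
    show "if bridge I u then snd (scan (cand I G Z y s (Vh I G Z y s) u) (bridge I u) (default I)
     (DD I * Vh I G Z y s u) A) = int (default I) else snd (scan (cand I G Z y s (Vh I G Z y s) u)
         (bridge I u) (default I)
     (DD I * Vh I G Z y s u) A) < int A"
      using params_pos(3) scan_max[of "cand I G Z y s (Vh I G Z y s) u" "default I"
          "DD I * Vh I G Z y s u" A]
      by (cases "bridge I u") (auto simp: scan_bridge)
  qed
  moreover have "V 0 u = 0" for u by (simp add: V_def)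
  moreover have "V (Suc s) u = (if best_act I G Z y s u < 0 then V s u else ?c s u (nat (best_act
      I G Z y s u)))"
    if u: "u < N" for s u
  proof (cases "bridge I u")
    case True
    then show ?thesis using params_pos(3) cand[OF u, of "default I" s]
      unfolding V best_act_def by (simp add: scan_bridge)
  next
    case False
    then show ?thesis
      using scan_max[of "cand I G Z y s (Vh I G Z y s) u" "default I" "DD I * Vh I G Z y s u" A]
        cand[OF u, of _ s] keep[of s u]
      unfolding V best_act_def by auto
  qed
  moreover have "V s u \<le> V (Suc s) u \<and> (\<forall>a<A. ?c s u a \<le> V (Suc s) u)"
    if u: "u < N" and "\<not> bridge I u" for s u
  proof -
    have b: "bridge I u = False" using that by simp
    note sc = scan_max[of "cand I G Z y s (Vh I G Z y s) u" "default I" "DD I * Vh I G Z y s u" A]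
    have "V s u \<le> V (Suc s) u"
      unfolding V b keep[of s u, symmetric] using sc by (intro mono) linarith
    moreover have "?c s u a \<le> V (Suc s) u" if "a < A" for a
      unfolding V b cand[OF u that, symmetric] using sc that by (intro mono) simp
    ultimately show ?thesis by blast
  qed
  ultimately show ?thesis
    unfolding optimal_policy_def V_def[symmetric] lam_def by blast
qed

lemma real_Qh:
  assumes "policy I act" "u < N"
  shows "real_of_int (Qh I act q s u) = DD I ^ s * Ev I act (at_slot q) s u"
  using assms(2)
proof (induction s arbitrary: u)
  case (Suc s)
  show ?case
  proof (cases "act s u < 0")
    case False
    then show ?thesis
      using Suc policy_action(1)[OF assms(1) Suc.prems False]
      by (simp add: real_Ph algebra_simps sum_distrib_left)
  qed (use Suc in simp)
qed simp

lemma policy_learned: "policy I (learned I k)"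
proof -
  have "0 < GG I" using DD_pos params_pos by (simp add: GG_def HH_def)
  from optimal_policyD(1)[OF optimal_best_act[OF this]] show ?thesis unfolding learned_def .
qed

section \<open>Regret of the subgradient method\<close>

definition total :: "(nat \<Rightarrow> nat \<Rightarrow> int) \<Rightarrow> real" where
  "total act = (\<Sum>i<n. Ev I act (\<lambda>s. rr I) B (root I i))"

definition load :: "(nat \<Rightarrow> nat \<Rightarrow> int) \<Rightarrow> nat \<Rightarrow> real" where
  "load act q = (\<Sum>i<n. Ev I act (at_slot q) B (root I i))"

lemma load_bounds:
  assumes "policy I act"
  shows "0 \<le> load act q" "load act q \<le> n"
proof -
  show "0 \<le> load act q" unfolding load_def
    using assms roots(1) by (intro sum_nonneg Ev_nonneg) auto
  have "load act q \<le> (\<Sum>i<n. 1)" unfolding load_def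
    using assms roots(1) depth(1) by (intro sum_mono Ev_at_slot_le_1) auto
  then show "load act q \<le> n" by simp
qed

text \<open>The potential of the regret argument is the sum of the squared prices. The bound on the
  loads is disjunctive because for \<open>L = 0\<close> also \<open>R0\<close> and the step size are
  0, so that prices carry no weight and the loads are uncontrolled.\<close>

theorem learned_mixture:
  obtains L where "OPT_PolyLP I \<le> L" "0 \<le> L"
    "(1 - 1 / (4 * B)) * L * KK I \<le> (\<Sum>k<KK I. total (learned I k))"
    "\<And>q. q < B \<Longrightarrow> L = 0 \<or> (\<Sum>k<KK I. load (learned I k) q) \<le> (1 + 1 / (4 * B)) * KK I"
proof -
  define K where "K = KK I"
  define y where "y k q = real_of_int (prices I (GG I) (ZZ I) k q) / DD I ^ B" for k q
  define V0 where "V0 s u = Vh I 1 0 (\<lambda>_. 0) s u / DD I ^ s" for s u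
  define R0 where "R0 = (\<Sum>i<n. V0 B (root I i))"
  define eta where "eta = R0 / HH I"
  have D: "0 < real_of_int (DD I)" using DD_pos by simp
  have H: "0 < HH I" using params_pos by (simp add: HH_def)
  then have G: "0 < GG I" using DD_pos by (simp add: GG_def)
  have opt0: "optimal_policy (\<lambda>_. 0) V0 (best_act I 1 0 (\<lambda>_. 0))"
    using optimal_best_act[of 1 0 "\<lambda>_. 0"] by (simp add: V0_def[abs_def])
  have V0: "0 \<le> V0 B (root I i)" if "i < n" for i
    using optimal_value_nonneg[OF opt0] roots that by blast
  have R0: "0 \<le> R0" unfolding R0_def using V0 by (intro sum_nonneg) auto
  have ZZ: "real_of_int (ZZ I) = DD I ^ B * R0"
    using D by (simp add: ZZ_def R0_def V0_def flip: sum_divide_distrib)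
  have price: "ZZ I * prices I (GG I) (ZZ I) k q / GG I = eta * y k q" for k q
    using D H by (simp add: ZZ GG_def eta_def y_def field_simps)
  define V where "V k s u = Vh I (GG I) (ZZ I) (prices I (GG I) (ZZ I) k) s u / (GG I * DD I ^ s)"
      for k s u
  have opt: "optimal_policy (\<lambda>s. eta * y k s) (V k) (learned I k)" for k
    using optimal_best_act[OF G, of "ZZ I" "prices I (GG I) (ZZ I) k"]
    unfolding V_def[abs_def] learned_def by (simp add: price[unfolded of_int_mult])
  note pol = policy_learned
  have prices_nonneg: "0 \<le> prices I (GG I) (ZZ I) k q" for k q
    by (cases k) (simp_all add: price_step_def)
  have y0: "y 0 q = 0" for q by (simp add: y_def)
  have ynn: "0 \<le> y k q" for k q using prices_nonneg D by (simp add: y_def)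
  have ySuc: "y (Suc k) q = max 0 (y k q + (load (learned I k) q - 1))" for k q
  proof -
    have "real_of_int (prices I (GG I) (ZZ I) (Suc k) q) =
        max 0 (prices I (GG I) (ZZ I) k q - DD I ^ B + DD I ^ B * load (learned I k) q)"
      using real_Qh[OF pol roots(1), of _ k q B]
      by (simp add: price_step_def load_def sum_distrib_left of_int_max flip: learned_def)
    also have "\<dots> = DD I ^ B * max 0 (y k q + (load (learned I k) q - 1))"
      using D by (simp add: max_mult_distrib_left y_def algebra_simps)
    finally show ?thesis using D by (simp add: y_def)
  qed
  have eta: "0 \<le> eta" using R0 by (simp add: eta_def)
  \<comment> \<open>The second term turns errors proportional to \<open>R0\<close> into multiples of
    \<open>L\<close>.\<close>
  define L where "L = max (OPT_PolyLP I) (R0 / n)"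
  define dual where "dual k = (\<Sum>s<B. eta * y k s) + (\<Sum>i<n. V k B (root I i))" for k
  \<comment> \<open>The learned policies are optimal at the current prices, so the dual value is
    their reward minus the priced excess load. This makes the excess load the direction of
    descent.\<close>
  have dual_eq: "dual k = total (learned I k) - eta * (\<Sum>q<B. y k q * (load (learned I k) q - 1))"
      for k
  proof -
    have "V k B (root I i) = Ev I (learned I k) (\<lambda>s. rr I) B (root I i) -
        (\<Sum>q<B. eta * y k q * Ev I (learned I k) (at_slot q) B (root I i))" if "i < n" for i
      by (simp only: optimal_policy_Ev[OF opt roots(1)[OF that]] Ev_diff
          Ev_slots[where c = "\<lambda>q. eta * y k q", OF order_refl])
    then have "(\<Sum>i<n. V k B (root I i)) = total (learned I k) -
        (\<Sum>i<n. \<Sum>q<B. eta * y k q * Ev I (learned I k) (at_slot q) B (root I i))"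
      by (simp add: total_def sum_subtractf)
    also have "(\<Sum>i<n. \<Sum>q<B. eta * y k q * Ev I (learned I k) (at_slot q) B (root I i)) =
        (\<Sum>q<B. eta * y k q * load (learned I k) q)"
      by (subst sum.swap) (simp add: load_def sum_distrib_left)
    finally show ?thesis
      by (simp add: dual_def right_diff_distrib sum_subtractf sum_distrib_left mult.assoc)
  qed
  have dual_ge: "L \<le> dual k" for k
  proof -
    have lam: "0 \<le> eta * y k s" for s using eta ynn by simp
    have "OPT_PolyLP I \<le> dual k" unfolding dual_def by (rule OPT_le_dual[OF opt lam])
    \<comment> \<open>Each arm alone is worth no more than the dual value: its priced value is one
      of the summands, and it loses at most the sum of all prices, which is another.\<close>
    moreover have "V0 B (root I i) \<le> dual k" if "i < n" for i
    proof -
      have "V0 B (root I i) \<le> V k B (root I i) + (\<Sum>q<B. eta * y k q)"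
        using optimal_le_priced[OF opt0 opt lam roots(1)[OF that], of B] depth(1)[OF that] by simp
      also have "V k B (root I i) \<le> (\<Sum>i<n. V k B (root I i))"
        using optimal_value_nonneg[OF opt] roots that by (intro member_le_sum) auto
      finally show ?thesis by (simp add: dual_def)
    qed
    then have "R0 \<le> (\<Sum>i<n. dual k)" unfolding R0_def by (intro sum_mono) auto
    then have "R0 / n \<le> dual k" using params_pos by (simp add: field_simps)
    ultimately show ?thesis by (simp add: L_def)
  qed
  have total_le: "total (learned I k) \<le> R0" for k
    unfolding total_def R0_def using Ev_le_optimal[OF opt0 pol] roots by (intro sum_mono) auto
  define c where "c = real (B * n ^ 2)"
  \<comment> \<open>Cutting off at 0 does not increase the square. Expanding it leaves the cross
    term, controlled by \<open>dual_eq\<close>, and a square of at most \<open>n^2\<close> per slot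
    since a load lies between 0 and \<open>n\<close>.\<close>
  have step: "eta * (\<Sum>q<B. (y (Suc k) q)\<^sup>2) \<le> eta * (\<Sum>q<B. (y k q)\<^sup>2) +
      2 * (total (learned I k) - L) + eta * c" for k
  proof -
    let ?l = "\<lambda>q. load (learned I k) q - 1"
    have "(\<Sum>q<B. (y (Suc k) q)\<^sup>2) \<le> (\<Sum>q<B. (y k q)\<^sup>2 + 2 * (y k q * ?l q) + (real n)\<^sup>2)"
    proof (rule sum_mono)
      fix q
      have "\<bar>?l q\<bar> \<le> real n"
        using load_bounds[OF pol, of k q] params_pos(1) by (simp add: abs_le_iff)
      then have "(?l q)\<^sup>2 \<le> (real n)\<^sup>2" by (metis abs_ge_zero power2_abs power_mono)
      moreover have "(y (Suc k) q)\<^sup>2 \<le> (y k q + ?l q)\<^sup>2"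
        unfolding ySuc by (auto simp: max_def)
      moreover have "(y k q + ?l q)\<^sup>2 = (y k q)\<^sup>2 + 2 * (y k q * ?l q) + (?l q)\<^sup>2"
        by (simp only: power2_sum mult.assoc)
      ultimately show "(y (Suc k) q)\<^sup>2 \<le> (y k q)\<^sup>2 + 2 * (y k q * ?l q) + (real n)\<^sup>2"
        by linarith
    qed
    also have "\<dots> = (\<Sum>q<B. (y k q)\<^sup>2) + 2 * (\<Sum>q<B. y k q * ?l q) + c"
      by (simp add: sum.distrib sum_distrib_left c_def)
    finally have "eta * (\<Sum>q<B. (y (Suc k) q)\<^sup>2) \<le>
        eta * ((\<Sum>q<B. (y k q)\<^sup>2) + 2 * (\<Sum>q<B. y k q * ?l q) + c)"
      using eta by (rule mult_left_mono)
    then show ?thesis using dual_eq[of k] dual_ge[of k] by (simp add: algebra_simps)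
  qed
  have regret: "eta * (\<Sum>q<B. (y k q)\<^sup>2) \<le> 2 * ((\<Sum>j<k. total (learned I j)) - k * L)
      + k * (eta * c)" for k
  proof (induction k)
    case (Suc k)
    then show ?case using step[of k] by (simp add: algebra_simps)
  qed (simp add: y0)
  have Lnn: "0 \<le> L" using R0 by (simp add: L_def max.coboundedI2)
  have "eta * c / 2 \<le> 1 / (4 * B) * L"
  proof -
    have "eta * c / 2 = R0 / n / (4 * B)"
      using params_pos by (simp add: eta_def c_def HH_def field_simps power2_eq_square
          power3_eq_cube)
    also have "\<dots> \<le> L / (4 * B)" by (intro divide_right_mono) (auto simp: L_def)
    finally show ?thesis by simp
  qed
  then have "K * (eta * c / 2) \<le> K * (1 / (4 * B) * L)" by (rule mult_left_mono) simp
  then have "K * (eta * c) / 2 \<le> K * (1 / (4 * B) * L)" by simp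
  moreover have "0 \<le> eta * (\<Sum>q<B. (y K q)\<^sup>2)" using eta by (simp add: sum_nonneg)
  ultimately have reward: "(1 - 1 / (4 * B)) * L * K \<le> (\<Sum>k<K. total (learned I k))"
    using regret[of K] by (simp add: algebra_simps)
  have loads: "(\<Sum>k<K. load (learned I k) q) \<le> (1 + 1 / (4 * B)) * K" if "L \<noteq> 0" "q < B" for q
  proof -
    \<comment> \<open>For \<open>R0 = 0\<close> the first dual value would be 0, which forces
      \<open>L = 0\<close>.\<close>
    have "0 < R0"
    proof (rule ccontr)
      assume "\<not> 0 < R0"
      then have "R0 = 0" using R0 by simp
      then have "dual 0 = 0"
        using dual_eq[of 0] total_le[of 0] Lnn dual_ge[of 0] by (simp add: y0)
      then show False using dual_ge[of 0] Lnn \<open>L \<noteq> 0\<close> by simp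
    qed
    then have eta': "0 < eta" using H by (simp add: eta_def)
    have R0_eta: "R0 = eta * HH I" using H by (simp add: eta_def)
    have "eta * (y K q)\<^sup>2 \<le> eta * (\<Sum>q<B. (y K q)\<^sup>2)"
      using eta \<open>q < B\<close> by (intro mult_left_mono member_le_sum) auto
    also have "\<dots> \<le> 2 * (K * R0) + K * (eta * c)"
    proof -
      have "(\<Sum>k<K. total (learned I k)) \<le> (\<Sum>k<K. R0)" using total_le by (intro sum_mono)
      moreover have "0 \<le> K * L" using Lnn by simp
      ultimately show ?thesis using regret[of K] by simp
    qed
    also have "\<dots> = eta * (K * (2 * HH I + c))" by (simp add: R0_eta algebra_simps)
    finally have "(y K q)\<^sup>2 \<le> K * (2 * HH I + c)" using eta' by simp
    also have "\<dots> = (K / (4 * B))\<^sup>2"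
      using params_pos by (simp add: K_def KK_def c_def field_simps power2_eq_square)
    finally have y_le: "y K q \<le> K / (4 * B)" by (rule power2_le_imp_le) simp
    \<comment> \<open>A price accumulates the excess loads of its slot, and the projection can only
      add to it. A small final price therefore bounds the total excess.\<close>
    have "(\<Sum>j<k. load (learned I j) q - 1) \<le> y k q" for k
      by (induction k) (auto simp: y0 ySuc max_def)
    from order_trans[OF this y_le] show ?thesis by (simp add: sum_subtractf algebra_simps)
  qed
  show ?thesis
    by (rule that[of L]) (use Lnn reward loads in \<open>auto simp: L_def K_def\<close>)
qed

end

section \<open>The potential of a partial run\<close>

text \<open>The slot of the next pull plus 1, or 0 if there is none. Idling leaves the node
  unchanged, so the next pull of a waiting arm is known in advance.\<close>

primrec nx :: "(nat \<Rightarrow> nat \<Rightarrow> int) \<Rightarrow> nat \<Rightarrow> nat \<Rightarrow> nat" where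
  "nx act 0 u = 0"
| "nx act (Suc s) u = (if act s u < 0 then nx act s u else Suc s)"

text \<open>\<open>c\<close> is the number of earlier pulls of the arm and \<open>k\<close> the key of the last one.\<close>

definition newkey :: "mab \<Rightarrow> nat \<Rightarrow> nat \<Rightarrow> nat \<Rightarrow> nat \<Rightarrow> nat" where
  "newkey I s u c k = (if \<not> bridge I u \<and> 2 * c \<le> horizon I - s then horizon I - s else k)"

text \<open>\<open>Ev\<close> with pull count and last key carried along, so that gains may depend
  on the key of a pull.\<close>

primrec Gf :: "mab \<Rightarrow> (nat \<Rightarrow> nat \<Rightarrow> int) \<Rightarrow> (nat \<Rightarrow> nat \<Rightarrow> nat \<Rightarrow> nat \<Rightarrow> real)
    \<Rightarrow> nat \<Rightarrow> nat \<Rightarrow> nat \<Rightarrow> nat \<Rightarrow> real"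
  where
  "Gf I act g 0 = (\<lambda>u c k. 0)"
| "Gf I act g (Suc s) = (\<lambda>u c k. if act s u < 0 then Gf I act g s u c k
     else g (newkey I s u c k) s u (nat (act s u)) +
       (\<Sum>v<nodes I. rp I u (nat (act s u)) v * Gf I act g s v (Suc c) (newkey I s u c k)))"

text \<open>
  A pull with key \<open>k\<close> is late only if the weights \<open>coef I k s\<close> of the pulls of the other arms sum
  up to at least 1: these then make up at least \<open>k / 2\<close> pulls before own time \<open>k\<close>, or one of the
  other arms is inside a run through bridge nodes at own time \<open>k\<close>.
\<close>

definition coef :: "mab \<Rightarrow> nat \<Rightarrow> nat \<Rightarrow> real" where
  "coef I k s = (if horizon I - s < k then 2 / real k else if horizon I - s = k then 1 else 0)"

text \<open>
  \<open>arem\<close> is the number of slots left to the arm in its own time, and \<open>apast k\<close> the sum of the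
  weights \<open>coef I k s\<close> of its pulls so far.
\<close>

record arm =
  apol :: nat
  arem :: nat
  anode :: nat
  acount :: nat
  akey :: nat
  apast :: "nat \<Rightarrow> real"

text \<open>Numbers from \<open>KK I\<close> on stand for sitting out; the initial draw below
  \<open>6 * KK I\<close> thus takes part with probability 1/6.\<close>

definition pol :: "mab \<Rightarrow> nat \<Rightarrow> nat \<Rightarrow> nat \<Rightarrow> int" where
  "pol I z = (if z < KK I then learned I z else (\<lambda>s u. -1))"

definition next_slot :: "mab \<Rightarrow> arm \<Rightarrow> nat" where
  "next_slot I a = nx (pol I (apol a)) (arem a) (anode a)"

text \<open>0 marks a pull that inherits its key or is forced: the previous pull of the arm had the
  smallest key of all, so the next one with this key comes at once. \<open>horizon I + 1\<close>
  marks an arm with nothing left to do.\<close>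

definition prio :: "mab \<Rightarrow> arm \<Rightarrow> nat" where
  "prio I a = (if bridge I (anode a) then 0 else if next_slot I a = 0 then horizon I + 1
     else if 2 * acount a \<le> horizon I + 1 - next_slot I a then horizon I + 1 - next_slot I a else
         0)"

definition pending_key :: "mab \<Rightarrow> arm \<Rightarrow> nat" where
  "pending_key I a = (if prio I a = 0 then akey a else prio I a)"

definition action :: "mab \<Rightarrow> arm \<Rightarrow> nat" where
  "action I a = (if bridge I (anode a) then default I else nat (pol I (apol a) (next_slot I a - 1)
      (anode a)))"

text \<open>An arm can enter a bridge node with its last own slot. The forced pulls after that lie
  outside its own time and change neither key nor weights.\<close>

definition move :: "mab \<Rightarrow> arm \<Rightarrow> nat \<Rightarrow> arm" where
  "move I a v = \<lparr>apol = apol a, arem = next_slot I a - 1, anode = v, acount = Suc (acount a),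
     akey = (if next_slot I a = 0 then akey a
       else newkey I (next_slot I a - 1) (anode a) (acount a) (akey a)),
     apast = (if next_slot I a = 0 then apast a
       else (\<lambda>k. apast a k + coef I k (next_slot I a - 1)))\<rparr>"

definition start :: "mab \<Rightarrow> nat \<Rightarrow> nat \<Rightarrow> arm" where
  "start I i z = \<lparr>apol = z, arem = horizon I, anode = root I i, acount = 0, akey = 0, apast =
      (\<lambda>k. 0)\<rparr>"

text \<open>The expected reward still to come from pulls with key \<open>k\<close>.\<close>

definition gam :: "mab \<Rightarrow> arm \<Rightarrow> nat \<Rightarrow> real" where
  "gam I a k = Gf I (pol I (apol a)) (\<lambda>k' s u x. rr I u x * of_bool (k' = k))
     (arem a) (anode a) (acount a) (akey a)"

text \<open>The conditional expectation, given the past, of the total weight of the pulls of the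
  arm; it is a martingale.\<close>

definition omg :: "mab \<Rightarrow> arm \<Rightarrow> nat \<Rightarrow> real" where
  "omg I a k = apast a k + Gf I (pol I (apol a)) (\<lambda>k' s u x. coef I k s)
     (arem a) (anode a) (acount a) (akey a)"

text \<open>The reward still to come with key \<open>k\<close>, times the bound that Markov's
  inequality gives for the probability of being in time. Only data of different arms are multiplied
  with each other.\<close>

definition Pot :: "mab \<Rightarrow> (nat \<Rightarrow> nat \<Rightarrow> real) \<Rightarrow> (nat \<Rightarrow> nat \<Rightarrow> real) \<Rightarrow> real" where
  "Pot I g w = (\<Sum>i<arms I. \<Sum>k\<in>{1..horizon I}. g i k * (1 - (\<Sum>j\<in>{..<arms I} - {i}. w j k)))"

section \<open>The potential as an affine function of the data of one arm\<close>

lemma nx_le: "nx act s u \<le> s"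
  by (induction s) auto

lemma nx_Suc: "nx act s u = Suc s' \<Longrightarrow> 0 \<le> act s' u \<and> s' < s"
  by (induction s) (auto split: if_splits)

lemma Gf_nx: "Gf I act g s u c k = Gf I act g (nx act s u) u c k"
  by (induction s) auto

lemma Gf_eq_Ev: "Gf I act (\<lambda>k. g) s u c k = Ev I act g s u"
  by (induction s arbitrary: u c k) auto

lemma Pot_affine:
  assumes "i < arms I"
  shows "Pot I (g(i := g')) (w(i := w')) = (\<Sum>k\<in>{1..horizon I}.
    g' k * (1 - (\<Sum>j\<in>{..<arms I} - {i}. w j k)) +
    (\<Sum>l\<in>{..<arms I} - {i}. g l k * (1 - (\<Sum>j\<in>{..<arms I} - {l} - {i}. w j k))) -
    (\<Sum>l\<in>{..<arms I} - {i}. g l k) * w' k)"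
proof -
  let ?n = "{..<arms I}" and ?K = "{1..horizon I}"
  have "Pot I (g(i := g')) (w(i := w')) =
      (\<Sum>k\<in>?K. g' k * (1 - (\<Sum>j\<in>?n - {i}. (w(i := w')) j k))) +
      (\<Sum>l\<in>?n - {i}. \<Sum>k\<in>?K. g l k * (1 - (\<Sum>j\<in>?n - {l}. (w(i := w')) j k)))"
    unfolding Pot_def using assms by (subst sum.remove[of _ i]) auto
  also have "(\<Sum>k\<in>?K. g' k * (1 - (\<Sum>j\<in>?n - {i}. (w(i := w')) j k))) =
      (\<Sum>k\<in>?K. g' k * (1 - (\<Sum>j\<in>?n - {i}. w j k)))"
    by (intro sum.cong refl arg_cong2[of _ _ _ _ "(*)"] arg_cong2[of _ _ _ _ "(-)"]) auto
  also have "(\<Sum>l\<in>?n - {i}. \<Sum>k\<in>?K. g l k * (1 - (\<Sum>j\<in>?n - {l}. (w(i := w')) j k))) =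
      (\<Sum>l\<in>?n - {i}. \<Sum>k\<in>?K. g l k * (1 - (\<Sum>j\<in>?n - {l} - {i}. w j k)) - g l k * w' k)"
  proof (intro sum.cong refl)
    fix l k assume "l \<in> ?n - {i}"
    then have "(\<Sum>j\<in>?n - {l}. (w(i := w')) j k) = w' k + (\<Sum>j\<in>?n - {l} - {i}. (w(i := w')) j k)"
      using assms by (subst sum.remove[of _ i]) auto
    also have "(\<Sum>j\<in>?n - {l} - {i}. (w(i := w')) j k) = (\<Sum>j\<in>?n - {l} - {i}. w j k)"
      by (intro sum.cong) auto
    finally show "g l k * (1 - (\<Sum>j\<in>?n - {l}. (w(i := w')) j k)) =
        g l k * (1 - (\<Sum>j\<in>?n - {l} - {i}. w j k)) - g l k * w' k"
      by (simp add: algebra_simps)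
  qed
  also have "\<dots> = (\<Sum>k\<in>?K. (\<Sum>l\<in>?n - {i}. g l k * (1 - (\<Sum>j\<in>?n - {l} - {i}. w j k))) -
      (\<Sum>l\<in>?n - {i}. g l k) * w' k)"
    by (subst sum.swap) (simp add: sum_subtractf sum_distrib_right)
  finally show ?thesis by (simp only: sum.distrib sum_subtractf add_diff_eq)
qed

text \<open>Affine functions commute with averaging. This is applied to the random choice of a
  policy and to every transition.\<close>

lemma Pot_average:
  assumes i: "i < arms I" and p: "(\<Sum>v\<in>S. p v) = 1"
    and g: "\<And>k. g i k = (\<Sum>v\<in>S. p v * g' v k)" and w: "\<And>k. w i k = (\<Sum>v\<in>S. p v * w' v k)"
  shows "Pot I g w = (\<Sum>v\<in>S. p v * Pot I (g(i := g' v)) (w(i := w' v)))"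
proof -
  define C where "C k = 1 - (\<Sum>j\<in>{..<arms I} - {i}. w j k)" for k
  define D where "D k = (\<Sum>l\<in>{..<arms I} - {i}. g l k * (1 - (\<Sum>j\<in>{..<arms I} - {l} - {i}. w j k)))"
      for k
  define E where "E k = (\<Sum>l\<in>{..<arms I} - {i}. g l k)" for k
  have *: "Pot I (g(i := g')) (w(i := w')) = (\<Sum>k\<in>{1..horizon I}. g' k * C k + D k - E k * w' k)"
      for g' w'
    unfolding C_def D_def E_def by (rule Pot_affine[OF i])
  have "(\<Sum>v\<in>S. p v * Pot I (g(i := g' v)) (w(i := w' v))) =
      (\<Sum>k\<in>{1..horizon I}. \<Sum>v\<in>S. p v * g' v k * C k + p v * D k - E k * (p v * w' v k))"
    unfolding * by (subst sum.swap) (simp add: sum_distrib_left algebra_simps)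
  also have "\<dots> = (\<Sum>k\<in>{1..horizon I}. g i k * C k + D k - E k * w i k)"
    using p by (simp add: g w sum.distrib sum_subtractf flip: sum_distrib_left sum_distrib_right)
  also have "\<dots> = Pot I g w" using *[of "g i" "w i"] by simp
  finally show ?thesis by simp
qed

text \<open>The factor of a reward in the potential is at most 1, so removing the reward just earned
  costs at most that reward.\<close>

lemma Pot_reward:
  assumes i: "i < arms I" and r: "0 \<le> r" and w: "\<And>j k. 0 \<le> w j k"
  shows "Pot I g w \<le> r + Pot I (g(i := \<lambda>k. g i k - r * of_bool (k' = k))) w"
proof -
  define C where "C k = 1 - (\<Sum>j\<in>{..<arms I} - {i}. w j k)" for k
  define D where "D k = (\<Sum>l\<in>{..<arms I} - {i}. g l k * (1 - (\<Sum>j\<in>{..<arms I} - {l} - {i}. w j k)))"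
      for k
  define E where "E k = (\<Sum>l\<in>{..<arms I} - {i}. g l k)" for k
  have *: "Pot I (g(i := g')) (w(i := w')) = (\<Sum>k\<in>{1..horizon I}. g' k * C k + D k - E k * w' k)"
      for g' w'
    unfolding C_def D_def E_def by (rule Pot_affine[OF i])
  have C: "C k \<le> 1" for k unfolding C_def using w by (simp add: sum_nonneg)
  have "(\<Sum>k\<in>{1..horizon I}. r * of_bool (k' = k) * C k) \<le> (\<Sum>k\<in>{1..horizon I}. r * of_bool (k' = k)
      * 1)"
    using r C by (intro sum_mono mult_left_mono) auto
  also have "\<dots> = r * (\<Sum>k\<in>{1..horizon I}. if k = k' then 1 else 0)"
    unfolding sum_distrib_left by (intro sum.cong) auto
  also have "\<dots> \<le> r" using r by (simp add: sum.delta)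
  finally have le: "(\<Sum>k\<in>{1..horizon I}. r * of_bool (k' = k) * C k) \<le> r" .
  have "Pot I g w = (\<Sum>k\<in>{1..horizon I}. g i k * C k + D k - E k * w i k)"
    using *[of "g i" "w i"] by simp
  moreover have "Pot I (g(i := \<lambda>k. g i k - r * of_bool (k' = k))) w =
      (\<Sum>k\<in>{1..horizon I}. g i k * C k + D k - E k * w i k) - (\<Sum>k\<in>{1..horizon I}. r * of_bool (k' =
          k) * C k)"
    using *[of "\<lambda>k. g i k - r * of_bool (k' = k)" "w i"]
    by (simp add: algebra_simps flip: sum_subtractf)
  ultimately show ?thesis using le by simp
qed

context superprocess_instance
begin

text \<open>
  The essential invariant is the last but one: for every key \<open>k\<close> from the last one on, the pulls
  of the arm so far weigh at least 1 or have all happened up to own time \<open>k\<close>.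
\<close>

definition arm_ok :: "arm \<Rightarrow> bool" where
  "arm_ok a \<longleftrightarrow> anode a < N \<and> depth (anode a) \<le> acount a \<and> arem a \<le> B \<and>
     (bridge I (anode a) \<longrightarrow> apol a < KK I \<and> 1 \<le> acount a) \<and>
     akey a \<le> B - arem a \<and> (arem a = 0 \<or> akey a + 2 * acount a \<le> 2 * (B + 1 - arem a)) \<and>
     (acount a = 0 \<or> 1 \<le> akey a) \<and> (\<forall>k. 0 \<le> apast a k) \<and>
     (\<forall>k. 1 \<le> k \<longrightarrow> k \<le> B \<longrightarrow> akey a \<le> k \<longrightarrow>
        1 \<le> apast a k \<or> (B - arem a \<le> k \<and> min 1 (2 / real k) * acount a \<le> apast a k)) \<and>
     (1 \<le> acount a \<longrightarrow> 1 \<le> apast a (B - arem a))"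

section \<open>A single arm: its invariant and its expected reward and weight\<close>

lemma pol_bridge:
  assumes "z < KK I" "u < N" "bridge I u"
  shows "pol I z s u = int (default I)"
  using policy_learned[of z] assms by (simp add: pol_def policy_def)

lemma nx_bridge:
  assumes "z < KK I" "u < N" "bridge I u"
  shows "nx (pol I z) s u = s"
  by (cases s) (simp_all add: pol_bridge[OF assms])

lemma next_slot_Suc:
  assumes "next_slot I a = Suc s"
  shows "apol a < KK I" "0 \<le> pol I (apol a) s (anode a)" "s < arem a"
  using nx_Suc[OF assms[unfolded next_slot_def]] by (auto simp: pol_def split: if_splits)

lemma next_slot_bridge: "arm_ok a \<Longrightarrow> bridge I (anode a) \<Longrightarrow> next_slot I a = arem a"
  by (simp add: next_slot_def arm_ok_def nx_bridge)

lemma prio_le_horizon: "prio I a \<le> B \<longleftrightarrow> bridge I (anode a) \<or> next_slot I a \<noteq> 0"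
  by (auto simp: prio_def)

lemma action_less:
  assumes "arm_ok a" "prio I a \<le> B"
  shows "action I a < A"
proof (cases "bridge I (anode a)")
  case False
  then obtain s where s: "next_slot I a = Suc s"
    using assms(2) by (auto simp: prio_le_horizon gr0_conv_Suc)
  then show ?thesis
    using policy_action(1)[OF policy_learned, of "anode a" "apol a"
        s] next_slot_Suc[OF s] assms(1) False
    by (simp add: action_def arm_ok_def pol_def not_less)
qed (use params_pos in \<open>simp add: action_def\<close>)

lemma akey_move:
  assumes "arm_ok a" "prio I a \<le> B"
  shows "akey (move I a v) = pending_key I a"
proof (cases "next_slot I a")
  case (Suc s)
  moreover have "arem a \<le> B" using assms(1) by (simp add: arm_ok_def)
  ultimately show ?thesis using next_slot_Suc(3)[OF Suc]
    by (auto simp: move_def pending_key_def prio_def newkey_def)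
next
  case 0
  then show ?thesis using assms by (auto simp: move_def pending_key_def prio_def split: if_splits)
qed

lemma akey_le_pending_key: "arm_ok a \<Longrightarrow> akey a \<le> pending_key I a"
  using nx_le[of "pol I (apol a)" "arem a" "anode a"]
  by (auto simp: pending_key_def prio_def arm_ok_def next_slot_def)

text \<open>The delicate case is a pull at own time \<open>t\<close> beyond some \<open>x\<close>
  that is at least its key. Such a pull has inherited its key, either because more than
  \<open>x / 2\<close> pulls came before or because the arm is inside a bridge run. Either way the
  weight at \<open>x\<close> has already reached 1.\<close>

lemma move_ok:
  assumes a: "arm_ok a" and p: "prio I a \<le> B" and v: "v < N" "0 < trans I (anode a) (action I a) v"
  shows "arm_ok (move I a v)"
proof -
  define s u c k w where d: "s = arem a" "u = anode a" "c = acount a" "k = akey a" "w = apast a"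
  have ok: "u < N" "depth u \<le> c" "s \<le> B" "bridge I u \<Longrightarrow> apol a < KK I \<and> 1 \<le> c" "k \<le> B - s"
    "s = 0 \<or> k + 2 * c \<le> 2 * (B + 1 - s)" "c = 0 \<or> 1 \<le> k" "\<And>x. 0 \<le> w x"
    "\<And>x. 1 \<le> x \<Longrightarrow> x \<le> B \<Longrightarrow> k \<le> x \<Longrightarrow> 1 \<le> w x \<or> (B - s \<le> x \<and> min 1 (2 / real x) * c \<le> w x)"
    "1 \<le> c \<Longrightarrow> 1 \<le> w (B - s)"
    using a unfolding arm_ok_def d by blast+
  have dv: "depth v \<le> Suc c"
    using depth(2)[OF ok(1) action_less[OF a p] v(1)] v(2) ok(2) by (simp add: d)
  show ?thesis
  proof (cases "next_slot I a")
    \<comment> \<open>The forced pull lies beyond own time and adds no weight. The last own pull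
      happened at own time \<open>B\<close> and weighs 1 there, while below \<open>B\<close> the
      second alternative of the invariant is impossible.\<close>
    case 0
    then have br: "bridge I u" using p by (simp add: prio_le_horizon d)
    then have s: "s = 0" using next_slot_bridge[OF a] 0 by (simp add: d)
    have wB: "1 \<le> w B" using ok(10) ok(4)[OF br] s by simp
    have w1: "1 \<le> w x" if "1 \<le> x" "x \<le> B" "k \<le> x" for x
      using ok(9)[OF that] wB s that by (cases "x = B") auto
    have "move I a v = \<lparr>apol = apol a, arem = 0, anode = v, acount = Suc c, akey = k, apast = w\<rparr>"
      using 0 by (simp add: move_def d)
    then show ?thesis
      using ok(4)[OF br] ok(5,7,8) dv v(1) wB w1 s by (simp add: arm_ok_def)
  next
    case (Suc s')
    note ns = next_slot_Suc[OF Suc]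
    have s': "s' < s" "s' < B" using ns(3) ok(3) by (auto simp: d)
    define t where "t = B - s'"
    have t: "1 \<le> t" "B - s < t" "t \<le> B" "B + 1 - s \<le> t" using s' ok(3) by (auto simp: t_def)
    define k' where "k' = newkey I s' u c k"
    have k': "k' = t \<and> \<not> bridge I u \<and> 2 * c \<le> t \<or> k' = k \<and> (bridge I u \<or> t < 2 * c)"
      by (auto simp: k'_def newkey_def t_def)
    define w' where "w' x = w x + coef I x s'" for x
    have coef: "coef I x s' = (if t < x then 2 / real x else if t = x then 1 else 0)" for x
      by (simp add: coef_def t_def)
    have w'ge: "w x \<le> w' x" for x by (simp add: w'_def coef)
    have mv: "move I a v = \<lparr>apol = apol a, arem = s', anode = v, acount = Suc c, akey = k',
        apast = w'\<rparr>"
      using Suc by (simp add: move_def d k'_def w'_def[abs_def])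
    have A: "1 \<le> w' x \<or> (t \<le> x \<and> min 1 (2 / real x) * Suc c \<le> w' x)"
      if x: "1 \<le> x" "x \<le> B" "k' \<le> x" for x
    proof -
      have kx: "k \<le> x" using x(3) k' ok(5) t by auto
      show ?thesis
      proof (cases "1 \<le> w x")
        case True
        then show ?thesis using w'ge[of x] by linarith
      next
        case False
        then have *: "B - s \<le> x" "min 1 (2 / real x) * c \<le> w x" using ok(9)[OF x(1,2) kx] by auto
        show ?thesis
        proof (cases "t \<le> x")
          case True
          \<comment> \<open>The minimum matters for \<open>x = 1\<close>, where \<open>2 / x\<close>
            exceeds the weight 1 of a pull at own time 1.\<close>
          then have "min 1 (2 / real x) \<le> coef I x s'" by (auto simp: coef)
          then have "min 1 (2 / real x) * Suc c \<le> w' x"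
            using *(2) by (simp add: w'_def algebra_simps)
          then show ?thesis using True by blast
        next
          case tx: False
          then have "bridge I u \<or> t < 2 * c" using k' x(3) by auto
          then have "1 \<le> w x"
          proof
            assume br: "bridge I u"
            then have "s = Suc s'" using next_slot_bridge[OF a] Suc by (simp add: d)
            \<comment> \<open>A bridge run leaves no gap in own time, so \<open>x\<close> can only
              be the own time of the previous pull, which by itself weighs 1 at
              \<open>x\<close>.\<close>
            then have "x = B - s" using *(1) tx t(2) s' ok(3) by (auto simp: t_def)
            then show ?thesis using ok(10) ok(4)[OF br] by simp
          next
            assume c: "t < 2 * c"
            then have "x < 2 * c" "1 \<le> c" using tx by auto
            then have "1 \<le> min 1 (2 / real x) * c" using x(1) by (auto simp: min_def field_simps)
            then show ?thesis using *(2) by linarith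
          qed
          then show ?thesis using False by simp
        qed
      qed
    qed
    have "1 \<le> w' t" using ok(8)[of t] by (simp add: w'_def coef)
    moreover have "k' \<le> t" using k' ok(5) t by auto
    \<comment> \<open>A fresh key satisfies \<open>2 * c <= t\<close> by definition. For an
      inherited one, own time has advanced by at least 1, which pays for the additional
      pull.\<close>
    moreover have "s' = 0 \<or> k' + 2 * Suc c \<le> 2 * (B + 1 - s')"
    proof -
      have "B + 1 - s' = t + 1" using s' by (simp add: t_def)
      moreover have "k + 2 * c \<le> 2 * t" using ok(6) s' t(4) by auto
      ultimately show ?thesis using k' by auto
    qed
    moreover have "1 \<le> k'" using k' t(1) ok(4,7) by auto
    moreover have "0 \<le> w' x" for x using ok(8)[of x] w'ge[of x] by linarith
    ultimately show ?thesis
      using A dv v(1) ns(1) s' by (simp add: arm_ok_def mv t_def)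
  qed
qed

text \<open>A forced pull after the last own slot is not credited with its reward; the analysis
  gives that reward away.\<close>

lemma gam_move:
  assumes "arm_ok a" "prio I a \<le> B"
  shows "gam I a k = rr I (anode a) (action I a) * of_bool (next_slot I a \<noteq> 0 \<and> pending_key I a =
      k) +
    (\<Sum>v<N. rp I (anode a) (action I a) v * gam I (move I a v) k)"
proof (cases "next_slot I a")
  case 0
  then have "gam I a k = 0" "gam I (move I a v) k = 0" for v
    unfolding gam_def by (subst Gf_nx, simp add: next_slot_def, simp add: move_def 0)
  then show ?thesis using 0 by simp
next
  case (Suc s)
  note ns = next_slot_Suc[OF Suc]
  have act: "action I a = nat (pol I (apol a) s (anode a))"
    using Suc assms(1) ns(1) by (auto simp: action_def pol_bridge arm_ok_def)
  have key: "newkey I s (anode a) (acount a) (akey a) = pending_key I a"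
    using akey_move[OF assms] Suc by (simp add: move_def)
  show ?thesis unfolding gam_def
    by (subst Gf_nx) (use Suc ns(2) key in \<open>simp add: act move_def flip: next_slot_def\<close>)
qed

text \<open>The martingale property: a pull moves its weight from the expected future to the past.
  The depth condition ensures that the transition probabilities sum to 1.\<close>

lemma omg_move:
  assumes "arm_ok a" "prio I a \<le> B" "depth (anode a) < B"
  shows "omg I a k = (\<Sum>v<N. rp I (anode a) (action I a) v * omg I (move I a v) k)"
proof -
  let ?p = "rp I (anode a) (action I a)"
  have sum1: "(\<Sum>v<N. ?p v) = 1"
    using assms action_less[OF assms(1,2)] by (intro sum_rp) (auto simp: arm_ok_def)
  show ?thesis
  proof (cases "next_slot I a")
    case 0
    then have "omg I a k = apast a k" "omg I (move I a v) k = apast a k" for v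
      unfolding omg_def by (subst Gf_nx, simp add: next_slot_def, simp add: move_def 0)
    then show ?thesis using sum1 by (simp flip: sum_distrib_right)
  next
    case (Suc s)
    note ns = next_slot_Suc[OF Suc]
    have act: "action I a = nat (pol I (apol a) s (anode a))"
      using Suc assms(1) ns(1) by (auto simp: action_def pol_bridge arm_ok_def)
    have mv: "omg I (move I a v) k = (apast a k + coef I k s) + Gf I (pol I (apol a))
        (\<lambda>k' s u x. coef I k s)
        s v (Suc (acount a)) (newkey I s (anode a) (acount a) (akey a))" for v
      using Suc by (simp add: omg_def move_def)
    have "(\<Sum>v<N. ?p v * omg I (move I a v) k) = (apast a k + coef I k s) * (\<Sum>v<N. ?p v) +
        (\<Sum>v<N. ?p v * Gf I (pol I (apol a)) (\<lambda>k' s u x. coef I k s)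
        s v (Suc (acount a)) (newkey I s (anode a) (acount a) (akey a)))"
      unfolding mv by (simp add: algebra_simps sum.distrib sum_distrib_left)
    moreover have "omg I a k = apast a k + (coef I k s +
        (\<Sum>v<N. ?p v * Gf I (pol I (apol a)) (\<lambda>k' s u x. coef I k s)
        s v (Suc (acount a)) (newkey I s (anode a) (acount a) (akey a))))"
      unfolding omg_def by (subst Gf_nx) (use Suc ns(2) in \<open>simp add: act flip: next_slot_def\<close>)
    ultimately show ?thesis using sum1 by simp
  qed
qed

lemma Gf_nonneg:
  assumes "u < N" "\<And>k s u a. u < N \<Longrightarrow> a < A \<Longrightarrow> 0 \<le> g k s u a"
  shows "0 \<le> Gf I (pol I z) g s u c k"
proof (cases "z < KK I")
  case True
  then have pol: "policy I (pol I z)" using policy_learned by (simp add: pol_def)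
  show ?thesis using assms(1)
  proof (induction s arbitrary: u c k)
    case (Suc s)
    then show ?case
      using policy_action(1)[OF pol Suc.prems, of s] assms(2)
      by (auto intro!: add_nonneg_nonneg sum_nonneg mult_nonneg_nonneg rp_nonneg)
  qed simp
next
  case False
  then have "Gf I (pol I z) g s u c k = 0" by (induction s) (simp_all add: pol_def)
  then show ?thesis by simp
qed

lemma gam_nonneg: "arm_ok a \<Longrightarrow> 0 \<le> gam I a k"
  unfolding gam_def by (intro Gf_nonneg mult_nonneg_nonneg rr_nonneg) (simp_all add: arm_ok_def)

lemma omg_ge_past: "arm_ok a \<Longrightarrow> apast a k \<le> omg I a k"
  unfolding omg_def using Gf_nonneg[of "anode a" "\<lambda>k' s u x. coef I k s"]
  by (simp add: arm_ok_def coef_def)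

lemma omg_nonneg: "arm_ok a \<Longrightarrow> 0 \<le> omg I a k"
  using omg_ge_past[of a k] by (auto simp: arm_ok_def intro: order_trans)

text \<open>Keys never decrease along a trajectory, so reward with key \<open>x'\<close> lies ahead
  only if the next key is at most \<open>x'\<close>. A pull with this key at own time
  \<open>t\<close> after \<open>c'\<close> earlier pulls has \<open>x' + 2 * c' <= 2 * t\<close>,
  and \<open>t <= B\<close>, \<open>c <= c'\<close>.\<close>

lemma Gf_key:
  assumes "Gf I act (\<lambda>k' s u x. rr I u x * of_bool (k' = x')) s u c k \<noteq> 0"
    "s \<le> B" "k \<le> B - s" "s = 0 \<or> k + 2 * c \<le> 2 * (B + 1 - s)" "c = 0 \<or> 1 \<le> k"
    "bridge I u \<longrightarrow> 1 \<le> c"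
  shows "\<exists>s'. nx act s u = Suc s' \<and> newkey I s' u c k \<le> x' \<and> 1 \<le> x' \<and> x' \<le> B \<and> x' + 2 * c \<le> 2 * B"
  using assms
proof (induction s arbitrary: u c k)
  case (Suc s)
  show ?case
  proof (cases "act s u < 0")
    case True
    then have "Gf I act (\<lambda>k' s u x. rr I u x * of_bool (k' = x')) s u c k \<noteq> 0"
      using Suc.prems(1) by simp
    moreover have "s \<le> B" "k \<le> B - s" "s = 0 \<or> k + 2 * c \<le> 2 * (B + 1 - s)"
      using Suc.prems(2-4) by auto
    ultimately have "\<exists>s'. nx act s u = Suc s' \<and> newkey I s' u c k \<le> x' \<and> 1 \<le> x' \<and> x' \<le> B \<and>
        x' + 2 * c \<le> 2 * B"
      using Suc.prems(5,6) by (rule Suc.IH)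
    then show ?thesis using True by simp
  next
    case False
    define k' where "k' = newkey I s u c k"
    have k': "k' = B - s \<and> \<not> bridge I u \<and> 2 * c \<le> B - s \<or> k' = k \<and> (bridge I u \<or> B - s < 2 * c)"
      by (auto simp: k'_def newkey_def)
    have k'1: "1 \<le> k'" "k' \<le> B - s" "k' + 2 * c \<le> 2 * (B - s)"
      using k' Suc.prems(2-6) by auto
    have nxs: "nx act (Suc s) u = Suc s" using False by simp
    from Suc.prems(1) False have "k' = x' \<or>
        (\<exists>v<N. Gf I act (\<lambda>k' s u x. rr I u x * of_bool (k' = x')) s v (Suc c) k' \<noteq> 0)"
      by (auto simp: k'_def[symmetric] dest!: sum.not_neutral_contains_not_neutral)
    then show ?thesis
    proof
      assume "k' = x'"
      moreover have "k' \<le> B" "k' + 2 * c \<le> 2 * B" using k'1 by linarith+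
      ultimately show ?thesis using k'1 nxs
        by (intro exI[of _ s]) (simp add: k'_def[symmetric] del: nx.simps)
    next
      assume "\<exists>v<N. Gf I act (\<lambda>k' s u x. rr I u x * of_bool (k' = x')) s v (Suc c) k' \<noteq> 0"
      then obtain v where "v < N" "Gf I act (\<lambda>k' s u x. rr I u x * of_bool (k' = x')) s v (Suc c)
          k' \<noteq> 0"
        by blast
      moreover have "k' + 2 * Suc c \<le> 2 * (B + 1 - s)"
        using k'1(3) Suc.prems(2) by (simp add: Suc_diff_le)
      ultimately obtain s' where
        *: "nx act s v = Suc s'" "newkey I s' v (Suc c) k' \<le> x'" "1 \<le> x'" "x' \<le> B"
            "x' + 2 * Suc c \<le> 2 * B"
        using Suc.IH[of v "Suc c" k'] Suc.prems(2) k'1(1,2) by auto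
      have "k' \<le> newkey I s' v (Suc c) k'" using k'1(2) nx_Suc[OF *(1)] by (auto simp: newkey_def)
      then show ?thesis using * nxs by (intro exI[of _ s])
          (simp add: k'_def[symmetric] del: nx.simps)
    qed
  qed
qed simp

lemma gam_neq_0:
  assumes "arm_ok a" "gam I a k \<noteq> 0"
  shows "prio I a \<le> B" "pending_key I a \<le> k" "1 \<le> k" "k \<le> B" "k + 2 * acount a \<le> 2 * B"
proof -
  have "\<exists>s'. next_slot I a = Suc s' \<and> newkey I s' (anode a) (acount a) (akey a) \<le> k \<and> 1 \<le> k \<and> k \<le>
      B \<and>
      k + 2 * acount a \<le> 2 * B"
    unfolding next_slot_def
    by (rule Gf_key[OF assms(2)[unfolded gam_def]]) (use assms(1) in \<open>auto simp: arm_ok_def\<close>)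
  then obtain s' where s': "next_slot I a = Suc s'" "newkey I s' (anode a) (acount a) (akey a) \<le> k"
    "1 \<le> k" "k \<le> B" "k + 2 * acount a \<le> 2 * B" by blast
  show p: "prio I a \<le> B" using s'(1) by (simp add: prio_le_horizon)
  show "pending_key I a \<le> k" using s'(1,2) akey_move[OF assms(1) p] by (simp add: move_def)
  show "1 \<le> k" "k \<le> B" "k + 2 * acount a \<le> 2 * B" by fact+
qed

definition run_ok :: "(nat \<Rightarrow> arm) \<Rightarrow> nat \<Rightarrow> bool" where
  "run_ok \<sigma> el \<longleftrightarrow> (\<forall>i<n. arm_ok (\<sigma> i)) \<and>
     (\<forall>i<n. \<forall>j<n. prio I (\<sigma> i) \<le> B \<longrightarrow> akey (\<sigma> j) \<le> pending_key I (\<sigma> i)) \<and>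
     (\<forall>i<n. \<forall>j<n. prio I (\<sigma> i) = 0 \<longrightarrow> prio I (\<sigma> j) = 0 \<longrightarrow> i = j) \<and>
     ((\<Sum>i<n. acount (\<sigma> i)) = el \<or> (\<forall>i<n. B < prio I (\<sigma> i)))"

definition Phi :: "(nat \<Rightarrow> arm) \<Rightarrow> real" where
  "Phi \<sigma> = Pot I (\<lambda>i. gam I (\<sigma> i)) (\<lambda>i. if i < n then omg I (\<sigma> i) else (\<lambda>k. 0))"

section \<open>The run of all arms together\<close>

lemma run_okD:
  assumes "run_ok \<sigma> el"
  shows "i < n \<Longrightarrow> arm_ok (\<sigma> i)"
    "i < n \<Longrightarrow> j < n \<Longrightarrow> prio I (\<sigma> i) \<le> B \<Longrightarrow> akey (\<sigma> j) \<le> pending_key I (\<sigma> i)"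
    "i < n \<Longrightarrow> j < n \<Longrightarrow> prio I (\<sigma> i) = 0 \<Longrightarrow> prio I (\<sigma> j) = 0 \<Longrightarrow> i = j"
    "i < n \<Longrightarrow> prio I (\<sigma> i) \<le> B \<Longrightarrow> (\<Sum>i<n. acount (\<sigma> i)) = el"
proof -
  note r = assms[unfolded run_ok_def]
  show "i < n \<Longrightarrow> arm_ok (\<sigma> i)" using r[THEN conjunct1] by simp
  show "i < n \<Longrightarrow> j < n \<Longrightarrow> prio I (\<sigma> i) \<le> B \<Longrightarrow> akey (\<sigma> j) \<le> pending_key I (\<sigma> i)"
    using r[THEN conjunct2, THEN conjunct1] by simp
  show "i < n \<Longrightarrow> j < n \<Longrightarrow> prio I (\<sigma> i) = 0 \<Longrightarrow> prio I (\<sigma> j) = 0 \<Longrightarrow> i = j"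
    using r[THEN conjunct2, THEN conjunct2, THEN conjunct1] by simp
  show "i < n \<Longrightarrow> prio I (\<sigma> i) \<le> B \<Longrightarrow> (\<Sum>i<n. acount (\<sigma> i)) = el"
    using r[THEN conjunct2, THEN conjunct2, THEN conjunct2] by (auto simp: not_less[symmetric])
qed

text \<open>The depth of an arm is at most the number of its pulls, which is at most the number of
  elapsed steps.\<close>

lemma run_ok_depth:
  assumes "run_ok \<sigma> el" "i < n" "prio I (\<sigma> i) \<le> B" "el < B"
  shows "depth (anode (\<sigma> i)) < B"
proof -
  have "depth (anode (\<sigma> i)) \<le> acount (\<sigma> i)" using run_okD(1)[OF assms(1,2)] by (simp add:
      arm_ok_def)
  also have "acount (\<sigma> i) \<le> (\<Sum>i<n. acount (\<sigma> i))" using assms(2) by (intro member_le_sum) auto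
  also have "\<dots> = el" by (rule run_okD(4)[OF assms(1-3)])
  finally show ?thesis using assms(4) by simp
qed

text \<open>The selected arm has the smallest pending key: by comparison if its priority is
  positive, and by the invariant on last keys if it inherits its own. Its new last key is therefore
  below everything pending.\<close>

lemma run_ok_move:
  assumes r: "run_ok \<sigma> el" and i: "i < n" and min: "\<And>j. j < n \<Longrightarrow> prio I (\<sigma> i) \<le> prio I (\<sigma> j)"
    and p: "prio I (\<sigma> i) \<le> B" and v: "v < N" "0 < trans I (anode (\<sigma> i)) (action I (\<sigma> i)) v"
  shows "run_ok (\<sigma>(i := move I (\<sigma> i) v)) (Suc el)"
proof -
  let ?a = "\<sigma> i" and ?b = "move I (\<sigma> i) v"
  have ok: "\<And>j. j < n \<Longrightarrow> arm_ok (\<sigma> j)"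
    and keys: "\<And>j l. j < n \<Longrightarrow> l < n \<Longrightarrow> prio I (\<sigma> j) \<le> B \<Longrightarrow> akey (\<sigma> l) \<le> pending_key I (\<sigma> j)"
    and uniq: "\<And>j l. j < n \<Longrightarrow> l < n \<Longrightarrow> prio I (\<sigma> j) = 0 \<Longrightarrow> prio I (\<sigma> l) = 0 \<Longrightarrow> j = l"
    and el: "(\<Sum>i<n. acount (\<sigma> i)) = el"
    using run_okD(1-3)[OF r] run_okD(4)[OF r i p] by blast+
  have b: "arm_ok ?b" by (rule move_ok[OF ok[OF i] p v])
  have bk: "akey ?b = pending_key I ?a" by (rule akey_move[OF ok[OF i] p])
  \<comment> \<open>Any arm of priority 0 would have been selected itself, so after the pull only
    arm \<open>i\<close> can have priority 0.\<close>
  have pos: "0 < prio I (\<sigma> j)" if "j < n" "j \<noteq> i" for j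
    using min[OF that(1)] uniq[OF that(1) i] that(2) by (cases "prio I (\<sigma> j)") auto
  have le: "pending_key I ?a \<le> pending_key I (\<sigma> j)" if "j < n" "prio I (\<sigma> j) \<le> B" for j
  proof (cases "prio I ?a = 0")
    case True
    then have "pending_key I ?a = akey ?a" by (simp add: pending_key_def)
    then show ?thesis using keys[OF that(1) i that(2)] by simp
  next
    case False
    then have "pending_key I ?a = prio I ?a" "prio I ?a \<le> prio I (\<sigma> j)" "prio I (\<sigma> j) \<noteq> 0"
      using min[OF that(1)] by (auto simp: pending_key_def)
    then show ?thesis by (simp add: pending_key_def)
  qed
  have 1: "\<forall>j<n. arm_ok ((\<sigma>(i := ?b)) j)" using ok b by simp
  have 2: "\<forall>j<n. \<forall>l<n. prio I ((\<sigma>(i := ?b)) j) \<le> B \<longrightarrow>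
      akey ((\<sigma>(i := ?b)) l) \<le> pending_key I ((\<sigma>(i := ?b)) j)"
  proof (intro allI impI)
    fix j l assume j: "j < n" and l: "l < n" and pj: "prio I ((\<sigma>(i := ?b)) j) \<le> B"
    have "akey ((\<sigma>(i := ?b)) l) \<le> akey ?b \<or> j \<noteq> i \<and> l \<noteq> i"
      using keys[OF i l p] bk by (auto simp: akey_le_pending_key)
    then show "akey ((\<sigma>(i := ?b)) l) \<le> pending_key I ((\<sigma>(i := ?b)) j)"
    proof
      assume "akey ((\<sigma>(i := ?b)) l) \<le> akey ?b"
      also have "akey ?b \<le> pending_key I ((\<sigma>(i := ?b)) j)"
        using akey_le_pending_key[OF b] le[OF j] pj bk by (cases "j = i") auto
      finally show ?thesis .
    next
      assume "j \<noteq> i \<and> l \<noteq> i"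
      then show ?thesis using keys[OF j l] pj by simp
    qed
  qed
  have 3: "\<forall>j<n. \<forall>l<n. prio I ((\<sigma>(i := ?b)) j) = 0 \<longrightarrow> prio I ((\<sigma>(i := ?b)) l) = 0 \<longrightarrow> j = l"
  proof (intro allI impI)
    fix j l assume "j < n" "l < n" "prio I ((\<sigma>(i := ?b)) j) = 0" "prio I ((\<sigma>(i := ?b)) l) = 0"
    then show "j = l" using pos[of j] pos[of l] by (cases "j = i"; cases "l = i") auto
  qed
  have "(\<Sum>j<n. acount ((\<sigma>(i := ?b)) j)) = acount ?b + (\<Sum>j\<in>{..<n} - {i}. acount (\<sigma> j))"
    using i by (subst sum.remove[of _ i]) (auto intro!: sum.cong)
  also have "\<dots> = Suc (\<Sum>j<n. acount (\<sigma> j))"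
    using i by (subst (2) sum.remove[of _ i]) (auto simp: move_def)
  finally have 4: "(\<Sum>j<n. acount ((\<sigma>(i := ?b)) j)) = Suc el" using el by simp
  show ?thesis using 1 2 3 4 unfolding run_ok_def by blast
qed

text \<open>The submartingale step: the reward just earned is taken out of the potential, after
  which both data of the arm are averages over its transition.\<close>

lemma Phi_move:
  assumes r: "run_ok \<sigma> el" and i: "i < n" and p: "prio I (\<sigma> i) \<le> B" and el: "el < B"
  shows "Phi \<sigma> \<le> rr I (anode (\<sigma> i)) (action I (\<sigma> i)) +
    (\<Sum>v<N. rp I (anode (\<sigma> i)) (action I (\<sigma> i)) v * Phi (\<sigma>(i := move I (\<sigma> i) v)))"
proof -
  let ?a = "\<sigma> i"
  let ?u = "anode ?a" and ?x = "action I ?a"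
  have ok: "\<And>j. j < n \<Longrightarrow> arm_ok (\<sigma> j)" by (rule run_okD(1)[OF r])
  have u: "?u < N" using ok[OF i] by (simp add: arm_ok_def)
  note x = action_less[OF ok[OF i] p]
  note dep = run_ok_depth[OF r i p el]
  define g where "g i = gam I (\<sigma> i)" for i
  define w where "w i = (if i < n then omg I (\<sigma> i) else (\<lambda>k. 0))" for i
  define r' where "r' = rr I ?u ?x * of_bool (next_slot I ?a \<noteq> 0)"
  define g1 where "g1 = g(i := \<lambda>k. g i k - r' * of_bool (pending_key I ?a = k))"
  have r'0: "0 \<le> r'" "r' \<le> rr I ?u ?x" using rr_nonneg[OF u x] by (auto simp: r'_def)
  have "Phi \<sigma> = Pot I g w" by (simp add: Phi_def g_def[abs_def] w_def[abs_def])
  also have "\<dots> \<le> r' + Pot I g1 w" unfolding g1_def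
    by (rule Pot_reward[OF i r'0(1)]) (use ok omg_nonneg in \<open>auto simp: w_def\<close>)
  also have "Pot I g1 w = (\<Sum>v<N. rp I ?u ?x v * Pot I (g1(i := gam I (move I ?a v)))
      (w(i := omg I (move I ?a v))))"
  proof (rule Pot_average[OF i])
    show "(\<Sum>v<N. rp I ?u ?x v) = 1" by (rule sum_rp[OF u dep x])
    show "g1 i k = (\<Sum>v<N. rp I ?u ?x v * gam I (move I ?a v) k)" for k
      using gam_move[OF ok[OF i] p, of k] by (auto simp: g1_def g_def r'_def)
    show "w i k = (\<Sum>v<N. rp I ?u ?x v * omg I (move I ?a v) k)" for k
      using omg_move[OF ok[OF i] p dep] i by (simp add: w_def)
  qed
  also have "\<dots> = (\<Sum>v<N. rp I ?u ?x v * Phi (\<sigma>(i := move I ?a v)))"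
  proof (intro sum.cong refl arg_cong2[of _ _ _ _ "(*)"])
    fix v
    have "g1(i := gam I (move I ?a v)) = (\<lambda>j. gam I ((\<sigma>(i := move I ?a v)) j))"
      by (auto simp: g1_def g_def fun_eq_iff)
    moreover have "w(i := omg I (move I ?a v)) =
        (\<lambda>j. if j < n then omg I ((\<sigma>(i := move I ?a v)) j) else (\<lambda>k. 0))"
      using i by (auto simp: w_def fun_eq_iff)
    ultimately show "Pot I (g1(i := gam I (move I ?a v))) (w(i := omg I (move I ?a v))) =
        Phi (\<sigma>(i := move I ?a v))"
      by (simp only: Phi_def)
  qed
  finally show ?thesis using r'0(2) by simp
qed

lemma run_ok_idle: "run_ok \<sigma> el \<Longrightarrow> (\<And>i. i < n \<Longrightarrow> B < prio I (\<sigma> i)) \<Longrightarrow> run_ok \<sigma> (Suc el)"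
  by (simp add: run_ok_def)

lemma run_ok_legal:
  assumes "run_ok \<sigma> el" "i < n" "\<And>j. j < n \<Longrightarrow> prio I (\<sigma> i) \<le> prio I (\<sigma> j)"
    "j < n" "bridge I (anode (\<sigma> j))"
  shows "i = j" "action I (\<sigma> i) = default I"
proof -
  have "prio I (\<sigma> j) = 0" using assms(5) by (simp add: prio_def)
  moreover from this have "prio I (\<sigma> i) = 0" using assms(3)[OF assms(4)] by simp
  ultimately show "i = j" using run_okD(3)[OF assms(1,2,4)] by blast
  then show "action I (\<sigma> i) = default I" using assms(5) by (simp add: action_def)
qed

text \<open>If arm \<open>i\<close> is left with reward of key \<open>k\<close>, all
  \<open>B\<close> steps were used and at most \<open>B - k / 2\<close> of them by arm
  \<open>i\<close>. The others made at least \<open>k / 2\<close> pulls with keys at most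
  \<open>k\<close>, so either one of them weighs 1 by itself or their pulls weigh
  \<open>2 / k\<close> each.\<close>

lemma Phi_final:
  assumes r: "run_ok \<sigma> B"
  shows "Phi \<sigma> \<le> 0"
  unfolding Phi_def Pot_def
proof (intro sum_nonpos)
  fix i k assume "i \<in> {..<n}" and k: "k \<in> {1..B}"
  then have i: "i < n" by simp
  have ok: "\<And>j. j < n \<Longrightarrow> arm_ok (\<sigma> j)" by (rule run_okD(1)[OF r])
  let ?w = "\<Sum>j\<in>{..<n} - {i}. (if j < n then omg I (\<sigma> j) else (\<lambda>k. 0)) k"
  show "gam I (\<sigma> i) k * (1 - ?w) \<le> 0"
  proof (cases "gam I (\<sigma> i) k = 0")
    case False
    note g = gam_neq_0[OF ok[OF i] False]
    have cnt: "(\<Sum>j<n. acount (\<sigma> j)) = B" by (rule run_okD(4)[OF r i g(1)])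
    have w: "?w = (\<Sum>j\<in>{..<n} - {i}. omg I (\<sigma> j) k)" by (intro sum.cong) auto
    have past: "1 \<le> omg I (\<sigma> j) k \<or> min 1 (2 / real k) * acount (\<sigma> j) \<le> omg I (\<sigma> j) k" if "j < n"
        for j
    proof -
      have "akey (\<sigma> j) \<le> k" using run_okD(2)[OF r i that g(1)] g(2) by (rule order_trans)
      then have "1 \<le> apast (\<sigma> j) k \<or> min 1 (2 / real k) * acount (\<sigma> j) \<le> apast (\<sigma> j) k"
        using ok[OF that] g(3,4) by (auto simp: arm_ok_def)
      then show ?thesis using omg_ge_past[OF ok[OF that], of k] by linarith
    qed
    have "1 \<le> ?w"
    proof (cases "\<exists>j\<in>{..<n} - {i}. 1 \<le> omg I (\<sigma> j) k")
      case True
      then obtain j where j: "j \<in> {..<n} - {i}" "1 \<le> omg I (\<sigma> j) k" by blast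
      have "omg I (\<sigma> j) k \<le> (\<Sum>j\<in>{..<n} - {i}. omg I (\<sigma> j) k)"
        using j(1) ok omg_nonneg by (intro member_le_sum) auto
      then show ?thesis using j(2) w by simp
    next
      case False
      let ?M = "\<Sum>j\<in>{..<n} - {i}. acount (\<sigma> j)"
      have "acount (\<sigma> i) + ?M = B" using cnt i by (subst (asm) sum.remove[of _ i]) auto
      then have M: "k \<le> 2 * ?M" using g(5) by linarith
      then have "1 \<le> min 1 (2 / real k) * real ?M"
        using g(3) by (auto simp: min_def field_simps simp flip: of_nat_sum)
      also have "\<dots> = (\<Sum>j\<in>{..<n} - {i}. min 1 (2 / real k) * acount (\<sigma> j))"
        by (simp add: sum_distrib_left)
      also have "\<dots> \<le> (\<Sum>j\<in>{..<n} - {i}. omg I (\<sigma> j) k)"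
        using past False by (intro sum_mono) auto
      finally show ?thesis by (simp add: w)
    qed
    then show ?thesis using gam_nonneg[OF ok[OF i], of k] by (simp add: mult_nonneg_nonpos)
  qed simp
qed

lemma start_ok:
  assumes "i < n"
  shows "arm_ok (start I i z)"
  using assms roots depth(1) by (simp add: arm_ok_def start_def)

lemma run_ok_start:
  assumes "\<And>i. i < n \<Longrightarrow> \<exists>z. \<sigma> i = start I i z"
  shows "run_ok \<sigma> 0"
proof -
  have "arm_ok (\<sigma> i) \<and> akey (\<sigma> i) = 0 \<and> 0 < prio I (\<sigma> i) \<and> acount (\<sigma> i) = 0" if i: "i < n" for i
  proof -
    obtain z where z: "\<sigma> i = start I i z" using assms[OF i] by blast
    have "next_slot I (start I i z) \<le> B" using nx_le by (simp add: next_slot_def start_def)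
    then show ?thesis unfolding z using start_ok[OF i, of z] roots(3)[OF i]
      by (auto simp: prio_def start_def)
  qed
  then have pos: "prio I (\<sigma> i) \<noteq> 0" and rest: "arm_ok (\<sigma> i)" "akey (\<sigma> i) = 0" "acount (\<sigma> i) = 0"
    if "i < n" for i using that by auto
  show ?thesis unfolding run_ok_def
  proof (intro conjI allI impI disjI1)
    fix i j assume "i < n" "prio I (\<sigma> i) = 0"
    with pos[of i] show "i = j" by blast
  qed (simp_all add: rest)
qed

section \<open>The potential before the policies are drawn\<close>

definition avg_gam :: "nat \<Rightarrow> nat \<Rightarrow> real" where
  "avg_gam i k = (\<Sum>z<6 * KK I. gam I (start I i z) k) / real (6 * KK I)"

definition avg_omg :: "nat \<Rightarrow> nat \<Rightarrow> real" where
  "avg_omg i k = (\<Sum>z<6 * KK I. omg I (start I i z) k) / real (6 * KK I)"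

lemma KK_pos: "0 < KK I"
  using params_pos by (simp add: KK_def HH_def)

text \<open>Every pull has exactly one key in \<open>{1..B}\<close>. The last assumption prevents a
  pull from inheriting the initial key 0.\<close>

lemma Gf_sum_keys:
  assumes "s \<le> B" "k \<le> B" "1 \<le> k \<or> c = 0 \<and> \<not> bridge I u"
  shows "(\<Sum>x\<in>{1..B}. Gf I act (\<lambda>k' s u y. rr I u y * of_bool (k' = x)) s u c k) =
      Ev I act (\<lambda>s. rr I) s u"
  using assms
proof (induction s arbitrary: u c k)
  case (Suc s)
  show ?case
  proof (cases "act s u < 0")
    case True
    then show ?thesis using Suc by simp
  next
    case False
    define k' where "k' = newkey I s u c k"
    have k': "1 \<le> k'" "k' \<le> B" using Suc.prems by (auto simp: k'_def newkey_def)
    let ?a = "nat (act s u)"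
    let ?G = "\<lambda>x v. Gf I act (\<lambda>k' s u y. rr I u y * of_bool (k' = x)) s v (Suc c) k'"
    have "(\<Sum>x\<in>{1..B}. of_bool (k' = x)) = (\<Sum>x\<in>{1..B}. if x = k' then 1 else (0 :: real))"
      by (intro sum.cong) auto
    then have 1: "(\<Sum>x\<in>{1..B}. rr I u ?a * of_bool (k' = x)) = rr I u ?a"
      using k' by (simp flip: sum_distrib_left)
    have "(\<Sum>x\<in>{1..B}. \<Sum>v<N. rp I u ?a v * ?G x v) = (\<Sum>v<N. rp I u ?a v * (\<Sum>x\<in>{1..B}. ?G x v))"
      by (subst sum.swap) (simp add: sum_distrib_left)
    also have "\<dots> = (\<Sum>v<N. rp I u ?a v * Ev I act (\<lambda>s. rr I) s v)"
      using Suc.IH[of k' "Suc c"] Suc.prems(1) k' by simp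
    finally show ?thesis using False 1 by (simp add: sum.distrib k'_def[symmetric])
  qed
qed simp

lemma Ev_pol: "Ev I (pol I z) g s u = (if z < KK I then Ev I (learned I z) g s u else 0)"
proof (cases "z < KK I")
  case False
  have "Ev I (\<lambda>s u. - 1) g s u = 0" by (induction s) simp_all
  then show ?thesis using False by (simp add: pol_def)
qed (simp add: pol_def)

lemma sum_pol: "(\<Sum>z<6 * KK I. if z < KK I then f z else 0) = (\<Sum>z<KK I. f z :: real)"
  by (rule sum.mono_neutral_cong_right) auto

lemma sum_avg_gam:
  "(\<Sum>i<n. \<Sum>k\<in>{1..B}. avg_gam i k) = (\<Sum>z<KK I. total (learned I z)) / real (6 * KK I)"
proof -
  have "(\<Sum>k\<in>{1..B}. gam I (start I i z) k) = (if z < KK I then Ev I (learned I z) (\<lambda>s. rr I)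
      B (root I i) else 0)"
    if "i < n" for i z
    using Gf_sum_keys[of B 0 0 "root I i" "pol I z"] roots(3)[OF that]
    by (simp add: gam_def start_def Ev_pol)
  then have "(\<Sum>k\<in>{1..B}. \<Sum>z<6 * KK I. gam I (start I i z) k) =
      (\<Sum>z<KK I. Ev I (learned I z) (\<lambda>s. rr I) B (root I i))" if "i < n" for i
    using that by (subst sum.swap) (simp add: sum_pol)
  then have "(\<Sum>i<n. \<Sum>k\<in>{1..B}. \<Sum>z<6 * KK I. gam I (start I i z) k) =
      (\<Sum>z<KK I. total (learned I z))"
    unfolding total_def by (subst sum.swap) simp
  then show ?thesis unfolding avg_gam_def by (simp flip: sum_divide_distrib)
qed

lemma sum_avg_omg:
  "(\<Sum>j<n. avg_omg j k) = (\<Sum>q<B. coef I k q * (\<Sum>z<KK I. load (learned I z) q)) / real (6 * KK I)"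
proof -
  have "omg I (start I i z) k =
      (if z < KK I then \<Sum>q<B. coef I k q * Ev I (learned I z) (at_slot q) B (root I i) else 0)"
          for i z
    using Gf_eq_Ev[of I "pol I z" "\<lambda>s u x. coef I k s"]
      Ev_slots[of B B "learned I z" "coef I k" "root I i"]
    by (simp add: omg_def start_def Ev_pol)
  then have "(\<Sum>j<n. \<Sum>z<6 * KK I. omg I (start I j z) k) =
      (\<Sum>j<n. \<Sum>z<KK I. \<Sum>q<B. coef I k q * Ev I (learned I z) (at_slot q) B (root I j))"
    by (simp add: sum_pol)
  also have "\<dots> = (\<Sum>z<KK I. \<Sum>q<B. \<Sum>j<n. coef I k q * Ev I (learned I z) (at_slot q) B (root I j))"
    by (rule trans[OF sum.swap], rule sum.cong[OF refl], rule sum.swap)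
  also have "\<dots> = (\<Sum>q<B. coef I k q * (\<Sum>z<KK I. load (learned I z) q))"
    by (rule trans[OF sum.swap]) (simp add: load_def sum_distrib_left)
  finally show ?thesis unfolding avg_omg_def by (simp flip: sum_divide_distrib)
qed

text \<open>The \<open>k - 1\<close> earlier own times weigh \<open>2 / k\<close> each, and own time
  \<open>k\<close> weighs 1.\<close>

lemma sum_coef:
  assumes "1 \<le> k" "k \<le> B"
  shows "(\<Sum>q<B. coef I k q) = 3 - 2 / real k"
proof -
  have "(\<Sum>q<B. coef I k q) = (\<Sum>t\<in>{1..B}. if t < k then 2 / real k else if t = k then 1 else 0)"
    by (rule sum.reindex_bij_witness[of _ "\<lambda>s. B - s" "\<lambda>t. B - t"]) (auto simp: coef_def)
  also have "\<dots> = (\<Sum>t\<in>{1..k}. if t < k then 2 / real k else 1)"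
    using assms by (intro sum.mono_neutral_cong_right) auto
  also have "{1..k} = insert k {1..<k}" using assms by auto
  also have "(\<Sum>t\<in>insert k {1..<k}. if t < k then 2 / real k else 1) = 1 + (real k - 1)
      * (2 / real k)"
    using assms by (simp add: of_nat_diff)
  also have "\<dots> = 3 - 2 / real k" using assms by (simp add: field_simps)
  finally show ?thesis .
qed

text \<open>To first order in \<open>e = 1 / b\<close>, the term \<open>- 2 / b\<close> gains
  \<open>e / 3\<close>, and the inaccuracies of reward and load lose \<open>e / 8\<close> each. The
  surplus is \<open>e / 12\<close>, and the quadratic rest is nonnegative.\<close>

lemma twelfth_arith:
  fixes b :: real
  assumes "1 \<le> b"
  shows "1 / 2 \<le> (1 - 1 / (4 * b)) * (1 - (1 + 1 / (4 * b)) / 6 * (3 - 2 / b))"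
proof -
  define e where "e = 1 / b"
  have e: "0 \<le> e" "e \<le> 1" using assms by (auto simp: e_def)
  have "(1 - e / 4) * (1 - (1 + e / 4) / 6 * (3 - 2 * e)) - 1 / 2 =
      e / 12 + e * e * (3 / 96 - e / 48)"
    by (simp add: field_simps)
  moreover have "0 \<le> e * e * (3 / 96 - e / 48)" using e by (intro mult_nonneg_nonneg) auto
  ultimately have "1 / 2 \<le> (1 - e / 4) * (1 - (1 + e / 4) / 6 * (3 - 2 * e))" using e by linarith
  moreover have "e / 4 = 1 / (4 * b)" "2 * e = 2 / b" by (simp_all add: e_def)
  ultimately show ?thesis by simp
qed

lemma Pot_start:
  assumes L: "0 \<le> L" "(1 - 1 / (4 * B)) * L * KK I \<le> (\<Sum>k<KK I. total (learned I k))"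
    and loads: "\<And>q. q < B \<Longrightarrow> (\<Sum>k<KK I. load (learned I k) q) \<le> (1 + 1 / (4 * B)) * KK I"
  shows "L / 12 \<le> Pot I avg_gam (\<lambda>i. if i < n then avg_omg i else (\<lambda>k. 0))"
proof -
  define K where "K = real (KK I)"
  have K: "0 < K" using KK_pos by (simp add: K_def)
  define b where "b = real B"
  have b: "1 \<le> b" using params_pos by (simp add: b_def)
  define c where "c = 1 - (1 + 1 / (4 * b)) / 6 * (3 - 2 / b)"
  have le: "(\<Sum>j<n. avg_omg j k) \<le> 1 - c" if k: "k \<in> {1..B}" for k
  proof -
    have coef: "0 \<le> coef I k q" for q by (simp add: coef_def)
    have "(\<Sum>q<B. coef I k q * (\<Sum>z<KK I. load (learned I z) q)) \<le>
        (\<Sum>q<B. coef I k q * ((1 + 1 / (4 * b)) * K))"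
      using loads coef by (intro sum_mono mult_left_mono) (auto simp: b_def K_def)
    also have "\<dots> = (3 - 2 / real k) * ((1 + 1 / (4 * b)) * K)"
      using sum_coef[of k] k by (simp flip: sum_distrib_right)
    \<comment> \<open>The total weight grows with \<open>k\<close>, so the last key is the worst
      one.\<close>
    also have "\<dots> \<le> (3 - 2 / b) * ((1 + 1 / (4 * b)) * K)"
      using k b K by (intro mult_right_mono diff_left_mono divide_left_mono) (auto simp: b_def)
    finally show ?thesis
      using K by (simp add: sum_avg_omg c_def K_def[symmetric] field_simps)
  qed
  have omg0: "0 \<le> avg_omg j k" if "j < n" for j k
    using omg_nonneg[OF start_ok[OF that]] by (simp add: avg_omg_def sum_nonneg)
  have gam0: "0 \<le> avg_gam j k" if "j < n" for j k
    using gam_nonneg[OF start_ok[OF that]] by (simp add: avg_gam_def sum_nonneg)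
  have half: "1 / 2 \<le> (1 - 1 / (4 * b)) * c" unfolding c_def by (rule twelfth_arith[OF b])
  have b4: "0 < 1 - 1 / (4 * b)" using b by (simp add: field_simps)
  have c: "0 \<le> c"
  proof (rule ccontr)
    assume "\<not> 0 \<le> c"
    then have "(1 - 1 / (4 * b)) * c \<le> 0" using b4 by (simp add: mult_nonneg_nonpos)
    then show False using half by simp
  qed
  have "L / 12 \<le> (1 / 6) * L * ((1 - 1 / (4 * b)) * c)"
    using mult_left_mono[OF half L(1)] by simp
  also have "\<dots> = ((1 - 1 / (4 * b)) * L * K) / (6 * K) * c" using K by (simp add: field_simps)
  also have "\<dots> \<le> (\<Sum>z<KK I. total (learned I z)) / (6 * K) * c"
    using L(2) K c by (intro mult_right_mono divide_right_mono) (auto simp: b_def K_def)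
  also have "\<dots> = (\<Sum>i<n. \<Sum>k\<in>{1..B}. avg_gam i k * c)"
    unfolding sum_distrib_right[symmetric] sum_avg_gam by (simp add: K_def)
  also have "\<dots> \<le> Pot I avg_gam (\<lambda>i. if i < n then avg_omg i else (\<lambda>k. 0))"
    unfolding Pot_def
  proof (intro sum_mono mult_left_mono)
    fix i k assume i: "i \<in> {..<n}" and k: "k \<in> {1..B}"
    have "(\<Sum>j\<in>{..<n} - {i}. (if j < n then avg_omg j else (\<lambda>k. 0)) k) =
        (\<Sum>j\<in>{..<n} - {i}. avg_omg j k)"
      by (intro sum.cong) auto
    also have "\<dots> \<le> (\<Sum>j<n. avg_omg j k)" using omg0 by (intro sum_mono2) auto
    finally show "c \<le> 1 - (\<Sum>j\<in>{..<n} - {i}. (if j < n then avg_omg j else (\<lambda>k. 0)) k)"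
      using le[OF k] by simp
    show "0 \<le> avg_gam i k" using gam0 i by simp
  qed
  finally show ?thesis .
qed

end

section \<open>Sizes of the numbers\<close>

lemma abs_input_less: "k < length (encode I) \<Longrightarrow> \<bar>encode I ! k\<bar> < 2 ^ input_size I"
proof -
  assume k: "k < length (encode I)"
  have "bits (encode I ! k) \<le> input_size I"
    unfolding input_size_def using k by (intro member_le_sum_list) auto
  then have "(2::int) ^ bits (encode I ! k) \<le> 2 ^ input_size I" by (intro power_increasing) auto
  then show ?thesis using abs_less_power_bits[of "encode I ! k"] by linarith
qed

lemma length_encode_le: "length (encode I) \<le> input_size I"
proof -
  have "length (encode I) = (\<Sum>z\<leftarrow>encode I. 1)" by (simp add: sum_list_triv)
  also have "\<dots> \<le> input_size I" unfolding input_size_def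
    by (intro sum_list_mono) (simp add: bits_def)
  finally show ?thesis .
qed

text \<open>The unit of size: it exceeds \<open>N\<close> times any scaled datum, so one level of a
  recursion costs one factor \<open>EE I\<close> and all bounds can be stated as powers of
  it.\<close>

definition "EE I = (2 :: int) ^ ((input_size I + 1) ^ 2)"
text \<open>Makes \<open>2 ^ Wb I\<close> the power of \<open>EE I\<close> with exponent
  \<open>20 * (input_size I + 1)\<close>, above the largest exponent arising,
  \<open>12 + 6 * horizon I\<close>.\<close>

definition "Wb I = 20 * (input_size I + 1) * (input_size I + 1) ^ 2"
text \<open>Bounds \<open>KK I\<close>, the length of the longest loop.\<close>

definition "Zb I = 80 * (input_size I + 1) ^ 7"

context superprocess_instance
begin

abbreviation "sz \<equiv> input_size I"
abbreviation "E \<equiv> EE I"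
abbreviation "W \<equiv> Wb I"
abbreviation "Z0 \<equiv> Zb I"

text \<open>The tables of the input have an entry for each node, root and reward, which bounds these
  counts although the header gives them in binary. The horizon is bounded through the number of
  nodes.\<close>

lemma sizes: "N \<le> sz" "n \<le> sz" "nentries I \<le> sz" "B \<le> sz" "A \<le> sz" "5 \<le> sz"
proof -
  have *: "5 + 2 * N + n + 2 * nentries I \<le> sz"
    using length_encode_le[of I] by (simp add: length_encode)
  then show "N \<le> sz" "n \<le> sz" "nentries I \<le> sz" "5 \<le> sz" by auto
  show "B \<le> sz" using horizon_less_nodes \<open>N \<le> sz\<close> by simp
  have "A \<le> N * A" using horizon_less_nodes by simp
  then have "A \<le> nentries I" unfolding nentries_def by (rule trans_le_add1)
  then show "A \<le> sz" using \<open>nentries I \<le> sz\<close> by simp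
qed

lemma W_eq: "2 ^ W = E ^ (20 * (sz + 1))"
  by (simp only: Wb_def EE_def mult.commute[of "20 * (sz + 1)"] power_mult)

lemma E_ge: "2 ^ sz \<le> E" "16 \<le> E" "1 \<le> E" "0 < E"
proof -
  have "sz \<le> (sz + 1) ^ 2" by (simp add: power2_eq_square)
  then show "2 ^ sz \<le> E" unfolding EE_def by (intro power_increasing) auto
  have "(2::int) ^ 5 \<le> 2 ^ sz" using sizes by (intro power_increasing) auto
  then show "16 \<le> E" using \<open>2 ^ sz \<le> E\<close> by simp
  then show "1 \<le> E" "0 < E" by auto
qed

lemma nat_le_E: "k \<le> sz \<Longrightarrow> int k \<le> E"
proof -
  assume "k \<le> sz"
  then have "k < 2 ^ sz" using less_exp[of sz] by linarith
  then have "int k < 2 ^ sz" by (metis of_nat_less_iff of_nat_numeral of_nat_power)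
  then show ?thesis using E_ge(1) by linarith
qed

lemma E_power_less: "x \<le> E ^ k \<Longrightarrow> k < 20 * (sz + 1) \<Longrightarrow> x < 2 ^ W"
proof -
  assume "x \<le> E ^ k" and k: "k < 20 * (sz + 1)"
  have "E ^ k < E ^ (20 * (sz + 1))" using k E_ge(2) by (intro power_strict_increasing) auto
  then show "x < 2 ^ W" unfolding W_eq using \<open>x \<le> E ^ k\<close> by linarith
qed

lemma nat_less_W: "k \<le> sz \<Longrightarrow> int k < 2 ^ W"
  using E_power_less[of "int k" 1] nat_le_E by simp

lemma le_Z0: "k \<le> sz \<Longrightarrow> k \<le> Z0"
proof -
  assume "k \<le> sz"
  also have "sz \<le> (sz + 1) ^ 1" by simp
  also have "\<dots> \<le> (sz + 1) ^ 7" by (intro power_increasing) auto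
  finally show "k \<le> Z0" by (simp add: Zb_def)
qed

lemma HH_le: "HH I \<le> 2 * sz ^ 5"
proof -
  have "HH I \<le> 2 * sz ^ 2 * sz ^ 3" unfolding HH_def
    using sizes by (intro mult_mono power_mono) auto
  then show ?thesis by (simp add: mult.assoc flip: power_add)
qed

lemma KK_le: "KK I \<le> 80 * (sz + 1) ^ 7"
proof -
  let ?w = "sz + 1"
  have "HH I \<le> 2 * ?w ^ 5" using HH_le by (rule order_trans) (intro mult_left_mono power_mono; simp)
  moreover have "B * n ^ 2 \<le> ?w * ?w ^ 2" using sizes by (intro mult_mono power_mono) auto
  then have "B * n ^ 2 \<le> ?w ^ 5"
    by (rule order_trans) (simp only: power_Suc[symmetric], intro power_increasing; simp)
  ultimately have "2 * HH I + B * n ^ 2 \<le> 5 * ?w ^ 5" by simp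
  moreover have "B ^ 2 \<le> ?w ^ 2" using sizes by (intro power_mono) auto
  ultimately have "16 * B ^ 2 * (2 * HH I + B * n ^ 2) \<le> 16 * ?w ^ 2 * (5 * ?w ^ 5)"
    by (intro mult_mono) auto
  also have "\<dots> = 80 * (?w ^ 2 * ?w ^ 5)" by (simp only: mult_ac)
  also have "?w ^ 2 * ?w ^ 5 = ?w ^ 7" by (simp flip: power_add)
  finally show ?thesis by (simp only: KK_def)
qed

lemma KK_le_E: "int (KK I) \<le> E ^ 9" "6 * int (KK I) < 2 ^ W" "int (HH I) \<le> E ^ 6"
proof -
  have w: "int (sz + 1) \<le> E"
  proof -
    have "sz + 1 \<le> 2 ^ sz" using less_exp[of sz] by (simp add: Suc_le_eq)
    then have "int (sz + 1) \<le> 2 ^ sz" by (metis of_nat_le_iff of_nat_numeral of_nat_power)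
    then show ?thesis using E_ge(1) by linarith
  qed
  have "int (KK I) \<le> int (80 * (sz + 1) ^ 7)" using KK_le by (simp only: of_nat_le_iff)
  also have "\<dots> = 80 * int (sz + 1) ^ 7" by simp
  also have "\<dots> \<le> E ^ 2 * E ^ 7"
  proof (intro mult_mono power_mono w)
    have "16 ^ 2 \<le> E ^ 2" using E_ge by (intro power_mono) auto
    then show "80 \<le> E ^ 2" by simp
  qed auto
  also have "\<dots> = E ^ 9" by (simp flip: power_add)
  finally show 1: "int (KK I) \<le> E ^ 9" .
  have "6 * int (KK I) \<le> E * E ^ 9" using 1 E_ge by (intro mult_mono) auto
  also have "\<dots> = E ^ 10" by (simp flip: power_Suc)
  finally show "6 * int (KK I) < 2 ^ W" by (rule E_power_less) simp
  have "int (HH I) \<le> int (2 * sz ^ 5)" using HH_le by (simp only: of_nat_le_iff)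
  also have "\<dots> = 2 * int sz ^ 5" by simp
  also have "\<dots> \<le> E * E ^ 5" using E_ge nat_le_E[of sz] by (intro mult_mono power_mono) auto
  also have "\<dots> = E ^ 6" by (simp flip: power_Suc)
  finally show "int (HH I) \<le> E ^ 6" .
qed

lemma nums_dens_bound:
  assumes "j < nentries I"
  shows "\<bar>nums I j\<bar> < 2 ^ sz" "\<bar>dens I j\<bar> < 2 ^ sz"
proof -
  let ?k = "length (header I)"
  have "encode I ! (?k + 2 * j) = nums I j" "encode I ! (?k + Suc (2 * j)) = dens I j"
    using nth_concat_encode_rat[of j "entries I"] assms
    unfolding encode_eq nth_append_length_plus nums_def dens_def length_entries by simp_all
  moreover have "?k + 2 * j < length (encode I)" "?k + Suc (2 * j) < length (encode I)"
    using assms by (simp_all add: length_encode length_header)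
  ultimately show "\<bar>nums I j\<bar> < 2 ^ sz" "\<bar>dens I j\<bar> < 2 ^ sz" using abs_input_less by metis+
qed

lemma partial_DD:
  assumes "j \<le> nentries I"
  shows "0 < (\<Prod>i<j. dens I i)" "(\<Prod>i<j. dens I i) \<le> 2 ^ (sz * sz)"
proof -
  show "0 < (\<Prod>i<j. dens I i)" by (intro prod_pos) (simp add: dens_pos)
  have "(\<Prod>i<j. dens I i) \<le> (\<Prod>i<j. 2 ^ sz)"
  proof (intro prod_mono conjI)
    fix i assume "i \<in> {..<j}"
    then show "dens I i \<le> 2 ^ sz" using nums_dens_bound(2)[of i] assms by simp
  qed (simp add: dens_pos less_imp_le)
  also have "\<dots> = 2 ^ (sz * j)" by (simp add: power_mult)
  also have "\<dots> \<le> 2 ^ (sz * sz)" using assms sizes by (intro power_increasing) auto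
  finally show "(\<Prod>i<j. dens I i) \<le> 2 ^ (sz * sz)" .
qed

lemma DD_le: "DD I \<le> 2 ^ (sz * sz)" "DD I \<le> E"
proof -
  show "DD I \<le> 2 ^ (sz * sz)" unfolding DD_def by (rule partial_DD) simp
  also have "\<dots> \<le> E" unfolding EE_def by (intro power_increasing) (simp_all add: power2_eq_square)
  finally show "DD I \<le> E" .
qed

lemma scaled_bound:
  assumes "j < nentries I"
  shows "\<bar>scaled I j\<bar> \<le> 2 ^ (sz + sz * sz)"
proof -
  have "\<bar>scaled I j\<bar> \<le> 2 ^ sz * 2 ^ (sz * sz)"
    unfolding scaled_def abs_mult
    using nums_dens_bound(1)[OF assms] abs_div_le[of "DD I" "dens I j"] DD_le(1) DD_pos[of I]
    by (intro mult_mono) auto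
  then show ?thesis by (simp add: power_add)
qed

lemma Rh_bound: "u < N \<Longrightarrow> a < A \<Longrightarrow> \<bar>Rh I u a\<bar> \<le> E"
proof -
  assume "u < N" "a < A"
  then have "\<bar>Rh I u a\<bar> \<le> 2 ^ (sz + sz * sz)" unfolding Rh_def
    using nth_entries_rew[of u I a] by (intro scaled_bound) (simp add: nentries_def)
  also have "\<dots> \<le> E" unfolding EE_def by (intro power_increasing) (simp_all add: power2_eq_square)
  finally show ?thesis .
qed

text \<open>The extra summand \<open>b\<close> leaves room for the inhomogeneous term of a recursion
  within the same factor \<open>E\<close>.\<close>

lemma sum_Ph_bound:
  assumes "u < N" "a < A" "0 \<le> b" "\<And>v. v < N \<Longrightarrow> \<bar>X v\<bar> \<le> b"
  shows "(\<Sum>v<N. \<bar>Ph I u a v * X v\<bar>) + b \<le> E * b"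
proof -
  have "(\<Sum>v<N. \<bar>Ph I u a v * X v\<bar>) \<le> (\<Sum>v<N. 2 ^ (sz + sz * sz) * b)"
    unfolding abs_mult Ph_def using assms nth_entries_trans(1)[of u I a]
    by (intro sum_mono mult_mono scaled_bound) auto
  also have "\<dots> = int N * 2 ^ (sz + sz * sz) * b" by simp
  finally have 1: "(\<Sum>v<N. \<bar>Ph I u a v * X v\<bar>) + b \<le> (int N * 2 ^ (sz + sz * sz) + 1) * b"
    by (simp add: distrib_right)
  have "N < 2 ^ sz" using less_exp[of sz] sizes(1) by linarith
  then have "int N < int (2 ^ sz)" using of_nat_less_iff[where 'a = int] by blast
  then have "int N < 2 ^ sz" by (metis of_nat_numeral of_nat_power)
  then have "int N + 1 \<le> 2 ^ sz" by linarith
  then have "(int N + 1) * 2 ^ (sz + sz * sz) \<le> 2 ^ sz * 2 ^ (sz + sz * sz)"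
      by (intro mult_right_mono) auto
  also have "\<dots> = 2 ^ (sz + (sz + sz * sz))" by (simp only: power_add)
  also have "\<dots> \<le> E" unfolding EE_def by (intro power_increasing) (simp_all add: power2_eq_square)
  finally have "int N * 2 ^ (sz + sz * sz) + 2 ^ (sz + sz * sz) \<le> E" by (simp add: distrib_right)
  moreover have "(1::int) \<le> 2 ^ (sz + sz * sz)" by simp
  ultimately have "int N * 2 ^ (sz + sz * sz) + 1 \<le> E" by linarith
  then have "(int N * 2 ^ (sz + sz * sz) + 1) * b \<le> E * b" using assms(3) by (rule mult_right_mono)
  with 1 show ?thesis by linarith
qed

lemma DD_power: "1 \<le> DD I ^ s" "s \<le> t \<Longrightarrow> DD I ^ s \<le> E ^ t"
proof -
  show "1 \<le> DD I ^ s" using DD_pos[of I] by (simp add: one_le_power)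
  assume "s \<le> t"
  have "DD I ^ s \<le> E ^ s" using DD_le DD_pos[of I] by (intro power_mono) auto
  also have "\<dots> \<le> E ^ t" using \<open>s \<le> t\<close> E_ge by (intro power_increasing) auto
  finally show "DD I ^ s \<le> E ^ t" .
qed

lemma E_mono: "j \<le> k \<Longrightarrow> E ^ j \<le> E ^ k"
  using E_ge by (intro power_increasing) auto

text \<open>The initial exponent \<open>B\<close> absorbs the power \<open>DD I ^ Suc s\<close> that
  a pull in slot \<open>q\<close> adds.\<close>

lemma Qh_bound:
  assumes "policy I act" "u < N" "s \<le> B"
  shows "\<bar>Qh I act q s u\<bar> \<le> E ^ (B + s)"
  using assms(2,3)
proof (induction s arbitrary: u)
  case 0
  then show ?case using E_ge by simp
next
  case (Suc s)
  have IH: "\<bar>Qh I act q s v\<bar> \<le> E ^ (B + s)" if "v < N" for v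
    using Suc that by simp
  show ?case
  proof (cases "act s u < 0")
    case True
    then have "\<bar>Qh I act q (Suc s) u\<bar> = DD I * \<bar>Qh I act q s u\<bar>"
        using DD_pos[of I] by (simp add: abs_mult)
    also have "\<dots> \<le> E * E ^ (B + s)" using IH[OF Suc.prems(1)] DD_le DD_pos[of I] by (intro
        mult_mono) auto
    finally show ?thesis by simp
  next
    case False
    let ?a = "nat (act s u)"
    have "Qh I act q (Suc s) u = (if q = s then DD I ^ Suc s else 0)
        + (\<Sum>v<N. Ph I u ?a v * Qh I act q s v)"
      using False by simp
    then have "\<bar>Qh I act q (Suc s) u\<bar> \<le> \<bar>if q = s then DD I ^ Suc s else 0\<bar> + (\<Sum>v<N. \<bar>Ph I u ?a v
        * Qh I act q s v\<bar>)"
      using sum_abs[of "\<lambda>v. Ph I u ?a v * Qh I act q s v" "{..<N}"] by linarith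
    also have "\<bar>if q = s then DD I ^ Suc s else 0\<bar> \<le> E ^ (B + s)"
      using DD_power(2)[of "Suc s" "B + s"] DD_power(1)[of "Suc s"] Suc.prems(2) E_ge by auto
    also have "E ^ (B + s) + (\<Sum>v<N. \<bar>Ph I u ?a v * Qh I act q s v\<bar>) \<le> E * E ^ (B + s)"
      using sum_Ph_bound[of u ?a "E ^ (B + s)" "Qh I act q s"] Suc.prems(1)
        policy_action(1)[OF assms(1) Suc.prems(1) False] IH E_ge by simp
    finally show ?thesis by simp
  qed
qed

text \<open>The exponent for the part of a candidate that does not involve later values. As a
  parameter it lets one analysis serve the unpriced and the priced dynamic program.\<close>

definition dp_params :: "nat \<Rightarrow> int \<Rightarrow> int \<Rightarrow> (nat \<Rightarrow> int) \<Rightarrow> bool" where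
  "dp_params c G Z y \<longleftrightarrow> (\<forall>s<B. \<forall>u<N. \<forall>a<A.
     \<bar>G * DD I ^ s * Rh I u a - DD I ^ Suc s * Z * y s\<bar> \<le> E ^ c)"

lemma cand_bound:
  assumes "dp_params c G Z y" "s < B" "u < N" "a < A" "\<And>v. v < N \<Longrightarrow> \<bar>V v\<bar> \<le> E ^ (c + s)"
  shows "\<bar>G * DD I ^ s * Rh I u a - DD I ^ Suc s * Z * y s\<bar> + (\<Sum>v<N. \<bar>Ph I u a v * V v\<bar>) \<le>
      E ^ (c + Suc s)"
    "\<bar>cand I G Z y s V u a\<bar> \<le> E ^ (c + Suc s)"
proof -
  have "\<bar>G * DD I ^ s * Rh I u a - DD I ^ Suc s * Z * y s\<bar> \<le> E ^ c"
    using assms(1-4) unfolding dp_params_def by blast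
  also have "\<dots> \<le> E ^ (c + s)" by (intro E_mono) simp
  finally show *: "\<bar>G * DD I ^ s * Rh I u a - DD I ^ Suc s * Z * y s\<bar> + (\<Sum>v<N. \<bar>Ph I u a v * V v\<bar>)
      \<le> E ^ (c + Suc s)"
    using sum_Ph_bound[of u a "E ^ (c + s)" V] assms(3-5) E_ge by simp
  show "\<bar>cand I G Z y s V u a\<bar> \<le> E ^ (c + Suc s)"
    unfolding cand_def using * sum_abs[of "\<lambda>v. Ph I u a v * V v" "{..<N}"] by linarith
qed

lemma scan_bound:
  assumes "\<And>a. a < m \<Longrightarrow> \<bar>f a\<bar> \<le> b" "\<bar>z\<bar> \<le> b"
  shows "\<bar>fst (scan f br d z m)\<bar> \<le> b"
  using assms by (induction m) auto

lemma Vh_bound: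
  assumes "dp_params c G Z y" "u < N" "s \<le> B"
  shows "\<bar>Vh I G Z y s u\<bar> \<le> E ^ (c + s)"
  using assms(2,3)
proof (induction s arbitrary: u)
  case 0
  then show ?case using E_ge by simp
next
  case (Suc s)
  have IH: "\<bar>Vh I G Z y s v\<bar> \<le> E ^ (c + s)" if "v < N" for v
    using Suc that by simp
  have "\<bar>DD I * Vh I G Z y s u\<bar> \<le> E * E ^ (c + s)"
    unfolding abs_mult using IH[OF Suc.prems(1)] DD_le DD_pos[of I] by (intro mult_mono) auto
  then show ?case
    using cand_bound(2)[OF assms(1) _ Suc.prems(1) _ IH] Suc.prems(2)
    by (simp only: Vh.simps) (intro scan_bound; simp)
qed

lemma dp_paramsI:
  assumes "\<bar>G\<bar> \<le> E ^ (7 + 2 * B)" "\<bar>Z\<bar> \<le> E ^ (1 + 2 * B)" "\<And>q. q < B \<Longrightarrow> \<bar>y q\<bar> \<le> E ^ (10 + 2 * B)"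
  shows "dp_params (12 + 5 * B) G Z y"
  unfolding dp_params_def
proof (intro allI impI)
  fix s u a assume s: "s < B" and ua: "u < N" "a < A"
  have "\<bar>G * DD I ^ s * Rh I u a\<bar> \<le> E ^ (7 + 2 * B) * E ^ B * E"
    unfolding abs_mult using assms(1) DD_power[of s] s Rh_bound[OF ua] E_ge DD_power(2)[of s B]
    by (intro mult_mono) auto
  also have "\<dots> = E ^ (7 + 2 * B + B + 1)" by (simp only: power_add power_one_right)
  also have "\<dots> \<le> E ^ (11 + 5 * B)" by (intro E_mono) simp
  finally have 1: "\<bar>G * DD I ^ s * Rh I u a\<bar> \<le> E ^ (11 + 5 * B)" .
  have "\<bar>DD I ^ Suc s * Z * y s\<bar> \<le> E ^ B * E ^ (1 + 2 * B) * E ^ (10 + 2 * B)"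
    unfolding abs_mult using assms(2,3) DD_power(1)[of "Suc s"] DD_power(2)[of "Suc s" B] s E_ge
    by (intro mult_mono) auto
  also have "\<dots> = E ^ (B + (1 + 2 * B) + (10 + 2 * B))" by (simp only: power_add)
  also have "B + (1 + 2 * B) + (10 + 2 * B) = 11 + 5 * B" by simp
  finally have "\<bar>G * DD I ^ s * Rh I u a\<bar> + \<bar>DD I ^ Suc s * Z * y s\<bar> \<le> 2 * E ^ (11 + 5 * B)"
    using 1 by linarith
  then have "\<bar>G * DD I ^ s * Rh I u a - DD I ^ Suc s * Z * y s\<bar> \<le> 2 * E ^ (11 + 5 * B)"
    using abs_triangle_ineq4 by (rule order_trans[rotated])
  also have "\<dots> \<le> E * E ^ (11 + 5 * B)" using E_ge by (intro mult_right_mono) auto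
  also have "\<dots> = E ^ (1 + (11 + 5 * B))" by (simp only: power_add power_one_right)
  finally show "\<bar>G * DD I ^ s * Rh I u a - DD I ^ Suc s * Z * y s\<bar> \<le> E ^ (12 + 5 * B)" by simp
qed

lemma dp_params_first: "dp_params B 1 0 (\<lambda>_. 0)"
  unfolding dp_params_def
proof (intro allI impI)
  fix s u a assume s: "s < B" and ua: "u < N" "a < A"
  have "\<bar>DD I ^ s * Rh I u a\<bar> \<le> E ^ s * E"
    unfolding abs_mult using DD_power[of s] Rh_bound[OF ua] E_ge by (intro mult_mono) auto
  also have "\<dots> = E ^ Suc s" by simp
  also have "\<dots> \<le> E ^ B" using s by (intro E_mono) simp
  finally show "\<bar>1 * DD I ^ s * Rh I u a - DD I ^ Suc s * 0 * 0\<bar> \<le> E ^ B" by simp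
qed

lemma sum_roots_bound:
  assumes "\<And>u. u < N \<Longrightarrow> \<bar>X u\<bar> \<le> E ^ k"
  shows "(\<Sum>i<n. \<bar>X (root I i)\<bar>) \<le> E ^ Suc k"
proof -
  have "(\<Sum>i<n. \<bar>X (root I i)\<bar>) \<le> (\<Sum>i<n. E ^ k)" using assms roots(1) by (intro sum_mono) auto
  also have "\<dots> = int n * E ^ k" by simp
  also have "\<dots> \<le> E * E ^ k" using nat_le_E sizes E_ge by (intro mult_right_mono) auto
  finally show ?thesis by simp
qed

lemma ZZ_bound: "\<bar>ZZ I\<bar> \<le> E ^ (1 + 2 * B)"
proof -
  have "\<bar>ZZ I\<bar> \<le> (\<Sum>i<n. \<bar>Vh I 1 0 (\<lambda>_. 0) B (root I i)\<bar>)" unfolding ZZ_def by (rule sum_abs)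
  also have "\<dots> \<le> E ^ Suc (B + B)" using Vh_bound[OF dp_params_first] by (intro sum_roots_bound) auto
  finally show ?thesis by (simp add: mult_2)
qed

lemma GG_bound: "0 < GG I" "\<bar>GG I\<bar> \<le> E ^ (7 + 2 * B)"
proof -
  show pos: "0 < GG I" using DD_pos[of I] params_pos by (simp add: GG_def HH_def)
  have "GG I \<le> E ^ 6 * (E ^ B * E ^ B)" unfolding GG_def
    using KK_le_E(3) DD_power(2)[of B B] DD_power(1)[of B] E_ge by (intro mult_mono) auto
  also have "\<dots> = E ^ (6 + 2 * B)" by (simp only: power_add mult_2)
  also have "\<dots> \<le> E ^ (7 + 2 * B)" by (intro E_mono) simp
  finally show "\<bar>GG I\<bar> \<le> E ^ (7 + 2 * B)" using pos by simp
qed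

lemma prices_nonneg: "0 \<le> prices I G Z k q"
  by (cases k) (simp_all add: price_step_def)

text \<open>A step raises a price by at most \<open>E ^ (1 + 2 * B)\<close>, and there are at most
  \<open>E ^ 9\<close> steps.\<close>

lemma prices_bound:
  assumes "0 < G" "k \<le> KK I"
  shows "prices I G Z k q \<le> E ^ (10 + 2 * B)"
proof -
  have pol: "policy I (best_act I G Z y)" for y by (rule optimal_policyD(1)[OF optimal_best_act[OF
      assms(1)]])
  have "prices I G Z k q \<le> int k * E ^ (1 + 2 * B)"
  proof (induction k arbitrary: q)
    case (Suc k)
    let ?S = "\<Sum>i<n. Qh I (best_act I G Z (prices I G Z k)) q B (root I i)"
    have "\<bar>?S\<bar> \<le> (\<Sum>i<n. \<bar>Qh I (best_act I G Z (prices I G Z k)) q B (root I i)\<bar>)" by (rule sum_abs)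
    also have "\<dots> \<le> E ^ Suc (B + B)" using Qh_bound[OF pol] by (intro sum_roots_bound) auto
    finally have "\<bar>?S\<bar> \<le> E ^ (1 + 2 * B)" by (simp add: mult_2)
    moreover have "0 < DD I ^ B" using DD_pos[of I] by simp
    ultimately have "prices I G Z (Suc k) q \<le> prices I G Z k q + E ^ (1 + 2 * B)"
      using prices_nonneg[of G Z k q] by (simp add: price_step_def)
    then show ?case using Suc[of q] by (simp add: distrib_right)
  qed simp
  also have "\<dots> \<le> E ^ 9 * E ^ (1 + 2 * B)"
    using assms(2) KK_le_E(1) E_ge by (intro mult_right_mono) auto
  also have "\<dots> = E ^ (9 + (1 + 2 * B))" by (simp only: power_add)
  finally show ?thesis by simp
qed

lemma dp_params_learned: "k \<le> KK I \<Longrightarrow> dp_params (12 + 5 * B) (GG I) (ZZ I) (prices I (GG I) (ZZ I)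
    k)"
  using GG_bound ZZ_bound prices_nonneg prices_bound by (intro dp_paramsI) auto

end

section \<open>The program: computing the policies\<close>

abbreviation (input) "rD \<equiv> 2 :: nat"
abbreviation (input) "rj \<equiv> 3 :: nat"
abbreviation (input) "rpw \<equiv> 4 :: nat"
abbreviation (input) "rs \<equiv> 5 :: nat"
abbreviation (input) "ru \<equiv> 6 :: nat"
abbreviation (input) "ra \<equiv> 7 :: nat"
abbreviation (input) "rv \<equiv> 8 :: nat"
abbreviation (input) "rq \<equiv> 9 :: nat"
abbreviation (input) "rk \<equiv> 10 :: nat"
abbreviation (input) "ri \<equiv> 11 :: nat"
abbreviation (input) "rt \<equiv> 12 :: nat"
abbreviation (input) "rG \<equiv> 13 :: nat"
abbreviation (input) "rZ \<equiv> 14 :: nat"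
abbreviation (input) "ry \<equiv> 15 :: nat"
abbreviation (input) "rval \<equiv> 16 :: nat"
abbreviation (input) "rbest \<equiv> 17 :: nat"
abbreviation (input) "ract \<equiv> 18 :: nat"
abbreviation (input) "rV \<equiv> 19 :: nat"
abbreviation (input) "rQ \<equiv> 20 :: nat"
abbreviation (input) "rpol \<equiv> 21 :: nat"
abbreviation (input) "rnx \<equiv> 22 :: nat"
abbreviation (input) "racc \<equiv> 23 :: nat"

abbreviation "C0 \<equiv> Const 0"
abbreviation "C1 \<equiv> Const 1"

definition "escaled j = Mul (enum j) (Div (Var rD) (eden j))"
definition "eRh u a = escaled (Add (Mul u eactions) a)"
definition "ePh u a v =
  escaled (Add (Mul enodes eactions) (Add (Mul (Add (Mul u eactions) a) enodes) v))"

definition "cDen = Seq (Set rD C1)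
  (For rj (Add (Mul enodes eactions) (Mul enodes (Mul eactions enodes)))
    (Set rD (Mul (Var rD) (eden (Var rj)))))"

definition "cPowers = Seq (Set rpw C1)
  (For rs ehorizon (Asg rpw (Add (Var rs) C1) C0 C0 (Mul (Rd rpw (Var rs) C0 C0) (Var rD))))"

definition "cCand = Seq
  (Set rval (Sub (Mul (Mul (Var rG) (Rd rpw (Var rs) C0 C0)) (eRh (Var ru) (Var ra)))
     (Mul (Mul (Rd rpw (Add (Var rs) C1) C0 C0) (Var rZ)) (Rd ry (Var rs) C0 C0))))
  (SumLoop rval rv enodes (Mul (ePh (Var ru) (Var ra) (Var rv)) (Rd rV (Var rs) (Var rv) C0)))"

text \<open>On a bridge node, the test is positive iff the action is the default action.\<close>

definition "cBest = If
  (Add (Mul (ebridge (Var ru)) (Sub C1 (Mul (Sub (Var ra) edefault) (Sub (Var ra) edefault))))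
    (Mul (Sub C1 (ebridge (Var ru))) (Sub (Var rval) (Var rbest))))
  (Seq (Set rbest (Var rval)) (Set ract (Var ra))) Skip"

definition "cScan = Seq (Set rbest (Mul (Var rD) (Rd rV (Var rs) (Var ru) C0)))
    (Seq (Set ract (Const (-1)))
  (For ra eactions (Seq cCand
    cBest)))"

text \<open>Branches see signs only, so equality of \<open>q\<close> and \<open>s\<close> is tested
  as \<open>1 - (q - s)^2 > 0\<close>.\<close>

definition "cLoad = If (Sub C0 (Var ract))
  (Asg rQ (Var rq) (Add (Var rs) C1) (Var ru) (Mul (Var rD) (Rd rQ (Var rq) (Var rs) (Var ru))))
  (Seq
    (If (Sub C1 (Mul (Sub (Var rq) (Var rs)) (Sub (Var rq) (Var rs))))
      (Set racc (Rd rpw (Add (Var rs) C1) C0 C0)) (Set racc C0))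
    (Seq (SumLoop racc rv enodes
        (Mul (ePh (Var ru) (Var ract) (Var rv)) (Rd rQ (Var rq) (Var rs) (Var rv))))
      (Asg rQ (Var rq) (Add (Var rs) C1) (Var ru) (Var racc))))"

definition "cLoads = For rq ehorizon
  cLoad"

definition "cNode = Seq cScan (Seq (Asg rV (Add (Var rs) C1) (Var ru) C0 (Var rbest))
  (Seq (Asg rpol (Var rk) (Var rs) (Var ru) (Var ract))
  (Seq (If (Sub C0 (Var ract))
      (Asg rnx (Var rk) (Add (Var rs) C1) (Var ru) (Rd rnx (Var rk) (Var rs) (Var ru)))
      (Asg rnx (Var rk) (Add (Var rs) C1) (Var ru) (Add (Var rs) C1)))
    cLoads)))"

definition "cPass = For rs ehorizon (For ru enodes cNode)"

section \<open>Correctness of the dynamic program\<close>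

lemma val_Rd_nat:
  assumes "ok I W m" "0 \<le> val m i" "0 \<le> val m j" "0 \<le> val m k"
  shows "val m (Rd r i j k) = m (loc I r (nat (val m i)) (nat (val m j)) (nat (val m k)))"
  by (rule val_Rd[OF assms(1)]) (use assms in auto)

lemma nat_int_Suc [simp]: "nat (int k + 1) = Suc k"
  by simp

lemma val_escaled:
  assumes "ok I W m" "m (reg I rD) = DD I" "val m j = int j'" "j' < nentries I"
  shows "val m (escaled j) = scaled I j'"
  using assms val_num_den[OF assms(1,3,4)] by (simp add: escaled_def scaled_def)

lemma val_eRh:
  assumes "ok I W m" "m (reg I rD) = DD I" "val m u = int u'" "val m a = int a'" "u' < nodes I"
      "a' < actions I"
  shows "val m (eRh u a) = Rh I u' a'"
  unfolding eRh_def Rh_def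
  by (rule val_escaled[OF assms(1,2)])
    (use assms nth_entries_rew(1)[of u' I a'] in \<open>simp_all add: nentries_def\<close>)

lemma val_ePh:
  assumes "ok I W m" "m (reg I rD) = DD I" "val m u = int u'" "val m a = int a'" "val m v = int v'"
    "u' < nodes I" "a' < actions I" "v' < nodes I"
  shows "val m (ePh u a v) = Ph I u' a' v'"
  unfolding ePh_def Ph_def
  by (rule val_escaled[OF assms(1,2)])
    (use assms nth_entries_trans(1)[of u' I a' v'] in \<open>simp_all add: nentries_def\<close>)

context superprocess_instance
begin

lemma wp_cDen:
  assumes fin: "\<And>m'. agree I {rD, rj} m m' \<Longrightarrow> m' (reg I rD) = DD I \<Longrightarrow> Q m' e b"
  shows "wp I W Z0 cDen m e Q b"
  unfolding cDen_def
proof (rule wp_Seq, rule wp_Set[where z = 1])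
  show "wp I W Z0 (For rj (Add (Mul enodes eactions) (Mul enodes (Mul eactions enodes)))
      (Set rD (Mul (Var rD) (eden (Var rj))))) (m(reg I rD := 1)) e Q b"
  proof (rule wp_For_det[where n = "nentries I" and
        Inv = "\<lambda>i m'. agree I {rD, rj} m m' \<and> m' (reg I rD) = (\<Prod>i<i. dens I i)"])
    show "nentries I \<le> Z0" "int (nentries I) < 2 ^ W" using le_Z0 nat_less_W sizes by auto
  next
    fix i m' assume i: "i < nentries I" and inv: "agree I {rD, rj} m m' \<and> m' (reg I rD) =
        (\<Prod>i<i. dens I i)"
      and r: "m' (reg I rj) = int i"
    show "wp I W Z0 (Set rD (Mul (Var rD) (eden (Var rj)))) m' e (\<lambda>m'' e' x'. e' = e \<and> x' = b \<and>
       m'' (reg I rj) = int i \<and> agree I {rD, rj} m (m''(reg I rj := int (Suc i))) \<and>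
       (m''(reg I rj := int (Suc i))) (reg I rD) = (\<Prod>i<Suc i. dens I i)) b"
    proof (rule wp_Set[where z = "\<Prod>i<Suc i. dens I i"])
      assume ok: "ok I W m'"
      show "val m' (Mul (Var rD) (eden (Var rj))) = (\<Prod>i<Suc i. dens I i)"
        using ok inv val_num_den(2)[OF ok _ i] r by simp
      have "(2::int) ^ (sz * sz) \<le> E ^ 1" unfolding EE_def
        unfolding power_one_right by (intro power_increasing) (simp_all add: power2_eq_square)
      then show "\<bar>\<Prod>i<Suc i. dens I i\<bar> < 2 ^ W"
        using partial_DD[of "Suc i"] i by (intro E_power_less[of _ 1]) simp_all
    qed (use inv r in simp_all)
  qed (use fin in \<open>auto simp: nentries_def DD_def\<close>)
qed (use nat_less_W[of 1] sizes in simp_all)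

lemma wp_cPowers:
  assumes D: "m (reg I rD) = DD I"
    and fin: "\<And>m'. agree I {rpw, rs} m m' \<Longrightarrow> (\<And>s. s \<le> B \<Longrightarrow> m' (loc I rpw s 0 0) = DD I ^ s) \<Longrightarrow>
        Q m' e b"
  shows "wp I W Z0 cPowers m e Q b"
  unfolding cPowers_def
proof (rule wp_Seq, rule wp_Set[where z = 1])
  show "wp I W Z0 (For rs ehorizon (Asg rpw (Add (Var rs) C1) C0 C0 (Mul (Rd rpw (Var rs) C0 C0)
      (Var rD))))
      (m(reg I rpw := 1)) e Q b"
  proof (rule wp_For_det[where n = B and
        Inv = "\<lambda>i m'. agree I {rpw, rs} m m' \<and> (\<forall>s\<le>i. m' (loc I rpw s 0 0) = DD I ^ s)"])
    show "B \<le> Z0" "int B < 2 ^ W" using le_Z0 nat_less_W sizes by auto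
  next
    fix i m' assume i: "i < B" and ok: "ok I W m'" and r: "m' (reg I rs) = int i"
      and inv: "agree I {rpw, rs} m m' \<and> (\<forall>s\<le>i. m' (loc I rpw s 0 0) = DD I ^ s)"
    have D': "m' (reg I rD) = DD I" using agree_loc[of I "{rpw, rs}" m m' rD] inv D by simp
    show "wp I W Z0 (Asg rpw (Add (Var rs) C1) C0 C0 (Mul (Rd rpw (Var rs) C0 C0) (Var rD))) m' e
       (\<lambda>m'' e' x'. e' = e \<and> x' = b \<and> m'' (reg I rs) = int i \<and>
       agree I {rpw, rs} m (m''(reg I rs := int (Suc i))) \<and>
       (\<forall>s\<le>Suc i. (m''(reg I rs := int (Suc i))) (loc I rpw s 0 0) = DD I ^ s)) b"
    proof (rule wp_Asg[where i' = "Suc i" and j' = 0 and k' = 0 and z = "DD I ^ Suc i"])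
      show "\<bar>DD I ^ Suc i\<bar> < 2 ^ W"
        using DD_power(2)[of "Suc i" "Suc i"] DD_power(1)[of "Suc i"] i sizes(4)
        by (intro E_power_less[of _ "Suc i"]) auto
    qed (use inv r D' in \<open>auto simp: val_Rd_nat le_Suc_eq\<close>)
  qed (use fin in \<open>auto\<close>)
qed (use nat_less_W[of 1] sizes in simp_all)

text \<open>Everything that the choice of an action at level \<open>s\<close> reads, bundled so that
  one frame lemma carries it through the inner loops.\<close>

definition dp_ctx :: "int \<Rightarrow> int \<Rightarrow> (nat \<Rightarrow> int) \<Rightarrow> nat \<Rightarrow> (nat \<Rightarrow> int) \<Rightarrow> bool" where
  "dp_ctx G Z y s m \<longleftrightarrow> m (reg I rD) = DD I \<and> m (loc I rpw s 0 0) = DD I ^ s \<and>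
     m (loc I rpw (Suc s) 0 0) = DD I ^ Suc s \<and> m (reg I rG) = G \<and> m (reg I rZ) = Z \<and>
     m (loc I ry s 0 0) = y s \<and> m (reg I rs) = int s \<and> (\<forall>v<N. m (loc I rV s v 0) = Vh I G Z y s v)"

lemma dp_ctx_agree:
  "dp_ctx G Z y s m \<Longrightarrow> agree I R m m' \<Longrightarrow> R \<inter> {rD, rpw, rG, rZ, ry, rs, rV} = {} \<Longrightarrow> dp_ctx G Z y s m'"
proof -
  assume ctx: "dp_ctx G Z y s m" and ag: "agree I R m m'" and "R \<inter> {rD, rpw, rG, rZ, ry, rs, rV} =
      {}"
  then have "rD \<notin> R" "rpw \<notin> R" "rG \<notin> R" "rZ \<notin> R" "ry \<notin> R" "rs \<notin> R" "rV \<notin> R" by auto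
  with ctx show ?thesis by (simp add: dp_ctx_def agree_loc[OF ag])
qed

lemma wp_cCand:
  assumes ctx: "dp_ctx G Z y s m" "m (reg I ru) = int u" "m (reg I ra) = int a" "s < B" "u < N"
      "a < A"
    and par: "dp_params c G Z y" "c + s + 1 < 20 * (sz + 1)"
    and fin: "\<And>m'. agree I {rval, rv} m m' \<Longrightarrow> m' (reg I rval) = cand I G Z y s (Vh I G Z y s) u a \<Longrightarrow>
        Q m' e b"
  shows "wp I W Z0 cCand m e Q b"
proof -
  let ?b0 = "G * DD I ^ s * Rh I u a - DD I ^ Suc s * Z * y s"
  have bnd: "\<bar>?b0\<bar> + (\<Sum>v<N. \<bar>Ph I u a v * Vh I G Z y s v\<bar>) < 2 ^ W"
    using cand_bound(1)[OF par(1) ctx(4-6), of "Vh I G Z y s"] Vh_bound[OF par(1)] ctx(4) par(2)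
    by (intro E_power_less[of _ "c + Suc s"]) auto
  moreover have "0 \<le> (\<Sum>v<N. \<bar>Ph I u a v * Vh I G Z y s v\<bar>)" by (intro sum_nonneg) simp
  ultimately have bnd0: "\<bar>?b0\<bar> < 2 ^ W" by linarith
  show ?thesis unfolding cCand_def
  proof (rule wp_Seq, rule wp_Set[where z = ?b0])
    assume ok: "ok I W m"
    show "val m (Sub (Mul (Mul (Var rG) (Rd rpw (Var rs) C0 C0)) (eRh (Var ru) (Var ra)))
     (Mul (Mul (Rd rpw (Add (Var rs) C1) C0 C0) (Var rZ)) (Rd ry (Var rs) C0 C0))) = ?b0"
      using ctx ok by (simp add: dp_ctx_def val_Rd_nat val_eRh[where u' = u and a' = a])
  next
    show "\<bar>?b0\<bar> < 2 ^ W" by (rule bnd0)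
    let ?m = "m(reg I rval := ?b0)"
    show "wp I W Z0 (SumLoop rval rv enodes (Mul (ePh (Var ru) (Var ra) (Var rv)) (Rd rV (Var rs)
        (Var rv) C0))) ?m e Q b"
    proof (rule wp_SumLoop[where n = N and z = ?b0 and g = "\<lambda>v. Ph I u a v * Vh I G Z y s v"])
      show "N \<le> Z0" "int N < 2 ^ W" using le_Z0 nat_less_W sizes by auto
      show "\<bar>?b0\<bar> + (\<Sum>v<N. \<bar>Ph I u a v * Vh I G Z y s v\<bar>) < 2 ^ W" by (rule bnd)
    next
      fix v m' assume v: "v < N" and ok: "ok I W m'" and ag: "agree I {rval, rv} ?m m'"
          and r: "m' (reg I rv) = int v"
      show "val m' (Mul (ePh (Var ru) (Var ra) (Var rv)) (Rd rV (Var rs) (Var rv) C0)) =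
          Ph I u a v * Vh I G Z y s v"
        using ctx ok v r
        by (simp add: dp_ctx_def val_Rd_nat val_ePh[where u' = u and a' = a and v' =
            v] agree_loc[OF ag])
    next
      fix m' assume ag: "agree I {rval, rv} ?m m'" and "m' (reg I rval) =
          ?b0 + (\<Sum>v<N. Ph I u a v * Vh I G Z y s v)"
      then show "Q m' e b"
        by (intro fin agree_trans[OF _ ag]) (simp_all add: cand_def)
    qed simp_all
  qed
qed

lemma wp_cScan:
  assumes ctx: "dp_ctx G Z y s m" "m (reg I ru) = int u" "s < B" "u < N"
    and par: "dp_params c G Z y" "c + s + 1 < 20 * (sz + 1)"
    and fin: "\<And>m'. agree I {ra, rv, rval, rbest, ract} m m' \<Longrightarrow> m' (reg I rbest) =
        Vh I G Z y (Suc s) u \<Longrightarrow>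
      m' (reg I ract) = best_act I G Z y s u \<Longrightarrow> Q m' e b"
  shows "wp I W Z0 cScan m e Q b"
proof -
  let ?R = "{ra, rv, rval, rbest, ract}"
  let ?V = "Vh I G Z y s" and ?br = "bridge I u" and ?d = "default I"
  let ?c = "cand I G Z y s ?V u"
  let ?z = "DD I * ?V u"
  let ?sc = "scan ?c ?br ?d ?z"
  have V: "\<bar>?V v\<bar> \<le> E ^ (c + s)" if "v < N" for v using Vh_bound[OF par(1) that] ctx(3) by simp
  have z: "\<bar>?z\<bar> \<le> E ^ (c + Suc s)"
  proof -
    have "\<bar>?z\<bar> \<le> E * E ^ (c + s)"
      unfolding abs_mult using V[OF ctx(4)] DD_le DD_pos[of I] by (intro mult_mono) auto
    then show ?thesis by simp
  qed
  have cb: "\<bar>?c a\<bar> \<le> E ^ (c + Suc s)" if "a < A" for a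
    by (rule cand_bound(2)[OF par(1) ctx(3,4) that V])
  note less = E_power_less[of _ "c + Suc s"]
  have W1: "(1::int) < 2 ^ W" using nat_less_W[of 1] sizes by simp
  show ?thesis unfolding cScan_def
  proof (rule wp_Seq, rule wp_Set[where z = ?z])
    show "ok I W m \<Longrightarrow> val m (Mul (Var rD) (Rd rV (Var rs) (Var ru) C0)) = ?z"
      using ctx by (simp add: dp_ctx_def val_Rd_nat)
    show "\<bar>?z\<bar> < 2 ^ W" using less[OF z] par(2) by simp
    let ?m = "m(reg I rbest := ?z, reg I ract := -1)"
    show "wp I W Z0 (Seq (Set ract (Const (-1)))
      (For ra eactions (Seq cCand
    cBest))) (m(reg I rbest := ?z)) e Q b"
    proof (rule wp_Seq, rule wp_Set[where z = "-1"])
      show "wp I W Z0 (For ra eactions (Seq cCand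
        cBest)) ?m e Q b"
      proof (rule wp_For_det[where n = A and Inv = "\<lambda>a m'. agree I ?R m m' \<and>
            m' (reg I rbest) = fst (?sc a) \<and> m' (reg I ract) = snd (?sc a)"])
        show "A \<le> Z0" "int A < 2 ^ W" using le_Z0 nat_less_W sizes by auto
      next
        fix a m1 assume a: "a < A" and r: "m1 (reg I ra) = int a"
          and inv: "agree I ?R m m1 \<and> m1 (reg I rbest) = fst (?sc a) \<and> m1 (reg I ract) =
              snd (?sc a)"
        let ?P = "\<lambda>m' e' x'. e' = e \<and> x' = b \<and> m' (reg I ra) = int a \<and>
          agree I ?R m (m'(reg I ra := int (Suc a))) \<and>
          (m'(reg I ra := int (Suc a))) (reg I rbest) = fst (?sc (Suc a)) \<and>
          (m'(reg I ra := int (Suc a))) (reg I ract) = snd (?sc (Suc a))"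
        have ctx1: "dp_ctx G Z y s m1" using dp_ctx_agree[OF ctx(1), of ?R m1] inv by simp
        have u1: "m1 (reg I ru) = int u" using agree_loc[of I ?R m m1 ru] inv ctx(2) by simp
        show "wp I W Z0 (Seq cCand
        cBest) m1 e ?P b"
        proof (rule wp_Seq, rule wp_cCand[OF ctx1 u1 r ctx(3,4) a par])
          fix m2 assume ag: "agree I {rval, rv} m1 m2" and v: "m2 (reg I rval) = ?c a"
          have ag2: "agree I ?R m m2"
            using inv agree_trans[of I ?R m m1 m2] agree_mono[OF ag, of ?R] by simp
          have m2: "m2 (reg I ra) = int a" "m2 (reg I ru) = int u" "m2 (reg I rbest) = fst (?sc a)"
            "m2 (reg I ract) = snd (?sc a)" using inv u1 r by (simp_all add: agree_loc[OF ag])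
          let ?t = "Add (Mul (ebridge (Var ru)) (Sub C1 (Mul (Sub (Var ra) edefault) (Sub (Var ra)
              edefault))))
              (Mul (Sub C1 (ebridge (Var ru))) (Sub (Var rval) (Var rbest)))"
          have test: "0 < val m2 ?t \<longleftrightarrow> (if ?br then a = ?d else fst (?sc a) < ?c a)"
              if ok: "ok I W m2"
          proof -
            have "val m2 (ebridge (Var ru)) = of_bool ?br"
              using ok by (intro val_bridge[OF ok _ ctx(4)]) (simp add: m2)
            moreover have "0 < 1 - (int a - int ?d) * (int a - int ?d) \<longleftrightarrow> a = ?d"
            proof (cases "a = ?d")
              case False
              then have "0 < (int a - int ?d) * (int a - int ?d)"
                using zero_less_power2[of "int a - int ?d"] by (simp add: power2_eq_square)
              then show ?thesis using False by simp
            qed simp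
            ultimately show ?thesis using ok by (simp add: m2 v)
          qed
          show "wp I W Z0 cBest m2 e ?P b" unfolding cBest_def
          proof (rule wp_If)
            assume ok: "ok I W m2" and t: "0 < val m2 ?t"
            have sc: "?sc (Suc a) = (?c a, int a)"
              unfolding scan.simps by (rule if_P[OF test[OF ok, THEN iffD1, OF t]])
            show "wp I W Z0 (Seq (Set rbest (Var rval)) (Set ract (Var ra))) m2 e ?P b"
            proof (rule wp_Seq, rule wp_Set[where z = "?c a"])
              show "\<bar>?c a\<bar> < 2 ^ W" using less[OF cb[OF a]] par(2) by simp
              show "wp I W Z0 (Set ract (Var ra)) (m2(reg I rbest := ?c a)) e ?P b"
                by (rule wp_Set[where z = "int a"])
                  (use a sizes(5) nat_less_W[of a] sc m2 ag2 in \<open>simp_all del: scan.simps\<close>)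
            qed (simp add: v)
          next
            assume ok: "ok I W m2" and t: "\<not> 0 < val m2 ?t"
            then have "?sc (Suc a) = ?sc a" using test[OF ok] by (simp only: scan.simps if_False)
            then show "wp I W Z0 Skip m2 e ?P b"
              by (intro wp_Skip) (use m2 ag2 in \<open>simp del: scan.simps\<close>)
          qed
        qed
      next
        fix m' assume "agree I ?R m m' \<and> m' (reg I rbest) = fst (?sc A) \<and> m' (reg I ract) =
            snd (?sc A)"
        then show "Q m' e b" by (intro fin) (simp_all add: best_act_def)
      qed simp_all
    qed (use W1 in simp_all)
  qed
qed

lemma wp_cLoads:
  assumes D: "m (reg I rD) = DD I" "m (reg I rs) = int s" "m (reg I ru) = int u" "m (reg I ract) =
      act s u"
      "m (loc I rpw (Suc s) 0 0) = DD I ^ Suc s"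
    and Qs: "\<And>q v. q < B \<Longrightarrow> v < N \<Longrightarrow> m (loc I rQ q s v) = Qh I act q s v"
    and s: "s < B" and u: "u < N" and pol: "policy I act"
    and fin: "\<And>m'. agree I {rq, racc, rv, rQ} m m' \<Longrightarrow>
      (\<And>q i j. \<not> (i = Suc s \<and> j = u) \<Longrightarrow> m' (loc I rQ q i j) = m (loc I rQ q i j)) \<Longrightarrow>
      (\<And>q. q < B \<Longrightarrow> m' (loc I rQ q (Suc s) u) = Qh I act q (Suc s) u) \<Longrightarrow> Q m' e b"
  shows "wp I W Z0 cLoads m e Q b"
proof -
  let ?R = "{rq, racc, rv, rQ}"
  define Inv where "Inv q m' \<longleftrightarrow> agree I ?R m m' \<and>
      (\<forall>q i j. \<not> (i = Suc s \<and> j = u) \<longrightarrow> m' (loc I rQ q i j) = m (loc I rQ q i j)) \<and>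
      (\<forall>q'<q. m' (loc I rQ q' (Suc s) u) = Qh I act q' (Suc s) u)" for q m'
  have W1: "(1::int) < 2 ^ W" using nat_less_W[of 1] sizes by simp
  have Qb: "\<bar>Qh I act q (Suc s) u\<bar> < 2 ^ W" for q
    using Qh_bound[OF pol u, of "Suc s" q] s sizes(4) by (intro E_power_less[of _ "B + Suc s"]) auto
  show ?thesis unfolding cLoads_def
  proof (rule wp_For_det[where n = B and Inv = Inv])
    show "B \<le> Z0" "int B < 2 ^ W" using le_Z0 nat_less_W sizes by auto
    show "Inv 0 (m(reg I rq := 0))" by (simp add: Inv_def)
    show "val m' ehorizon = int B" if "ok I W m'" for m' using that by simp
    show "Q m' e b" if "Inv B m'" for m' by (rule fin) (use that in \<open>auto simp: Inv_def\<close>)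
  next
    fix q m1 assume q: "q < B" and ok: "ok I W m1" and inv: "Inv q m1" and r: "m1 (reg I rq) =
        int q"
    let ?P = "\<lambda>m' e' x'. e' = e \<and> x' = b \<and> m' (reg I rq) = int q \<and> Inv (Suc q)
        (m'(reg I rq := int (Suc q)))"
    have ag: "agree I ?R m m1" and fr: "\<And>q i j. \<not> (i = Suc s \<and> j = u) \<Longrightarrow> m1 (loc I rQ q i j) =
        m (loc I rQ q i j)"
      using inv by (auto simp: Inv_def)
    have m1: "m1 (reg I rD) = DD I" "m1 (reg I rs) = int s" "m1 (reg I ru) = int u"
        "m1 (reg I ract) = act s u"
      "m1 (loc I rpw (Suc s) 0 0) = DD I ^ Suc s"
      "\<And>v. v < N \<Longrightarrow> m1 (loc I rQ q s v) = Qh I act q s v"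
      using D Qs[OF q] fr by (simp_all add: agree_loc[OF ag])
    \<comment> \<open>Both branches end by storing the same entry, so the invariant is restored once
      for both.\<close>
    have store: "?P (m'(loc I rQ q (Suc s) u := Qh I act q (Suc s) u)) e b"
      if "agree I {racc, rv} m1 m'" for m'
    proof -
      have 1: "m' (loc I rQ q i j) = m1 (loc I rQ q i j)" for q i j using agree_loc[OF that] by simp
      have 2: "m' (reg I rq) = int q" using agree_loc[OF that] r by simp
      have 3: "agree I ?R m m'" using agree_trans[OF ag agree_mono[OF that]] by simp
      show ?thesis using inv 1 2 3 by (auto simp: Inv_def less_Suc_eq simp del: Qh.simps)
    qed
    show "wp I W Z0 cLoad m1 e ?P b" unfolding cLoad_def
    proof (rule wp_If)
      assume ok: "ok I W m1" and "0 < val m1 (Sub C0 (Var ract))"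
      then have neg: "act s u < 0" by (simp add: m1)
      show "wp I W Z0 (Asg rQ (Var rq) (Add (Var rs) C1) (Var ru)
          (Mul (Var rD) (Rd rQ (Var rq) (Var rs) (Var ru)))) m1 e ?P b"
      proof (rule wp_Asg[where i' = q and j' = "Suc s" and k' = u and z = "Qh I act q (Suc s) u"])
        show "?P (m1(loc I rQ q (Suc s) u := Qh I act q (Suc s) u)) e b" by (rule store) simp
      qed (use ok m1 r neg u Qb in \<open>simp_all add: val_Rd_nat\<close>)
    next
      assume ok: "ok I W m1" and "\<not> 0 < val m1 (Sub C0 (Var ract))"
      then have nneg: "\<not> act s u < 0" by (simp add: m1)
      let ?a = "nat (act s u)"
      have a: "?a < A" by (rule policy_action(1)[OF pol u nneg])
      let ?i = "if q = s then DD I ^ Suc s else 0"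
      have "\<bar>?i\<bar> \<le> E ^ (B + s)" using DD_power(2)[of "Suc s"
          "B + s"] DD_power(1)[of "Suc s"] s E_ge by auto
      moreover have "(\<Sum>v<N. \<bar>Ph I u ?a v * Qh I act q s v\<bar>) + E ^ (B + s) \<le> E * E ^ (B + s)"
        using sum_Ph_bound[OF u a, of "E ^ (B + s)" "Qh I act q s"] Qh_bound[OF pol] s E_ge by simp
      ultimately have "\<bar>?i\<bar> + (\<Sum>v<N. \<bar>Ph I u ?a v * Qh I act q s v\<bar>) \<le> E ^ Suc (B + s)" by simp
      then have bnd: "\<bar>?i\<bar> + (\<Sum>v<N. \<bar>Ph I u ?a v * Qh I act q s v\<bar>) < 2 ^ W"
        using s sizes(4) by (intro E_power_less[of _ "Suc (B + s)"]) auto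
      moreover have "0 \<le> (\<Sum>v<N. \<bar>Ph I u ?a v * Qh I act q s v\<bar>)" by (intro sum_nonneg) simp
      ultimately have bnd0: "\<bar>?i\<bar> < 2 ^ W" by linarith
      have test: "0 < 1 - (int q - int s) * (int q - int s) \<longleftrightarrow> q = s"
      proof (cases "q = s")
        case False
        then have "0 < (int q - int s) * (int q - int s)"
          using zero_less_power2[of "int q - int s"] by (simp add: power2_eq_square)
        then show ?thesis using False by simp
      qed simp
      let ?rest = "Seq (SumLoop racc rv enodes
          (Mul (ePh (Var ru) (Var ract) (Var rv)) (Rd rQ (Var rq) (Var rs) (Var rv))))
        (Asg rQ (Var rq) (Add (Var rs) C1) (Var ru) (Var racc))"
      have rest: "wp I W Z0 ?rest (m1(reg I racc := ?i)) e ?P b"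
      proof (rule wp_Seq, rule wp_SumLoop[where n = N and z = ?i and g =
          "\<lambda>v. Ph I u ?a v * Qh I act q s v"])
        show "N \<le> Z0" "int N < 2 ^ W" using le_Z0 nat_less_W sizes by auto
        show "\<bar>?i\<bar> + (\<Sum>v<N. \<bar>Ph I u ?a v * Qh I act q s v\<bar>) < 2 ^ W" by (rule bnd)
      next
        fix v m' assume v: "v < N" and ok: "ok I W m'" and ag: "agree I {racc,
            rv} (m1(reg I racc := ?i)) m'"
          and rv: "m' (reg I rv) = int v"
        show "val m' (Mul (ePh (Var ru) (Var ract) (Var rv)) (Rd rQ (Var rq) (Var rs) (Var rv))) =
            Ph I u ?a v * Qh I act q s v"
          using m1 r ok v rv u a nneg
          by (simp add: val_Rd_nat val_ePh[where u' = u and a' = ?a and v' = v] agree_loc[OF ag])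
      next
        fix m' assume ag: "agree I {racc, rv} (m1(reg I racc := ?i)) m'"
          and acc: "m' (reg I racc) = ?i + (\<Sum>v<N. Ph I u ?a v * Qh I act q s v)"
        have ag': "agree I {racc, rv} m1 m'" by (rule agree_trans[OF _ ag]) simp
        show "wp I W Z0 (Asg rQ (Var rq) (Add (Var rs) C1) (Var ru) (Var racc)) m' e ?P b"
        proof (rule wp_Asg[where i' = q and j' = "Suc s" and k' = u and z = "Qh I act q (Suc s) u"])
          show "?P (m'(loc I rQ q (Suc s) u := Qh I act q (Suc s) u)) e b" by (rule store[OF ag'])
          show "ok I W m' \<Longrightarrow> val m' (Var rq) = int q \<and> val m' (Add (Var rs) C1) = int (Suc s) \<and>
              val m' (Var ru) = int u \<and> val m' (Var racc) = Qh I act q (Suc s) u"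
            using acc m1 r nneg by (simp add: agree_loc[OF ag'])
        qed (rule Qb)
      qed simp_all
      show "wp I W Z0 (Seq (If (Sub C1 (Mul (Sub (Var rq) (Var rs)) (Sub (Var rq) (Var rs))))
        (Set racc (Rd rpw (Add (Var rs) C1) C0 C0)) (Set racc C0)) ?rest) m1 e ?P b"
      proof (rule wp_Seq, rule wp_If)
        assume ok: "ok I W m1" and "0 < val m1 (Sub C1 (Mul (Sub (Var rq) (Var rs)) (Sub (Var rq)
            (Var rs))))"
        then have "q = s" using test by (simp add: m1 r)
        then show "wp I W Z0 (Set racc (Rd rpw (Add (Var rs) C1) C0 C0))
            m1 e (\<lambda>m' e' x. wp I W Z0 ?rest m' e' ?P x) b"
          using bnd0 rest m1 by (intro wp_Set[where z = ?i]) (simp_all add: val_Rd_nat)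
      next
        assume ok: "ok I W m1" and "\<not> 0 < val m1 (Sub C1 (Mul (Sub (Var rq) (Var rs))
            (Sub (Var rq) (Var rs))))"
        then have "q \<noteq> s" using test by (simp add: m1 r)
        then show "wp I W Z0 (Set racc C0) m1 e (\<lambda>m' e' x. wp I W Z0 ?rest m' e' ?P x) b"
          using bnd0 rest by (intro wp_Set[where z = ?i]) simp_all
      qed
    qed
  qed
qed


lemma scan_ge: "-1 \<le> snd (scan f br d z m)"
  by (induction m) auto

abbreviation "node_regs \<equiv> {ra, rv, rval, rbest, ract, rq, racc, rV, rQ, rpol, rnx}"

lemma wp_cNode:
  fixes k :: nat and G Z :: int and y :: "nat \<Rightarrow> int"
  defines "act \<equiv> best_act I G Z y"
  assumes ctx: "dp_ctx G Z y s m" "m (reg I ru) = int u" "m (reg I rk) = int k" "s < B" "u < N"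
      "0 < G"
    and par: "dp_params c G Z y" "c + s + 1 < 20 * (sz + 1)"
    and Qs: "\<And>q v. q < B \<Longrightarrow> v < N \<Longrightarrow> m (loc I rQ q s v) = Qh I act q s v"
    and nxs: "m (loc I rnx k s u) = int (nx act s u)"
    and fin: "\<And>m'. agree I node_regs m m' \<Longrightarrow>
      (\<And>i j l. \<not> (i = Suc s \<and> j = u) \<Longrightarrow> m' (loc I rV i j l) = m (loc I rV i j l)) \<Longrightarrow>
      (\<And>q i j. \<not> (i = Suc s \<and> j = u) \<Longrightarrow> m' (loc I rQ q i j) = m (loc I rQ q i j)) \<Longrightarrow>
      (\<And>l i j. \<not> (l = k \<and> i = s \<and> j = u) \<Longrightarrow> m' (loc I rpol l i j) = m (loc I rpol l i j)) \<Longrightarrow>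
      (\<And>l i j. \<not> (l = k \<and> i = Suc s \<and> j = u) \<Longrightarrow> m' (loc I rnx l i j) = m (loc I rnx l i j)) \<Longrightarrow>
      m' (loc I rV (Suc s) u 0) = Vh I G Z y (Suc s) u \<Longrightarrow>
      (\<And>q. q < B \<Longrightarrow> m' (loc I rQ q (Suc s) u) = Qh I act q (Suc s) u) \<Longrightarrow>
      m' (loc I rpol k s u) = act s u \<Longrightarrow>
      m' (loc I rnx k (Suc s) u) = int (nx act (Suc s) u) \<Longrightarrow> Q m' e b"
  shows "wp I W Z0 cNode m e Q b"
proof -
  have pol: "policy I act" unfolding act_def by (rule optimal_policyD(1)[OF optimal_best_act[OF
      ctx(6)]])
  let ?a = "act s u" and ?v = "Vh I G Z y (Suc s) u" and ?nx = "int (nx act (Suc s) u)"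
  have "-1 \<le> ?a" unfolding act_def best_act_def by (rule scan_ge)
  moreover have "?a < int A"
    using pol ctx(5) params_pos(3) unfolding policy_def by (metis of_nat_less_iff)
  moreover have "int A < 2 ^ W" using nat_less_W sizes by simp
  ultimately have aW: "\<bar>?a\<bar> < 2 ^ W" using params_pos(3) by linarith
  have vW: "\<bar>?v\<bar> < 2 ^ W"
    by (rule E_power_less[OF Vh_bound[OF par(1) ctx(5)]]) (use ctx(4) par(2) in simp_all)
  have nW: "\<bar>?nx\<bar> < 2 ^ W"
    using nx_le[of act "Suc s" u] ctx(4) sizes(4) nat_less_W[of "nx act (Suc s)
        u"] by (simp del: nx.simps)
  show ?thesis unfolding cNode_def
  proof (rule wp_Seq, rule wp_cScan[OF ctx(1,2,4,5) par])
    fix m1 assume ag1: "agree I {ra, rv, rval, rbest, ract} m m1" and best: "m1 (reg I rbest) = ?v"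
      and "m1 (reg I ract) = best_act I G Z y s u"
    then have a1: "m1 (reg I ract) = ?a" by (simp add: act_def)
    note f1 = agree_loc[OF ag1]
    have s1: "m1 (reg I rs) = int s" using ctx(1) by (simp add: f1 dp_ctx_def)
    let ?m2 = "m1(loc I rV (Suc s) u 0 := ?v)"
    let ?m3 = "?m2(loc I rpol k s u := ?a)"
    let ?m4 = "?m3(loc I rnx k (Suc s) u := ?nx)"
    have loads: "wp I W Z0 cLoads ?m4 e Q b"
    proof (rule wp_cLoads[where act = act and s = s and u = u])
      fix m' assume ag: "agree I {rq, racc, rv, rQ} ?m4 m'"
        and fr: "\<And>q i j. \<not> (i = Suc s \<and> j = u) \<Longrightarrow> m' (loc I rQ q i j) = ?m4 (loc I rQ q i j)"
        and val: "\<And>q. q < B \<Longrightarrow> m' (loc I rQ q (Suc s) u) = Qh I act q (Suc s) u"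
      note f = agree_loc[OF ag]
      show "Q m' e b"
      proof (rule fin)
        have "agree I node_regs m ?m4" by (intro agree_upd agree_mono[OF ag1]) auto
        then show "agree I node_regs m m'" by (rule agree_trans) (rule agree_mono[OF ag], auto)
      qed (use val fr in \<open>auto simp: f f1\<close>)
    qed (use ctx Qs s1 a1 pol in \<open>auto simp: f1 dp_ctx_def\<close>)
    show "wp I W Z0 (Seq (Asg rV (Add (Var rs) C1) (Var ru) C0 (Var rbest))
      (Seq (Asg rpol (Var rk) (Var rs) (Var ru) (Var ract))
      (Seq (If (Sub C0 (Var ract))
          (Asg rnx (Var rk) (Add (Var rs) C1) (Var ru) (Rd rnx (Var rk) (Var rs) (Var ru)))
          (Asg rnx (Var rk) (Add (Var rs) C1) (Var ru) (Add (Var rs) C1)))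
        cLoads))) m1 e Q b"
    proof (rule wp_Seq, rule wp_Asg[where i' = "Suc s" and j' = u and k' = 0 and z = ?v],
        goal_cases)
      case 3
      show ?case
      proof (rule wp_Seq, rule wp_Asg[where i' = k and j' = s and k' = u and z = ?a], goal_cases)
        case 3
        show ?case
        proof (rule wp_Seq, rule wp_If)
          assume "ok I W ?m3" "0 < val ?m3 (Sub C0 (Var ract))"
          then have "?a < 0" using a1 by simp
          then show "wp I W Z0 (Asg rnx (Var rk) (Add (Var rs) C1) (Var ru) (Rd rnx (Var rk)
              (Var rs) (Var ru)))
              ?m3 e (\<lambda>m' e' x. wp I W Z0 cLoads m' e' Q x) b"
            by (intro wp_Asg[where i' = k and j' = "Suc s" and k' = u and z = ?nx])
              (use s1 ctx nxs nW loads in \<open>simp_all add: f1 val_Rd_nat\<close>)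
        next
          assume "ok I W ?m3" "\<not> 0 < val ?m3 (Sub C0 (Var ract))"
          then have "\<not> ?a < 0" using a1 by simp
          then show "wp I W Z0 (Asg rnx (Var rk) (Add (Var rs) C1) (Var ru) (Add (Var rs) C1))
              ?m3 e (\<lambda>m' e' x. wp I W Z0 cLoads m' e' Q x) b"
            by (intro wp_Asg[where i' = k and j' = "Suc s" and k' = u and z = ?nx])
              (use s1 ctx nxs nW loads in \<open>simp_all add: f1\<close>)
        qed
      qed (use s1 ctx a1 aW in \<open>simp_all add: f1\<close>)
    qed (use s1 ctx best vW in \<open>simp_all add: f1\<close>)
  qed
qed

abbreviation "pass_regs \<equiv> {rs, ru} \<union> node_regs"

text \<open>Memory starts at 0, which is the right content of the rows for 0 remaining slots. As the
  tables are reused, every pass has to preserve these rows.\<close>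

definition zero_rows :: "(nat \<Rightarrow> int) \<Rightarrow> bool" where
  "zero_rows m \<longleftrightarrow> (\<forall>i j. m (loc I rV 0 i j) = 0 \<and> m (loc I rQ i 0 j) = 0 \<and> m (loc I rnx i 0 j) = 0)"

text \<open>Values and loads are overwritten by each pass, whereas policies and next slots are
  indexed by the pass \<open>k\<close>, so those of other passes survive.\<close>

lemma wp_cPass:
  fixes k :: nat and G Z :: int and y :: "nat \<Rightarrow> int"
  defines "act \<equiv> best_act I G Z y"
  assumes m: "m (reg I rD) = DD I" "\<And>s. s \<le> B \<Longrightarrow> m (loc I rpw s 0 0) = DD I ^ s"
      "m (reg I rG) = G" "m (reg I rZ) = Z" "\<And>s. s < B \<Longrightarrow> m (loc I ry s 0 0) = y s" "m (reg I rk) =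
          int k"
      "zero_rows m"
    and G: "0 < G" and par: "dp_params c G Z y" "c + B < 20 * (sz + 1)"
    and fin: "\<And>m'. agree I pass_regs m m' \<Longrightarrow> zero_rows m' \<Longrightarrow>
      (\<And>u. u < N \<Longrightarrow> m' (loc I rV B u 0) = Vh I G Z y B u) \<Longrightarrow>
      (\<And>q u. q < B \<Longrightarrow> u < N \<Longrightarrow> m' (loc I rQ q B u) = Qh I act q B u) \<Longrightarrow>
      (\<And>s u. s < B \<Longrightarrow> u < N \<Longrightarrow> m' (loc I rpol k s u) = act s u) \<Longrightarrow>
      (\<And>s u. s \<le> B \<Longrightarrow> u < N \<Longrightarrow> m' (loc I rnx k s u) = int (nx act s u)) \<Longrightarrow>
      (\<And>l i j. l \<noteq> k \<Longrightarrow> m' (loc I rpol l i j) = m (loc I rpol l i j) \<and>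
        m' (loc I rnx l i j) = m (loc I rnx l i j)) \<Longrightarrow> Q m' e b"
  shows "wp I W Z0 cPass m e Q b"
proof -
  define cell where "cell s u m' \<longleftrightarrow> m' (loc I rV s u 0) = Vh I G Z y s u \<and>
      (\<forall>q<B. m' (loc I rQ q s u) = Qh I act q s u) \<and> m' (loc I rnx k s u) = int (nx act s u)"
          for s u m'
  define Inv where "Inv s u m' \<longleftrightarrow> agree I pass_regs m m' \<and> zero_rows m' \<and>
      (\<forall>s' u'. (s' \<le> s \<and> u' < N \<or> s' = Suc s \<and> u' < u) \<longrightarrow> cell s' u' m') \<and>
      (\<forall>s' u'. (s' < s \<and> u' < N \<or> s' = s \<and> u' < u) \<longrightarrow> m' (loc I rpol k s' u') = act s' u') \<and>
      (\<forall>l i j. l \<noteq> k \<longrightarrow> m' (loc I rpol l i j) = m (loc I rpol l i j) \<and>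
        m' (loc I rnx l i j) = m (loc I rnx l i j))" for s u m'
  have upd: "Inv s u (m'(reg I r := z))" if "Inv s u m'" "r \<in> {rs, ru}" for s u m' r z
    using that(2) by (elim insertE emptyE)
      (use that(1) in \<open>simp_all add: Inv_def cell_def zero_rows_def\<close>)
  show ?thesis unfolding cPass_def
  proof (rule wp_For_det[where n = B and Inv = "\<lambda>s. Inv s 0"])
    show "B \<le> Z0" "int B < 2 ^ W" using le_Z0 nat_less_W sizes by auto
    show "Inv 0 0 (m(reg I rs := 0))"
      using m(7) by (auto simp: Inv_def cell_def zero_rows_def)
    show "val m' ehorizon = int B" if "ok I W m'" for m' using that by simp
    show "Q m' e b" if "Inv B 0 m'" for m'
      by (rule fin) (use that in \<open>auto simp: Inv_def cell_def\<close>)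
  next
    fix s m1 assume s: "s < B" and inv1: "Inv s 0 m1" and r1: "m1 (reg I rs) = int s"
    show "wp I W Z0 (For ru enodes cNode) m1 e (\<lambda>m' e' x'. e' = e \<and> x' = b \<and> m' (reg I rs) = int s \<and>
        Inv (Suc s) 0 (m'(reg I rs := int (Suc s)))) b"
    proof (rule wp_For_det[where n = N and Inv = "\<lambda>u m'. Inv s u m' \<and> m' (reg I rs) = int s"])
      show "N \<le> Z0" "int N < 2 ^ W" using le_Z0 nat_less_W sizes by auto
      show "Inv s 0 (m1(reg I ru := 0)) \<and> (m1(reg I ru := 0)) (reg I rs) = int s"
        using upd[OF inv1, of ru 0] r1 by simp
      show "val m' enodes = int N" if "ok I W m'" for m' using that by simp
      show "e = e \<and> b = b \<and> m' (reg I rs) = int s \<and> Inv (Suc s) 0 (m'(reg I rs := int (Suc s)))"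
        if "Inv s N m' \<and> m' (reg I rs) = int s" for m'
      proof -
        have "Inv (Suc s) 0 m'" using that unfolding Inv_def by (auto simp: le_Suc_eq less_Suc_eq)
        from upd[OF this, of rs] show ?thesis using that by simp
      qed
    next
      fix u m2 assume u: "u < N" and inv: "Inv s u m2 \<and> m2 (reg I rs) = int s"
          and r2: "m2 (reg I ru) = int u"
      have ag: "agree I pass_regs m m2" and zr: "zero_rows m2"
        and cells: "\<And>s' u'. s' \<le> s \<and> u' < N \<or> s' = Suc s \<and> u' < u \<Longrightarrow> cell s' u' m2"
        and pols: "\<And>s' u'. s' < s \<and> u' < N \<or> s' = s \<and> u' < u \<Longrightarrow> m2 (loc I rpol k s' u') = act s' u'"
        and other: "\<And>l i j. l \<noteq> k \<Longrightarrow> m2 (loc I rpol l i j) = m (loc I rpol l i j) \<and>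
          m2 (loc I rnx l i j) = m (loc I rnx l i j)"
        using inv unfolding Inv_def by blast+
      note f = agree_loc[OF ag]
      have ctx: "dp_ctx G Z y s m2"
        using m(1-5) s inv cells[of s] by (simp add: dp_ctx_def f cell_def)
      show "wp I W Z0 cNode m2 e (\<lambda>m' e' x'. e' = e \<and> x' = b \<and> m' (reg I ru) = int u \<and>
          (Inv s (Suc u) (m'(reg I ru := int (Suc u))) \<and> (m'(reg I ru := int (Suc u))) (reg I rs)
              = int s)) b"
      proof (rule wp_cNode[OF ctx r2 _ s u G par(1)])
        show "m2 (reg I rk) = int k" using m(6) by (simp add: f)
        show "c + s + 1 < 20 * (sz + 1)" using par(2) s by simp
        show "m2 (loc I rQ q s v) = Qh I (best_act I G Z y) q s v" if "q < B" "v < N" for q v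
          using cells[of s v] that by (simp add: cell_def act_def)
        show "m2 (loc I rnx k s u) = int (nx (best_act I G Z y) s u)"
          using cells[of s u] u by (simp add: cell_def act_def)
      next
        fix m' assume ag': "agree I node_regs m2 m'"
          and V: "\<And>i j l. \<not> (i = Suc s \<and> j = u) \<Longrightarrow> m' (loc I rV i j l) = m2 (loc I rV i j l)"
          and Q: "\<And>q i j. \<not> (i = Suc s \<and> j = u) \<Longrightarrow> m' (loc I rQ q i j) = m2 (loc I rQ q i j)"
          and P: "\<And>l i j. \<not> (l = k \<and> i = s \<and> j = u) \<Longrightarrow> m' (loc I rpol l i j) = m2 (loc I rpol l i j)"
          and X: "\<And>l i j. \<not> (l = k \<and> i = Suc s \<and> j = u) \<Longrightarrow> m' (loc I rnx l i j) =
              m2 (loc I rnx l i j)"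
          and new: "m' (loc I rV (Suc s) u 0) = Vh I G Z y (Suc s) u"
            "\<And>q. q < B \<Longrightarrow> m' (loc I rQ q (Suc s) u) = Qh I (best_act I G Z y) q (Suc s) u"
            "m' (loc I rpol k s u) = best_act I G Z y s u"
            "m' (loc I rnx k (Suc s) u) = int (nx (best_act I G Z y) (Suc s) u)"
        have "agree I pass_regs m m'" by (rule agree_trans[OF ag agree_mono[OF ag']]) auto
        moreover have "zero_rows m'" using zr by (simp add: zero_rows_def V Q X)
        moreover have "cell s' u' m'" if "s' \<le> s \<and> u' < N \<or> s' = Suc s \<and> u' < Suc u" for s' u'
        proof (cases "s' = Suc s \<and> u' = u")
          case True
          then show ?thesis using new by (simp add: cell_def act_def del: Qh.simps Vh.simps
              nx.simps)
        next
          case False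
          then have "cell s' u' m2" using that by (intro cells) auto
          then show ?thesis using False by (auto simp: cell_def V Q X)
        qed
        moreover have "m' (loc I rpol k s' u') = act s' u'" if "s' < s \<and> u' < N \<or> s' = s \<and>
            u' < Suc u" for s' u'
          using that new(3) P[of k s' u'] pols[of s' u'] by (cases "s' = s \<and> u' = u")
              (auto simp: act_def)
        moreover have "m' (loc I rpol l i j) = m (loc I rpol l i j) \<and> m' (loc I rnx l i j) =
            m (loc I rnx l i j)"
          if "l \<noteq> k" for l i j using other[OF that] that by (simp add: P X)
        ultimately have "Inv s (Suc u) m'" unfolding Inv_def by blast
        then have "Inv s (Suc u) (m'(reg I ru := int (Suc u)))" by (rule upd) simp
        then show "e = e \<and> b = b \<and> m' (reg I ru) = int u \<and>
          (Inv s (Suc u) (m'(reg I ru := int (Suc u))) \<and> (m'(reg I ru := int (Suc u))) (reg I rs)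
              = int s)"
          using r2 inv by (simp add: agree_loc[OF ag'])
      qed
    qed
  qed
qed

end

definition "eHH = Mul (Mul (Mul (Const 2) (Mul ehorizon ehorizon)) (Mul earms (Mul earms earms)))
    C1"
definition "eKK = Mul (Mul (Const 16) (Mul ehorizon ehorizon))
  (Add (Mul (Const 2) eHH) (Mul ehorizon (Mul earms earms)))"

definition "cPrice = Seq (Set racc (Sub (Rd ry (Var rq) C0 C0) (Rd rpw ehorizon C0 C0)))
  (Seq (SumLoop racc ri earms (Rd rQ (Var rq) ehorizon (eroot (Var ri))))
    (If (Var racc) (Asg ry (Var rq) C0 C0 (Var racc)) (Asg ry (Var rq) C0 C0 C0)))"

definition "cPrices = For rq ehorizon
  cPrice"

text \<open>The first pass runs without prices to obtain \<open>ZZ I\<close>. It writes its policy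
  under number 0, where the first priced pass replaces it.\<close>

definition "cLearn = Seq cDen (Seq cPowers (Seq (Set rG C1) (Seq cPass
  (Seq (Set rZ C0) (Seq (SumLoop rZ ri earms (Rd rV ehorizon (eroot (Var ri)) C0))
  (Seq (Set rG (Mul eHH (Mul (Rd rpw ehorizon C0 C0) (Rd rpw ehorizon C0 C0))))
  (For rk eKK (Seq cPass cPrices))))))))"

lemma val_eHH: "ok I W m \<Longrightarrow> val m eHH = int (HH I)"
  by (simp add: eHH_def HH_def power2_eq_square power3_eq_cube)

lemma val_eKK: "ok I W m \<Longrightarrow> val m eKK = int (KK I)"
  by (simp add: eKK_def KK_def val_eHH power2_eq_square)

context superprocess_instance
begin

lemma wp_cPrices:
  assumes m: "\<And>s. s \<le> B \<Longrightarrow> m (loc I rpw s 0 0) = DD I ^ s" "\<And>q. q < B \<Longrightarrow> m (loc I ry q 0 0) = y q"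
      "\<And>q u. q < B \<Longrightarrow> u < N \<Longrightarrow> m (loc I rQ q B u) = Qh I act q B u"
    and pol: "policy I act" and y: "\<And>q. q < B \<Longrightarrow> 0 \<le> y q \<and> y q \<le> E ^ (10 + 2 * B)"
    and fin: "\<And>m'. agree I {rq, racc, ri, ry} m m' \<Longrightarrow>
      (\<And>q. q < B \<Longrightarrow> m' (loc I ry q 0 0) = price_step I act y q) \<Longrightarrow> Q m' e b"
  shows "wp I W Z0 cPrices m e Q b"
proof -
  let ?R = "{rq, racc, ri, ry}"
  define Inv where "Inv q m' \<longleftrightarrow> agree I ?R m m' \<and> (\<forall>q'<q. m' (loc I ry q' 0 0) =
      price_step I act y q') \<and>
    (\<forall>q'\<ge>q. m' (loc I ry q' 0 0) = m (loc I ry q' 0 0))" for q m'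
  show ?thesis unfolding cPrices_def
  proof (rule wp_For_det[where n = B and Inv = Inv])
    show "B \<le> Z0" "int B < 2 ^ W" using le_Z0 nat_less_W sizes by auto
    show "Inv 0 (m(reg I rq := 0))" by (simp add: Inv_def)
    show "val m' ehorizon = int B" if "ok I W m'" for m' using that by simp
    show "Q m' e b" if "Inv B m'" for m' by (rule fin) (use that in \<open>auto simp: Inv_def\<close>)
  next
    fix q m1 assume q: "q < B" and inv: "Inv q m1" and r: "m1 (reg I rq) = int q"
    let ?P = "\<lambda>m' e' x'. e' = e \<and> x' = b \<and> m' (reg I rq) = int q \<and> Inv (Suc q)
        (m'(reg I rq := int (Suc q)))"
    have ag: "agree I ?R m m1" using inv by (simp add: Inv_def)
    note f = agree_loc[OF ag]
    let ?z = "y q - DD I ^ B" and ?g = "\<lambda>i. Qh I act q B (root I i)"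
    have y1: "m1 (loc I ry q 0 0) = y q" using inv m(2)[OF q] by (simp add: Inv_def)
    have "\<bar>?z\<bar> \<le> E ^ (10 + 2 * B) + E ^ (10 + 2 * B)"
      using y[OF q, THEN conjunct1] y[OF q, THEN conjunct2] DD_power(2)[of B "10 + 2 * B"]
          DD_power(1)[of B]
      by linarith
    moreover have "(\<Sum>i<n. \<bar>?g i\<bar>) \<le> E ^ Suc (B + B)"
        using Qh_bound[OF pol] by (intro sum_roots_bound) auto
    moreover have "E ^ Suc (B + B) \<le> E ^ (10 + 2 * B)" by (intro E_mono) simp
    ultimately have "\<bar>?z\<bar> + (\<Sum>i<n. \<bar>?g i\<bar>) \<le> 3 * E ^ (10 + 2 * B)" by linarith
    also have "\<dots> \<le> E * E ^ (10 + 2 * B)" using E_ge by (intro mult_right_mono) auto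
    also have "\<dots> = E ^ Suc (10 + 2 * B)" by (simp only: power_Suc)
    finally have bnd: "\<bar>?z\<bar> + (\<Sum>i<n. \<bar>?g i\<bar>) < 2 ^ W"
      by (rule E_power_less) (use sizes(4) in simp)
    have "\<bar>?z + (\<Sum>i<n. ?g i)\<bar> \<le> \<bar>?z\<bar> + (\<Sum>i<n. \<bar>?g i\<bar>)"
      using sum_abs[of ?g "{..<n}"] abs_triangle_ineq[of ?z "\<Sum>i<n. ?g i"] by linarith
    then have bnd1: "\<bar>?z + (\<Sum>i<n. ?g i)\<bar> < 2 ^ W" using bnd by linarith
    have "0 \<le> (\<Sum>i<n. \<bar>?g i\<bar>)" by (intro sum_nonneg) simp
    then have bnd0: "\<bar>?z\<bar> < 2 ^ W" using bnd by linarith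
    show "wp I W Z0 cPrice m1 e ?P b" unfolding cPrice_def
    proof (rule wp_Seq, rule wp_Set[where z = ?z])
      show "ok I W m1 \<Longrightarrow> val m1 (Sub (Rd ry (Var rq) C0 C0) (Rd rpw ehorizon C0 C0)) = ?z"
        using r y1 m(1)[of B] by (simp add: val_Rd_nat f)
      show "\<bar>?z\<bar> < 2 ^ W" by (rule bnd0)
      show "wp I W Z0 (Seq (SumLoop racc ri earms (Rd rQ (Var rq) ehorizon (eroot (Var ri))))
        (If (Var racc) (Asg ry (Var rq) C0 C0 (Var racc)) (Asg ry (Var rq) C0 C0 C0)))
            (m1(reg I racc := ?z)) e ?P b"
      proof (rule wp_Seq, rule wp_SumLoop[where n = n and z = ?z and g = ?g])
        show "n \<le> Z0" "int n < 2 ^ W" using le_Z0 nat_less_W sizes by auto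
        show "\<bar>?z\<bar> + (\<Sum>i<n. \<bar>?g i\<bar>) < 2 ^ W" by (rule bnd)
      next
        fix i m' assume i: "i < n" and ok: "ok I W m'" and ag': "agree I {racc,
            ri} (m1(reg I racc := ?z)) m'"
          and ri: "m' (reg I ri) = int i"
        show "val m' (Rd rQ (Var rq) ehorizon (eroot (Var ri))) = ?g i"
          using val_root[OF ok _ i, of "Var ri"] ok ri r m(3)[OF q roots(1)[OF i]]
          by (simp add: val_Rd_nat agree_loc[OF ag'] f)
            (use inv in \<open>simp add: Inv_def\<close>)?
      next
        fix m' assume ag': "agree I {racc, ri} (m1(reg I racc := ?z)) m'"
          and acc: "m' (reg I racc) = ?z + (\<Sum>i<n. ?g i)"
        note f' = agree_loc[OF ag']
        have ag2: "agree I ?R m m'"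
          using agree_trans[OF agree_upd[OF ag] agree_mono[OF ag']] by simp
        have store: "wp I W Z0 (Asg ry (Var rq) C0 C0 h) m' e ?P b"
          if "ok I W m' \<Longrightarrow> val m' h = price_step I act y q" "\<bar>price_step I act y q\<bar> < 2 ^ W" for h
        proof (rule wp_Asg[where i' = q and j' = 0 and k' = 0 and z = "price_step I act y q"])
          show "ok I W m' \<Longrightarrow> val m' (Var rq) = int q \<and> val m' C0 = int 0 \<and> val m' C0 = int 0 \<and>
              val m' h = price_step I act y q"
            using that(1) r by (simp add: f')
          show "?P (m'(loc I ry q 0 0 := price_step I act y q)) e b"
            using inv r ag2 by (auto simp: Inv_def f' less_Suc_eq)
        qed (rule that(2))
        show "wp I W Z0 (If (Var racc) (Asg ry (Var rq) C0 C0 (Var racc)) (Asg ry (Var rq)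
            C0 C0 C0)) m' e ?P b"
        proof (rule wp_If)
          assume "ok I W m'" "0 < val m' (Var racc)"
          then have "price_step I act y q = ?z + (\<Sum>i<n. ?g i)"
              using acc by (simp add: price_step_def)
          then show "wp I W Z0 (Asg ry (Var rq) C0 C0 (Var racc)) m' e ?P b"
            using acc bnd1 by (intro store) simp_all
        next
          assume "ok I W m'" "\<not> 0 < val m' (Var racc)"
          then have "price_step I act y q = 0" using acc by (simp add: price_step_def)
          then show "wp I W Z0 (Asg ry (Var rq) C0 C0 C0) m' e ?P b"
            by (intro store) simp_all
        qed
      qed simp_all
    qed
  qed
qed

lemma wp_cLearn:
  assumes m: "\<And>r i j k. m (loc I r i j k) = 0"
    and fin: "\<And>m'. (\<And>k s u. k < KK I \<Longrightarrow> s < B \<Longrightarrow> u < N \<Longrightarrow> m' (loc I rpol k s u) = learned I k s u) \<Longrightarrow>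
      (\<And>k s u. s \<le> B \<Longrightarrow> u < N \<Longrightarrow> m' (loc I rnx k s u) = int (nx (pol I k) s u)) \<Longrightarrow> Q m' e b"
  shows "wp I W Z0 cLearn m e Q b"
  unfolding cLearn_def
proof (rule wp_Seq, rule wp_cDen)
  fix m1 assume ag1: "agree I {rD, rj} m m1" and D1: "m1 (reg I rD) = DD I"
  note f1 = agree_loc[OF ag1]
  have W1: "(1::int) < 2 ^ W" using nat_less_W[of 1] sizes by simp
  let ?loop = "For rk eKK (Seq cPass cPrices)"
  let ?G = "Set rG (Mul eHH (Mul (Rd rpw ehorizon C0 C0) (Rd rpw ehorizon C0 C0)))"
  let ?S = "SumLoop rZ ri earms (Rd rV ehorizon (eroot (Var ri)) C0)"
  show "wp I W Z0 (Seq cPowers (Seq (Set rG C1) (Seq cPass (Seq (Set rZ C0)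
      (Seq ?S (Seq ?G ?loop)))))) m1 e Q b"
  proof (rule wp_Seq, rule wp_cPowers)
    show "m1 (reg I rD) = DD I" by (rule D1)
  next
    fix m2 assume ag2: "agree I {rpw, rs} m1 m2" and pw2: "\<And>s. s \<le> B \<Longrightarrow> m2 (loc I rpw s 0 0) =
        DD I ^ s"
    note f2 = agree_loc[OF ag2]
    let ?m3 = "m2(reg I rG := 1)"
    have pass1: "wp I W Z0 cPass ?m3 e (\<lambda>m' e' x. wp I W Z0 (Seq (Set rZ C0)
        (Seq ?S (Seq ?G ?loop))) m' e' Q x) b"
    proof (rule wp_cPass[where G = 1 and Z = 0 and y = "\<lambda>_. 0" and k = 0,
        OF _ _ _ _ _ _ _ _ dp_params_first])
      show "zero_rows ?m3" by (simp add: zero_rows_def f2 f1 m)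
      show "B + B < 20 * (sz + 1)" using sizes(4) by simp
    next
      fix m4 assume ag4: "agree I pass_regs ?m3 m4" and zr4: "zero_rows m4"
        and V4: "\<And>u. u < N \<Longrightarrow> m4 (loc I rV B u 0) = Vh I 1 0 (\<lambda>_. 0) B u"
        and other4: "\<And>l i j. l \<noteq> 0 \<Longrightarrow> m4 (loc I rpol l i j) = ?m3 (loc I rpol l i j) \<and>
          m4 (loc I rnx l i j) = ?m3 (loc I rnx l i j)"
      note f4 = agree_loc[OF ag4]
      let ?m5 = "m4(reg I rZ := 0)" and ?g = "\<lambda>i. Vh I 1 0 (\<lambda>_. 0) B (root I i)"
      have "(\<Sum>i<n. \<bar>?g i\<bar>) \<le> E ^ Suc (B + B)" using Vh_bound[OF dp_params_first] by (intro
          sum_roots_bound) auto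
      then have bnd: "\<bar>0\<bar> + (\<Sum>i<n. \<bar>?g i\<bar>) < 2 ^ W"
        using sizes(4) by (intro E_power_less[of _ "Suc (B + B)"]) auto
      show "wp I W Z0 (Seq (Set rZ C0) (Seq ?S (Seq ?G ?loop))) m4 e Q b"
      proof (rule wp_Seq, rule wp_Set[where z = 0])
        show "wp I W Z0 (Seq ?S (Seq ?G ?loop)) ?m5 e Q b"
        proof (rule wp_Seq, rule wp_SumLoop[where n = n and z = 0 and g = ?g])
          show "n \<le> Z0" "int n < 2 ^ W" using le_Z0 nat_less_W sizes by auto
          show "\<bar>0\<bar> + (\<Sum>i<n. \<bar>?g i\<bar>) < 2 ^ W" by (rule bnd)
        next
          fix i m' assume i: "i < n" and ok: "ok I W m'" and ag': "agree I {rZ, ri} ?m5 m'"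
            and ri: "m' (reg I ri) = int i"
          show "val m' (Rd rV ehorizon (eroot (Var ri)) C0) = ?g i"
            using val_root[OF ok _ i, of "Var ri"] ok ri V4[OF roots(1)[OF i]]
            by (simp add: val_Rd_nat agree_loc[OF ag'])
        next
          fix m6 assume ag6: "agree I {rZ, ri} ?m5 m6" and "m6 (reg I rZ) = 0 + (\<Sum>i<n. ?g i)"
          then have Z6: "m6 (reg I rZ) = ZZ I" by (simp add: ZZ_def)
          note f6 = agree_loc[OF ag6]
          let ?m7 = "m6(reg I rG := GG I)"
          let ?y = "prices I (GG I) (ZZ I)"
          define Inv where "Inv k m' \<longleftrightarrow> m' (reg I rD) = DD I \<and> (\<forall>s\<le>B. m' (loc I rpw s 0 0) =
              DD I ^ s) \<and>
              m' (reg I rG) = GG I \<and> m' (reg I rZ) = ZZ I \<and> (\<forall>q<B. m' (loc I ry q 0 0) = ?y k q) \<and>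
                  zero_rows m' \<and>
              (\<forall>l<k. \<forall>s<B. \<forall>u<N. m' (loc I rpol l s u) = learned I l s u) \<and>
              (\<forall>l<k. \<forall>s\<le>B. \<forall>u<N. m' (loc I rnx l s u) = int (nx (learned I l) s u)) \<and>
              (\<forall>l\<ge>max 1 k. \<forall>s u. m' (loc I rnx l s u) = 0)" for k m'
          have loop: "wp I W Z0 ?loop ?m7 e Q b"
          proof (rule wp_For_det[where n = "KK I" and Inv = Inv])
            show "KK I \<le> Z0" using KK_le by (simp add: Zb_def)
            show "int (KK I) < 2 ^ W" using KK_le_E(2) by linarith
            show "Inv 0 (?m7(reg I rk := 0))"
              using D1 pw2 Z6 zr4 other4 by (simp add: Inv_def f6 f4 f2 f1 m zero_rows_def)
            show "val m' eKK = int (KK I)" if "ok I W m'" for m' by (rule val_eKK[OF that])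
          next
            fix m' assume inv: "Inv (KK I) m'"
            show "Q m' e b"
            proof (rule fin)
              show "m' (loc I rpol k s u) = learned I k s u" if "k < KK I" "s < B" "u < N" for k s u
                using inv that by (simp add: Inv_def)
              show "m' (loc I rnx k s u) = int (nx (pol I k) s u)" if "s \<le> B" "u < N" for k s u
              proof (cases "k < KK I")
                case True
                then show ?thesis using inv that by (simp add: Inv_def pol_def)
              next
                case False
                then have "m' (loc I rnx k s u) = 0" using inv KK_pos by (simp add: Inv_def)
                moreover have "nx (pol I k) s u = 0" using False by (induction s)
                    (simp_all add: pol_def)
                ultimately show ?thesis by simp
              qed
            qed
          next
            fix k m8 assume k: "k < KK I" and inv: "Inv k m8" and rk8: "m8 (reg I rk) = int k"
            let ?P = "\<lambda>m' e' x'. e' = e \<and> x' = b \<and> m' (reg I rk) = int k \<and> Inv (Suc k)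
                (m'(reg I rk := int (Suc k)))"
            show "wp I W Z0 (Seq cPass cPrices) m8 e ?P b"
            proof (rule wp_Seq, rule wp_cPass[where G = "GG I" and Z = "ZZ I" and y = "?y k"
                and k = k,
                  OF _ _ _ _ _ _ _ _ dp_params_learned])
              show "m8 (reg I rD) = DD I" "m8 (reg I rG) = GG I" "m8 (reg I rZ) = ZZ I"
                  "zero_rows m8"
                "\<And>s. s \<le> B \<Longrightarrow> m8 (loc I rpw s 0 0) = DD I ^ s" "\<And>s. s < B \<Longrightarrow> m8 (loc I ry s 0 0) =
                    ?y k s"
                using inv by (simp_all add: Inv_def)
              show "m8 (reg I rk) = int k" by (rule rk8)
              show "0 < GG I" by (rule GG_bound)
              show "k \<le> KK I" using k by simp
              show "12 + 5 * B + B < 20 * (sz + 1)" using sizes(4) by simp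
            next
              fix m9 assume ag9: "agree I pass_regs m8 m9" and zr9: "zero_rows m9"
                and Q9: "\<And>q u. q < B \<Longrightarrow> u < N \<Longrightarrow> m9 (loc I rQ q B u) = Qh I (best_act I (GG I)
                    (ZZ I) (?y k)) q B u"
                and pol9: "\<And>s u. s < B \<Longrightarrow> u < N \<Longrightarrow> m9 (loc I rpol k s u) = best_act I (GG I) (ZZ I)
                    (?y k) s u"
                and nx9: "\<And>s u. s \<le> B \<Longrightarrow> u < N \<Longrightarrow> m9 (loc I rnx k s u) = int (nx (best_act I (GG I)
                    (ZZ I) (?y k)) s u)"
                and other9: "\<And>l i j. l \<noteq> k \<Longrightarrow> m9 (loc I rpol l i j) = m8 (loc I rpol l i j) \<and>
                  m9 (loc I rnx l i j) = m8 (loc I rnx l i j)"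
              note f9 = agree_loc[OF ag9]
              show "wp I W Z0 cPrices m9 e ?P b"
              proof (rule wp_cPrices[where y = "?y k" and act = "learned I k"])
                show "m9 (loc I rpw s 0 0) = DD I ^ s" if "s \<le> B" for s
                  using inv that by (simp add: f9 Inv_def)
                show "m9 (loc I ry q 0 0) = ?y k q" if "q < B" for q
                  using inv that by (simp add: f9 Inv_def)
                show "m9 (loc I rQ q B u) = Qh I (learned I k) q B u" if "q < B" "u < N" for q u
                  using Q9[OF that] by (simp add: learned_def)
                show "policy I (learned I k)" by (rule policy_learned)
                show "0 \<le> ?y k q \<and> ?y k q \<le> E ^ (10 + 2 * B)" for q
                  using prices_nonneg prices_bound[OF GG_bound(1)] k by simp
              next
                fix m' assume ag': "agree I {rq, racc, ri, ry} m9 m'"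
                  and y': "\<And>q. q < B \<Longrightarrow> m' (loc I ry q 0 0) = price_step I (learned I k) (?y k) q"
                note f' = agree_loc[OF ag']
                have "Inv (Suc k) (m'(reg I rk := int (Suc k)))"
                  using inv zr9 y' pol9 nx9 other9 unfolding Inv_def zero_rows_def
                  by (auto simp: f' f9 less_Suc_eq learned_def)
                then show "?P m' e b" using rk8 by (simp add: f' f9)
              qed
            qed
          qed
          have G: "\<bar>GG I\<bar> < 2 ^ W" by (rule E_power_less[OF GG_bound(2)]) (use sizes(4) in simp)
          show "wp I W Z0 (Seq ?G ?loop) m6 e Q b"
          proof (rule wp_Seq, rule wp_Set[where z = "GG I"])
            show "ok I W m6 \<Longrightarrow> val m6 (Mul eHH (Mul (Rd rpw ehorizon C0 C0)
                (Rd rpw ehorizon C0 C0))) = GG I"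
              using pw2[of B] by (simp add: val_Rd_nat val_eHH f6 f4 GG_def)
          qed (use G loop in auto)
        qed simp_all
      qed (use W1 in simp_all)
    qed (use D1 pw2 in \<open>simp_all add: f2 f1 m\<close>)
    show "wp I W Z0 (Seq (Set rG C1) (Seq cPass (Seq (Set rZ C0) (Seq ?S (Seq ?G ?loop)))))
        m2 e Q b"
      by (rule wp_Seq, rule wp_Set[where z = 1], simp, use W1 in simp, rule wp_Seq, rule pass1)
  qed
qed

end

section \<open>The program: pulling the arms\<close>

abbreviation (input) "rz \<equiv> 24 :: nat"
abbreviation (input) "rcnt \<equiv> 25 :: nat"
abbreviation (input) "rsp \<equiv> 26 :: nat"
abbreviation (input) "rcur \<equiv> 27 :: nat"
abbreviation (input) "rpr \<equiv> 28 :: nat"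
abbreviation (input) "rsel \<equiv> 29 :: nat"
abbreviation (input) "rbp \<equiv> 30 :: nat"
abbreviation (input) "rnew \<equiv> 31 :: nat"

abbreviation "Rd1 r i \<equiv> Rd r i C0 C0"
abbreviation "Asg1 r i f \<equiv> Asg r i C0 C0 f"

definition "cStart = Seq (Asg1 rcnt (Var ri) C0)
  (Seq (Asg1 rsp (Var ri) (Rd rnx (Rd1 rz (Var ri)) ehorizon (eroot (Var ri))))
  (Seq (Asg1 rcur (Var ri) (eroot (Var ri)))
    (Asg1 rpr (Var ri) (Sub (Add ehorizon C1) (Rd1 rsp (Var ri))))))"

text \<open>A single draw decides both whether the arm takes part and which policy of the mixture it
  follows.\<close>

definition "cInit = For ri earms
  (Seq (Random (Cell rz (Var ri) C0 C0) (Mul (Const 6) eKK))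
  cStart)"

definition "cCompare = If (Sub (Var rbp) (Rd1 rpr (Var ri)))
    (Seq (Set rbp (Rd1 rpr (Var ri))) (Set rsel (Var ri))) Skip"

definition "cSelect = Seq (Set rbp (Add ehorizon C1)) (Seq (Set rsel C0)
  (For ri earms cCompare))"

text \<open>A case distinction as arithmetic with the 0/1 bridge flag; on a bridge node the table
  lookup, which may then be meaningless, is multiplied by 0.\<close>

definition "eAction = Add (Mul (ebridge (Rd1 rcur (Var rsel))) edefault)
  (Mul (Sub C1 (ebridge (Rd1 rcur (Var rsel))))
    (Rd rpol (Rd1 rz (Var rsel)) (Sub (Rd1 rsp (Var rsel)) C1) (Rd1 rcur (Var rsel))))"

text \<open>The factor \<open>rsp\<close> vanishes if no pull is left, so that the priority
  \<open>horizon I + 1\<close> of a finished arm is kept.\<close>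

definition "cInherit = If (ebridge (Var rnew)) (Asg1 rpr (Var rsel) C0)
      (If (Mul (Rd1 rsp (Var rsel)) (Sub (Mul (Const 2) (Rd1 rcnt (Var rsel)))
          (Sub (Add ehorizon C1) (Rd1 rsp (Var rsel)))))
        (Asg1 rpr (Var rsel) C0) Skip)"

definition "cMove = Seq (Asg1 rcur (Var rsel) (Var rnew))
  (Seq (Asg1 rsp (Var rsel) (Rd rnx (Rd1 rz (Var rsel)) (Rd1 rsp (Var rsel)) (Var rnew)))
  (Seq (Asg1 rpr (Var rsel) (Sub (Add ehorizon C1) (Rd1 rsp (Var rsel))))
    cInherit))"

text \<open>The test reproduces the truncated subtraction in \<open>move\<close>: with no slot left
  the entry stays 0.\<close>

definition "cUpdate = Seq (Asg1 rcnt (Var rsel) (Add (Rd1 rcnt (Var rsel)) C1))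
  (Seq (If (Rd1 rsp (Var rsel)) (Asg1 rsp (Var rsel) (Sub (Rd1 rsp (Var rsel)) C1)) Skip)
  cMove)"

definition "cStep = Seq cSelect (If (Sub (Add ehorizon C1) (Var rbp))
  (Seq (Pull (Var rsel) eAction (Cell rnew C0 C0 C0)) cUpdate) Idle)"

definition "algorithm = Seq cLearn (Seq cInit (For rt ehorizon cStep))"

section \<open>Correctness of the pulling phase\<close>

lemma Pot_cong:
  assumes "\<And>i. i < arms I \<Longrightarrow> g i = g' i" "\<And>i. i < arms I \<Longrightarrow> w i = w' i"
  shows "Pot I g w = Pot I g' w'"
  unfolding Pot_def using assms by (intro sum.cong arg_cong2[of _ _ _ _ "(*)"] arg_cong2[of _ _ _
      _ "(-)"]) auto

context superprocess_instance
begin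

definition tables :: "(nat \<Rightarrow> int) \<Rightarrow> bool" where
  "tables m \<longleftrightarrow> (\<forall>k s u. k < KK I \<longrightarrow> s < B \<longrightarrow> u < N \<longrightarrow> m (loc I rpol k s u) = learned I k s u) \<and>
     (\<forall>k s u. s \<le> B \<longrightarrow> u < N \<longrightarrow> m (loc I rnx k s u) = int (nx (pol I k) s u))"

text \<open>\<open>arem\<close>, \<open>akey\<close> and \<open>apast\<close> have no cells:
  priorities suffice to select the next arm, and these fields serve the analysis.\<close>

definition arm_mem :: "(nat \<Rightarrow> int) \<Rightarrow> nat \<Rightarrow> arm \<Rightarrow> bool" where
  "arm_mem m i a \<longleftrightarrow> m (loc I rz i 0 0) = int (apol a) \<and> m (loc I rcnt i 0 0) = int (acount a) \<and>
     m (loc I rsp i 0 0) = int (next_slot I a) \<and> m (loc I rcur i 0 0) = int (anode a) \<and>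
     m (loc I rpr i 0 0) = int (prio I a)"

lemma tables_upd [simp]: "r \<noteq> rpol \<Longrightarrow> r \<noteq> rnx \<Longrightarrow> tables (m(loc I r i j k := z)) = tables m"
  by (simp add: tables_def)

lemma tables_agree: "tables m \<Longrightarrow> agree I R m m' \<Longrightarrow> rpol \<notin> R \<Longrightarrow> rnx \<notin> R \<Longrightarrow> tables m'"
  by (simp add: tables_def agree_loc[of I R m m'])

lemma arm_mem_upd [simp]:
  "r \<notin> {rz, rcnt, rsp, rcur, rpr} \<or> i \<noteq> j \<Longrightarrow> arm_mem (m(loc I r j k l := z)) i a = arm_mem m i a"
  by (auto simp: arm_mem_def)

lemma arm_mem_agree:
  "arm_mem m i a \<Longrightarrow> agree I R m m' \<Longrightarrow> R \<inter> {rz, rcnt, rsp, rcur, rpr} = {} \<Longrightarrow> arm_mem m' i a"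
proof -
  assume a: "arm_mem m i a" and ag: "agree I R m m'" and "R \<inter> {rz, rcnt, rsp, rcur, rpr} = {}"
  then have "rz \<notin> R" "rcnt \<notin> R" "rsp \<notin> R" "rcur \<notin> R" "rpr \<notin> R" by auto
  with a show ?thesis by (simp add: arm_mem_def agree_loc[OF ag])
qed

lemma small: "k \<le> B + 1 \<Longrightarrow> int k < 2 ^ W"
  using nat_less_W[of N] horizon_less_nodes sizes(1) by simp

lemma prio_le: "arm_ok a \<Longrightarrow> prio I a \<le> B + 1"
  by (auto simp: prio_def)

lemma wp_cInit:
  assumes m: "tables m"
    and fin: "\<And>m' x \<sigma>. tables m' \<Longrightarrow> (\<And>i. i < n \<Longrightarrow> \<exists>z. \<sigma> i = start I i z) \<Longrightarrow>
      (\<And>i. i < n \<Longrightarrow> arm_mem m' i (\<sigma> i)) \<Longrightarrow> x \<le> Phi \<sigma> \<Longrightarrow> Q m' e x"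
  shows "wp I W Z0 cInit m e Q (Pot I avg_gam (\<lambda>i. if i < n then avg_omg i else (\<lambda>k. 0)))"
proof -
  \<comment> \<open>The arms draw one after another. Those from \<open>j\<close> on still enter the
    potential with their averages, and a draw replaces the averages of one arm by actual data,
    keeping the potential in expectation.\<close>
  define g where "g zs j i = (if i < j then gam I (start I i (zs i)) else avg_gam i)"
    for zs :: "nat \<Rightarrow> nat" and j i
  define w where "w zs j i = (if i < n then if i < j then omg I (start I i (zs i))
      else avg_omg i else (\<lambda>k. 0))"
    for zs :: "nat \<Rightarrow> nat" and j i
  define Inv where "Inv j m' e' x \<longleftrightarrow> e' = e \<and> tables m' \<and>
    (\<exists>zs. (\<forall>i<j. arm_mem m' i (start I i (zs i))) \<and> x \<le> Pot I (g zs j) (w zs j))" for j m' e' x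
  show ?thesis unfolding cInit_def
  proof (rule wp_For[where n = n and Inv = Inv])
    show "n \<le> Z0" "int n < 2 ^ W" using le_Z0 nat_less_W sizes by auto
    show "Inv 0 (m(reg I ri := 0)) e (Pot I avg_gam (\<lambda>i. if i < n then avg_omg i else (\<lambda>k. 0)))"
      unfolding Inv_def
      by (intro conjI exI[of _ "\<lambda>_. 0"]) (use m in \<open>simp_all add: g_def[abs_def] w_def[abs_def]
          cong: if_cong\<close>)
    show "val m' earms = int n" if "ok I W m'" for m' using that by simp
  next
    fix m' e' x assume "Inv n m' e' x"
    then obtain zs where zs: "e' = e" "tables m'" "\<And>i. i < n \<Longrightarrow> arm_mem m' i (start I i (zs i))"
      "x \<le> Pot I (g zs n) (w zs n)" by (auto simp: Inv_def)
    have "Pot I (g zs n) (w zs n) = Phi (\<lambda>i. start I i (zs i))"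
      unfolding Phi_def by (rule Pot_cong) (simp_all add: g_def w_def)
    then show "Q m' e' x"
      using zs fin[of m' "\<lambda>i. start I i (zs i)" x] by auto
  next
    fix j m1 e1 x assume j: "j < n" and inv: "Inv j m1 e1 x" and r: "m1 (reg I ri) = int j"
    then obtain zs where zs: "e1 = e" "tables m1" "\<And>i. i < j \<Longrightarrow> arm_mem m1 i (start I i (zs i))"
      "x \<le> Pot I (g zs j) (w zs j)" by (auto simp: Inv_def)
    let ?P = "\<lambda>m' e' x'. m' (reg I ri) = int j \<and> Inv (Suc j) (m'(reg I ri := int (Suc j))) e' x'"
    let ?zs = "\<lambda>z. zs(j := z)"
    let ?X = "\<lambda>z. Pot I (g (?zs z) (Suc j)) (w (?zs z) (Suc j))"
    have K: "0 < 6 * KK I" using KK_pos by simp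
    have avg: "x \<le> (\<Sum>z<6 * KK I. ?X z) / real (6 * KK I)"
    proof -
      have "Pot I (g zs j) (w zs j) = (\<Sum>z<6 * KK I. 1 / real (6 * KK I) *
          Pot I ((g zs j)(j := gam I (start I j z))) ((w zs j)(j := omg I (start I j z))))"
        using j KK_pos
        by (intro Pot_average[OF j])
          (simp_all add: g_def w_def avg_gam_def avg_omg_def flip: sum_divide_distrib)
      also have "\<dots> = (\<Sum>z<6 * KK I. 1 / real (6 * KK I) * ?X z)"
        by (intro sum.cong refl arg_cong2[of _ _ _ _ "(*)"] Pot_cong)
          (use j in \<open>auto simp: g_def w_def\<close>)
      also have "\<dots> = (\<Sum>z<6 * KK I. ?X z) / real (6 * KK I)"
        by (simp add: sum_divide_distrib)
      finally show ?thesis using zs(4) by simp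
    qed
    have body: "wp I W Z0 cStart (m1(loc I rz j 0 0 := int z)) e ?P (?X z)" if z: "z < 6 * KK I"
        for z
    proof -
      let ?a = "start I j z"
      let ?m2 = "m1(loc I rz j 0 0 := int z, loc I rcnt j 0 0 := 0)"
      let ?m3 = "?m2(loc I rsp j 0 0 := int (next_slot I ?a))"
      let ?m4 = "?m3(loc I rcur j 0 0 := int (root I j))"
      have sp: "next_slot I ?a \<le> B" using nx_le by (simp add: next_slot_def start_def)
      have rt: "root I j < N" using roots(1)[OF j] .
      have pr: "int (prio I ?a) = int B + 1 - int (next_slot I ?a)"
        using sp roots(3)[OF j] by (auto simp: prio_def start_def)
      have last: "?P (?m4(loc I rpr j 0 0 := int (prio I ?a))) e (?X z)"
      proof -
        have "arm_mem (?m4(loc I rpr j 0 0 := int (prio I ?a))) i (start I i (?zs z i))"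
            if "i < Suc j" for i
        proof (cases "i = j")
          case True
          then show ?thesis by (simp add: arm_mem_def) (simp add: start_def)
        next
          case False
          then show ?thesis using zs(3)[of i] that by simp
        qed
        then show ?thesis using zs(1,2) r by (auto simp: Inv_def intro!: exI[of _ "?zs z"])
      qed
      have root: "ok I W m' \<Longrightarrow> m' (reg I ri) = int j \<Longrightarrow> val m' (eroot (Var ri)) = int (root I j)"
          for m'
        by (rule val_root[OF _ _ j]) auto
      show ?thesis unfolding cStart_def
      proof (rule wp_Seq, rule wp_Asg[where i' = j and j' = 0 and k' = 0 and z = 0], goal_cases)
        case 3
        show ?case
        proof (rule wp_Seq, rule wp_Asg[where i' = j and j' = 0 and k' = 0 and z =
            "int (next_slot I ?a)"], goal_cases)
          case 1
          have "m1 (loc I rnx z B (root I j)) = int (nx (pol I z) B (root I j))"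
            using zs(2) rt by (simp add: tables_def)
          moreover have z': "val ?m2 (Rd1 rz (Var ri)) = int z"
            using val_Rd[OF 1, of "Var ri" j C0 0 C0 0 rz] 1 r by simp
          moreover have "val ?m2 (eroot (Var ri)) = int (root I j)" by (rule root[OF 1])
              (simp add: r)
          from val_Rd[OF 1 z' val_sizes(4)[OF 1] this, of rnx]
          have "val ?m2 (Rd rnx (Rd1 rz (Var ri)) ehorizon (eroot (Var ri))) =
              m1 (loc I rnx z B (root I j))"
            by simp
          ultimately show ?case using 1 r by (simp add: next_slot_def start_def)
        next
          case 3
          show ?case
          proof (rule wp_Seq, rule wp_Asg[where i' = j and j' = 0 and k' = 0 and z =
              "int (root I j)"], goal_cases)
            case 1
            then show ?case using r root[OF 1] by simp
          next
            case 3
            show ?case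
            proof (rule wp_Asg[where i' = j and j' = 0 and k' = 0 and z = "int (prio I ?a)"],
                goal_cases)
              case 3
              show ?case by (rule last)
            next
              case 2
              show ?case using small[OF prio_le[OF start_ok[OF j]], of z] by simp
            qed (use r pr in \<open>simp add: val_Rd_nat\<close>)
          qed (use nat_less_W[of "root I j"] rt sizes in simp)
        qed (use small sp in simp)
      qed (use r in simp_all)
    qed
    show "wp I W Z0 (Seq (Random (Cell rz (Var ri) C0 C0) (Mul (Const 6) eKK)) cStart) m1 e1 ?P x"
    proof (rule wp_Seq, rule wp_ok)
      assume ok: "ok I W m1"
      have addr: "val m1 (Cell rz (Var ri) C0 C0) = int (loc I rz j 0 0)"
        by (rule val_Cell[OF ok]) (use ok r in simp_all)
      show "wp I W Z0 (Random (Cell rz (Var ri) C0 C0) (Mul (Const 6) eKK)) m1 e1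
          (\<lambda>m' e' x. wp I W Z0 cStart m' e' ?P x) x"
      proof (rule wp_Random[where N = "6 * KK I" and X = ?X])
        show "int (6 * KK I) < 2 ^ W" using KK_le_E(2) by simp
      qed (use ok addr K avg body zs(1) in \<open>simp_all add: val_eKK\<close>)
    qed
  qed
qed

text \<open>Ties memory and environment to an abstract run. The last clause is the submartingale
  bound carried by the labels.\<close>

definition Rel :: "(nat \<Rightarrow> arm) \<Rightarrow> (nat \<Rightarrow> int) \<Rightarrow> env \<Rightarrow> real \<Rightarrow> bool" where
  "Rel \<sigma> m e x \<longleftrightarrow> tables m \<and> (\<forall>i<n. arm_mem m i (\<sigma> i) \<and> fst (snd e) i = anode (\<sigma> i)) \<and>
     run_ok \<sigma> (fst e) \<and> 0 \<le> snd (snd e) \<and> x \<le> snd (snd e) + Phi \<sigma>"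

lemma wp_cSelect:
  assumes mem: "\<And>i. i < n \<Longrightarrow> arm_mem m i (\<sigma> i)" and ok: "\<And>i. i < n \<Longrightarrow> arm_ok (\<sigma> i)"
    and fin: "\<And>m' b' s. agree I {rbp, rsel, ri} m m' \<Longrightarrow> m' (reg I rbp) = int b' \<Longrightarrow> m' (reg I rsel) =
        int s \<Longrightarrow>
      (\<And>l. l < n \<Longrightarrow> b' \<le> prio I (\<sigma> l)) \<Longrightarrow> (b' \<le> B \<Longrightarrow> s < n \<and> b' = prio I (\<sigma> s)) \<Longrightarrow> Q m' e b"
  shows "wp I W Z0 cSelect m e Q b"
proof -
  let ?R = "{rbp, rsel, ri}"
  define Inv where "Inv j m' \<longleftrightarrow> agree I ?R m m' \<and> (\<exists>b' s. m' (reg I rbp) = int b' \<and> m' (reg I rsel)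
      = int s \<and>
    (\<forall>l<j. b' \<le> prio I (\<sigma> l)) \<and> (b' \<le> B \<longrightarrow> s < n \<and> b' = prio I (\<sigma> s)))" for j m'
  show ?thesis unfolding cSelect_def
  proof (rule wp_Seq, rule wp_Set[where z = "int (B + 1)"])
    show "wp I W Z0 (Seq (Set rsel C0)
      (For ri earms cCompare)) (m(reg I rbp := int (B + 1))) e Q b"
    proof (rule wp_Seq, rule wp_Set[where z = 0])
      show "wp I W Z0 (For ri earms cCompare) (m(reg I rbp := int (B + 1), reg I rsel := 0)) e Q b"
      proof (rule wp_For_det[where n = n and Inv = Inv])
        show "n \<le> Z0" "int n < 2 ^ W" using le_Z0 nat_less_W sizes by auto
        show "Inv 0 (m(reg I rbp := int (B + 1), reg I rsel := 0, reg I ri := 0))"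
          unfolding Inv_def by (rule conjI, simp, rule exI[of _ "B + 1"], rule exI[of _ 0], simp)
        show "val m' earms = int n" if "ok I W m'" for m' using that by simp
        show "Q m' e b" if "Inv n m'" for m'
          using that fin unfolding Inv_def by blast
      next
        fix j m1 assume j: "j < n" and inv: "Inv j m1" and r: "m1 (reg I ri) = int j"
        then obtain b' s where ag: "agree I ?R m m1" and bs: "m1 (reg I rbp) = int b'"
            "m1 (reg I rsel) = int s"
          "\<And>l. l < j \<Longrightarrow> b' \<le> prio I (\<sigma> l)" "b' \<le> B \<Longrightarrow> s < n \<and> b' = prio I (\<sigma> s)"
          unfolding Inv_def by blast
        have pr: "m1 (loc I rpr j 0 0) = int (prio I (\<sigma> j))"
          using mem[OF j] by (simp add: agree_loc[OF ag] arm_mem_def)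
        let ?P = "\<lambda>m' e' x'. e' = e \<and> x' = b \<and> m' (reg I ri) = int j \<and> Inv (Suc j)
            (m'(reg I ri := int (Suc j)))"
        show "wp I W Z0 cCompare m1 e ?P b" unfolding cCompare_def
        proof (rule wp_If)
          assume "ok I W m1" "0 < val m1 (Sub (Var rbp) (Rd1 rpr (Var ri)))"
          then have less: "prio I (\<sigma> j) < b'" using r bs pr by (simp add: val_Rd_nat)
          let ?m' = "m1(reg I rbp := int (prio I (\<sigma> j)), reg I rsel := int j)"
          have lower: "prio I (\<sigma> j) \<le> prio I (\<sigma> l)" if "l < Suc j" for l
            using bs(3)[of l] less that by (cases "l = j") auto
          have "Inv (Suc j) (?m'(reg I ri := int (Suc j)))"
            unfolding Inv_def
            by (intro conjI, simp add: ag, rule exI[of _ "prio I (\<sigma> j)"], rule exI[of _ j])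
                (simp add: j lower)
          then have P: "?P ?m' e b" using r by simp
          show "wp I W Z0 (Seq (Set rbp (Rd1 rpr (Var ri))) (Set rsel (Var ri))) m1 e ?P b"
          proof (rule wp_Seq, rule wp_Set[where z = "int (prio I (\<sigma> j))"])
            show "wp I W Z0 (Set rsel (Var ri)) (m1(reg I rbp := int (prio I (\<sigma> j)))) e ?P b"
              by (rule wp_Set[where z = "int j"]) (use P r j nat_less_W[of j] sizes in simp_all)
          qed (use r pr small[OF prio_le[OF ok[OF j]]] in \<open>simp_all add: val_Rd_nat\<close>)
        next
          assume "ok I W m1" "\<not> 0 < val m1 (Sub (Var rbp) (Rd1 rpr (Var ri)))"
          then have "b' \<le> prio I (\<sigma> j)" using r bs pr by (simp add: val_Rd_nat)
          then have lower: "b' \<le> prio I (\<sigma> l)" if "l < Suc j" for l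
            using bs(3)[of l] that by (cases "l = j") auto
          have "Inv (Suc j) (m1(reg I ri := int (Suc j)))"
            unfolding Inv_def
            by (intro conjI, simp add: ag, rule exI[of _ b'], rule exI[of _ s])
                (use bs lower in simp)
          then show "wp I W Z0 Skip m1 e ?P b" using r by (intro wp_Skip) simp
        qed
      qed
    qed simp_all
  qed (use small[of "B + 1"] in simp_all)
qed

lemma val_new_prio:
  assumes "ok I W m" "m (reg I rsel) = int i" "m (loc I rsp i 0 0) = int s" "s \<le> B + 1"
  shows "val m (Sub (Add ehorizon C1) (Rd1 rsp (Var rsel))) = int (B + 1 - s)"
  using assms by (simp add: val_Rd_nat of_nat_diff)

lemma wp_cUpdate:
  assumes m: "tables m" "arm_mem m i a" "m (reg I rsel) = int i" "m (reg I rnew) = int v"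
    and v: "v < N" and a: "arm_ok a" "acount a < B"
    and fin: "\<And>m'. agree I {rcnt, rsp, rcur, rpr} m m' \<Longrightarrow> (\<And>j x. j \<noteq> i \<Longrightarrow> arm_mem m j x \<Longrightarrow>
        arm_mem m' j x) \<Longrightarrow>
      arm_mem m' i (move I a v) \<Longrightarrow> Q m' e b"
  shows "wp I W Z0 cUpdate m e Q b"
proof -
  let ?b = "move I a v"
  let ?sp = "next_slot I a - 1"
  have mm: "m (loc I rz i 0 0) = int (apol a)" "m (loc I rcnt i 0 0) = int (acount a)"
     "m (loc I rsp i 0 0) = int (next_slot I a)" using m(2) by (auto simp: arm_mem_def)
  have sp: "next_slot I a \<le> B"
    using nx_le[of "pol I (apol a)" "arem a" "anode a"] a(1) by (simp add: next_slot_def arm_ok_def)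
  have spb: "next_slot I ?b \<le> ?sp" using nx_le by (simp add: next_slot_def move_def)
  have nxt: "m (loc I rnx (apol a) ?sp v) = int (next_slot I ?b)"
    using m(1) v sp by (simp add: tables_def next_slot_def move_def)
  let ?m1 = "m(loc I rcnt i 0 0 := int (Suc (acount a)))"
  let ?m2 = "?m1(loc I rsp i 0 0 := int ?sp)"
  let ?m3 = "?m2(loc I rcur i 0 0 := int v)"
  let ?m4 = "?m3(loc I rsp i 0 0 := int (next_slot I ?b))"
  let ?p = "B + 1 - next_slot I ?b"
  let ?m5 = "?m4(loc I rpr i 0 0 := int ?p)"
  have final: "Q m' e b" if "m' = ?m5(loc I rpr i 0 0 := int (prio I ?b))" for m'
  proof (rule fin)
    show "agree I {rcnt, rsp, rcur, rpr} m m'" unfolding that by simp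
    show "arm_mem m' j x" if "j \<noteq> i" "arm_mem m j x" for j x unfolding \<open>m' = _\<close> using that by simp
    show "arm_mem m' i ?b" unfolding that by (simp add: arm_mem_def mm m) (simp add: move_def)
  qed
  have br: "bridge I (anode ?b) = bridge I v" and cnt: "acount ?b = Suc (acount a)"
      by (simp_all add: move_def)
  have z: "wp I W Z0 (Asg1 rpr (Var rsel) C0) ?m5 e Q b" if "prio I ?b = 0"
  proof (rule wp_Asg[where i' = i and j' = 0 and k' = 0 and z = 0])
    show "Q (?m5(loc I rpr i 0 0 := 0)) e b" by (rule final) (simp add: that)
  qed (use m(3) in simp_all)
  define M where "M = ?m5"
  have Mf: "M (reg I rsel) = int i" "M (reg I rnew) = int v" "M (loc I rsp i 0 0) =
      int (next_slot I ?b)"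
    "M (loc I rcnt i 0 0) = int (Suc (acount a))"
    using m by (simp_all add: M_def)
  have prio_part: "wp I W Z0 cInherit M e Q b" unfolding cInherit_def
  proof (rule wp_If)
    assume ok: "ok I W M" and "0 < val M (ebridge (Var rnew))"
    then have "bridge I v" using val_bridge[OF ok, of "Var rnew" v] v Mf by (auto split: if_splits)
    then show "wp I W Z0 (Asg1 rpr (Var rsel) C0) M e Q b" unfolding M_def by (intro z)
        (simp add: prio_def br)
  next
    assume ok: "ok I W M" and "\<not> 0 < val M (ebridge (Var rnew))"
    then have nb: "\<not> bridge I v" using val_bridge[OF ok, of "Var rnew" v] v Mf by auto
    let ?t = "Mul (Rd1 rsp (Var rsel)) (Sub (Mul (Const 2) (Rd1 rcnt (Var rsel)))
          (Sub (Add ehorizon C1) (Rd1 rsp (Var rsel))))"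
    have t: "val M ?t = int (next_slot I ?b) * (2 * int (Suc (acount a))
        - (int B + 1 - int (next_slot I ?b)))"
      using ok Mf by (simp add: val_Rd_nat)
    have test: "0 < val M ?t \<longleftrightarrow> 0 < next_slot I ?b \<and> ?p < 2 * Suc (acount a)"
      unfolding t using spb sp by (auto simp: zero_less_mult_iff)
    show "wp I W Z0 (If ?t (Asg1 rpr (Var rsel) C0) Skip) M e Q b"
    proof (rule wp_If)
      assume "0 < val M ?t"
      then have "prio I ?b = 0" unfolding test by (simp add: prio_def br cnt)
      then show "wp I W Z0 (Asg1 rpr (Var rsel) C0) M e Q b" unfolding M_def by (rule z)
    next
      assume "\<not> 0 < val M ?t"
      then have "prio I ?b = ?p" unfolding test using nb by (auto simp: prio_def br cnt)
      then have "M = M(loc I rpr i 0 0 := int (prio I ?b))" by (simp add: M_def)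
      then show "wp I W Z0 Skip M e Q b" by (intro wp_Skip final) (simp only: M_def)
    qed
  qed
  show ?thesis unfolding cUpdate_def
  proof (rule wp_Seq, rule wp_Asg[where i' = i and j' = 0 and k' = 0 and z =
      "int (Suc (acount a))"], goal_cases)
    case 3
    have rest: "wp I W Z0 cMove ?m2 e Q b" unfolding cMove_def
    proof (rule wp_Seq, rule wp_Asg[where i' = i and j' = 0 and k' = 0 and z = "int v"], goal_cases)
      case 3
      show ?case
      proof (rule wp_Seq, rule wp_Asg[where i' = i and j' = 0 and k' = 0 and z =
          "int (next_slot I ?b)"], goal_cases)
        case 1
        then show ?case using m mm nxt by (simp add: val_Rd_nat)
      next
        case 3
        show ?case
        proof (rule wp_Seq, rule wp_Asg[where i' = i and j' = 0 and k' = 0 and z = "int ?p"],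
            goal_cases)
          case 1
          then show ?case
            using val_new_prio[OF 1, of i "next_slot I ?b"] val_Var[OF 1, of rsel] m(3)
                spb sp by simp
        next
          case 2
          show ?case using small[of ?p] by simp
        next
          case 3
          show ?case using prio_part unfolding M_def .
        qed
      qed (use spb sp small[of "next_slot I ?b"] in simp)
    qed (use m v nat_less_W[of v] sizes in simp_all)
    show ?case
    proof (rule wp_Seq, rule wp_If)
      assume "ok I W ?m1" "0 < val ?m1 (Rd1 rsp (Var rsel))"
      then have "0 < next_slot I a" using m mm by (simp add: val_Rd_nat)
      then show "wp I W Z0 (Asg1 rsp (Var rsel) (Sub (Rd1 rsp (Var rsel)) C1))
          ?m1 e (\<lambda>m' e' x. wp I W Z0 cMove m' e' Q x) b"
        using m mm rest sp small[of ?sp]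
        by (intro wp_Asg[where i' = i and j' = 0 and k' = 0 and z = "int ?sp"])
            (simp_all add: val_Rd_nat of_nat_diff)
    next
      assume "ok I W ?m1" "\<not> 0 < val ?m1 (Rd1 rsp (Var rsel))"
      then have "next_slot I a = 0" using m mm by (simp add: val_Rd_nat)
      then have "?m1 = ?m2" using mm by (auto simp: fun_eq_iff)
      then show "wp I W Z0 Skip ?m1 e (\<lambda>m' e' x. wp I W Z0 cMove m' e' Q x) b"
        using rest by (intro wp_Skip) simp
    qed
  qed (use m mm a(2) small[of "Suc (acount a)"] in \<open>simp_all add: val_Rd_nat\<close>)
qed

lemma val_eAction:
  assumes ok: "ok I W m" and m: "tables m" "arm_mem m i a" "m (reg I rsel) = int i"
    and a: "arm_ok a" "prio I a \<le> B"
  shows "val m eAction = int (action I a)"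
proof -
  have mm: "m (loc I rz i 0 0) = int (apol a)" "m (loc I rsp i 0 0) = int (next_slot I a)"
    "m (loc I rcur i 0 0) = int (anode a)" using m(2) by (auto simp: arm_mem_def)
  have u: "anode a < N" using a(1) by (simp add: arm_ok_def)
  have cur: "val m (Rd1 rcur (Var rsel)) = int (anode a)" using ok m(3) mm by (simp add: val_Rd_nat)
  have br: "val m (ebridge (Rd1 rcur (Var rsel))) = of_bool (bridge I (anode a))"
    by (rule val_bridge[OF ok cur u])
  show ?thesis
  proof (cases "bridge I (anode a)")
    case True
    then show ?thesis using br ok by (simp add: eAction_def action_def)
  next
    case False
    then obtain s where s: "next_slot I a = Suc s"
      using a(2) by (auto simp: prio_le_horizon gr0_conv_Suc)
    note ns = next_slot_Suc[OF s]
    have "s < B" using ns(3) a(1) by (simp add: arm_ok_def)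
    then have "m (loc I rpol (apol a) s (anode a)) = learned I (apol a) s (anode a)"
      using m(1) ns(1) u by (simp add: tables_def)
    then show ?thesis using br ok False s ns cur mm m(3)
      by (simp add: eAction_def action_def val_Rd_nat pol_def)
  qed
qed

lemma wp_cStep:
  assumes rel: "Rel \<sigma> m e x" and el: "fst e < B"
  shows "wp I W Z0 cStep m e (\<lambda>m' e' x'. m' (reg I rt) = m (reg I rt) \<and> fst e' = Suc (fst e) \<and>
    (\<exists>\<sigma>'. Rel \<sigma>' m' e' x')) x"
proof -
  obtain k nd rw where e: "e = (k, nd, rw)" by (cases e) auto
  have tab: "tables m" and mem: "\<And>i. i < n \<Longrightarrow> arm_mem m i (\<sigma> i)" and nd: "\<And>i. i < n \<Longrightarrow> nd i =
      anode (\<sigma> i)"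
    and run: "run_ok \<sigma> k" and rw: "0 \<le> rw" and x: "x \<le> rw + Phi \<sigma>"
    using rel by (auto simp: Rel_def e)
  have k: "k < B" using el by (simp add: e)
  have aok: "\<And>i. i < n \<Longrightarrow> arm_ok (\<sigma> i)" by (rule run_okD(1)[OF run])
  let ?P = "\<lambda>m' e' x'. m' (reg I rt) = m (reg I rt) \<and> fst e' = Suc (fst e) \<and> (\<exists>\<sigma>'. Rel \<sigma>' m' e' x')"
  show ?thesis unfolding cStep_def
  proof (rule wp_Seq, rule wp_cSelect[OF mem aok])
    fix m1 b' i
    assume ag: "agree I {rbp, rsel, ri} m m1" and bp: "m1 (reg I rbp) = int b'"
        and sel: "m1 (reg I rsel) = int i"
      and min: "\<And>l. l < n \<Longrightarrow> b' \<le> prio I (\<sigma> l)" and b': "b' \<le> B \<Longrightarrow> i < n \<and> b' = prio I (\<sigma> i)"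
    have tab1: "tables m1" by (rule tables_agree[OF tab ag]) simp_all
    have mem1: "\<And>j. j < n \<Longrightarrow> arm_mem m1 j (\<sigma> j)" by (rule arm_mem_agree[OF mem ag]) simp_all
    have rt1: "m1 (reg I rt) = m (reg I rt)" by (simp add: agree_loc[OF ag])
    show "wp I W Z0 (If (Sub (Add ehorizon C1) (Var rbp))
      (Seq (Pull (Var rsel) eAction (Cell rnew C0 C0 C0)) cUpdate) Idle) m1 e ?P x"
    proof (rule wp_If)
      assume "ok I W m1" "0 < val m1 (Sub (Add ehorizon C1) (Var rbp))"
      then have "b' \<le> B" using bp by simp
      then have i: "i < n" and min: "\<And>l. l < n \<Longrightarrow> prio I (\<sigma> i) \<le> prio I (\<sigma> l)" and p: "prio I (\<sigma> i)
          \<le> B"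
        using b' min by auto
      let ?a = "\<sigma> i"
      let ?u = "anode ?a" and ?x = "action I ?a"
      have u: "?u < N" using aok[OF i] by (simp add: arm_ok_def)
      have xA: "?x < A" by (rule action_less[OF aok[OF i] p])
      have du: "depth ?u < B" by (rule run_ok_depth[OF run i p k])
      let ?X = "\<lambda>v. rw + rr I ?u ?x + Phi (\<sigma>(i := move I ?a v))"
      have b: "x \<le> (\<Sum>v<N. rp I ?u ?x v * ?X v)"
      proof -
        have "(\<Sum>v<N. rp I ?u ?x v * ?X v) = (rw + rr I ?u ?x) * (\<Sum>v<N. rp I ?u ?x v) +
            (\<Sum>v<N. rp I ?u ?x v * Phi (\<sigma>(i := move I ?a v)))"
          by (simp add: algebra_simps sum.distrib sum_distrib_left)
        also have "(\<Sum>v<N. rp I ?u ?x v) = 1" by (rule sum_rp[OF u du xA])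
        finally have eq: "(\<Sum>v<N. rp I ?u ?x v * ?X v) = (rw + rr I ?u ?x) * 1 +
            (\<Sum>v<N. rp I ?u ?x v * Phi (\<sigma>(i := move I ?a v)))" .
        show ?thesis unfolding eq mult_1_right using x Phi_move[OF run i p k] by linarith
      qed
      have cnt: "acount ?a < B"
      proof -
        have "acount ?a \<le> (\<Sum>i<n. acount (\<sigma> i))" using i by (intro member_le_sum) auto
        also have "\<dots> = k" by (rule run_okD(4)[OF run i p])
        finally show ?thesis using k by simp
      qed
      have addr: "val m1 (Cell rnew C0 C0 C0) = int (reg I rnew)" if "ok I W m1"
        by (rule val_Cell[OF that]) simp_all
      have upd: "wp I W Z0 cUpdate (m1(reg I rnew := int v)) (k + 1, nd(i := v), rw + rr I ?u ?x)
          ?P (?X v)"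
        if v: "v < N" "0 < trans I ?u ?x v" for v
      proof (rule wp_cUpdate[where i = i and a = ?a and v = v])
        fix m' assume ag': "agree I {rcnt, rsp, rcur, rpr} (m1(reg I rnew := int v)) m'"
          and others: "\<And>j x. j \<noteq> i \<Longrightarrow> arm_mem (m1(reg I rnew := int v)) j x \<Longrightarrow> arm_mem m' j x"
          and moved: "arm_mem m' i (move I ?a v)"
        have "Rel (\<sigma>(i := move I ?a v)) m' (k + 1, nd(i := v), rw + rr I ?u ?x) (?X v)"
          unfolding Rel_def
        proof (intro conjI allI impI)
          show "tables m'" by (rule tables_agree[OF _ ag']) (use tab1 in simp_all)
          show "arm_mem m' j ((\<sigma>(i := move I ?a v)) j)" if "j < n" for j
            using moved others[of j "\<sigma> j"] mem1[OF that] by simp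
          show "fst (snd (k + 1, nd(i := v), rw + rr I ?u ?x)) j = anode ((\<sigma>(i := move I ?a v))
              j)" if "j < n" for j
            using nd[OF that] by (simp add: move_def)
          show "run_ok (\<sigma>(i := move I ?a v)) (fst (k + 1, nd(i := v), rw + rr I ?u ?x))"
            using run_ok_move[OF run i min p v] by simp
          show "0 \<le> snd (snd (k + 1, nd(i := v), rw + rr I ?u ?x))"
              using rw rr_nonneg[OF u xA] by simp
        qed simp
        moreover have "m' (reg I rt) = m (reg I rt)" using rt1 by (simp add: agree_loc[OF ag'])
        ultimately show "?P m' (k + 1, nd(i := v), rw + rr I ?u ?x) (?X v)" by (auto simp: e)
      qed (use tab1 mem1[OF i] sel v aok[OF i] cnt in simp_all)
      show "wp I W Z0 (Seq (Pull (Var rsel) eAction (Cell rnew C0 C0 C0)) cUpdate) m1 e ?P x"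
        unfolding e
      proof (rule wp_Seq, rule wp_Pull[where i = i and a = ?x and X = ?X])
        show "length (encode I) \<le> nat (val m1 (Cell rnew C0 C0 C0)) \<and> val m1 (Var rsel) = int i \<and>
            val m1 eAction = int ?x"
          if "ok I W m1" using addr[OF that] sel that val_eAction[OF that tab1 mem1[OF i] sel
              aok[OF i] p] by simp
        show "i = j \<and> ?x = default I" if "j < n" "bridge I (nd j)" for j
          using run_ok_legal[OF run i min that(1)] that nd[OF that(1)] by simp
        show "0 \<le> trans I (nd i) ?x v" if "v < N" for v using trans_nonneg[OF u xA that] nd[OF i]
            by simp
        show "(\<Sum>v<N. trans I (nd i) ?x v) = 1" using depth(3)[OF u du xA] nd[OF i] by simp
        show "int N < 2 ^ W" using nat_less_W sizes by simp
        show "x \<le> (\<Sum>v<N. rp I (nd i) ?x v * ?X v)" using b nd[OF i] by simp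
      next
        fix v assume v: "v < N" "0 < trans I (nd i) ?x v"
        have cell: "nat (val m1 (Cell rnew C0 C0 C0)) = reg I rnew"
            using addr[OF \<open>ok I W m1\<close>] by simp
        show "wp I W Z0 cUpdate (m1(nat (val m1 (Cell rnew C0 C0 C0)) := int v))
            (k + 1, nd(i := v), rw + rr I (nd i) ?x)
            (\<lambda>m' e' x'. m' (reg I rt) = m (reg I rt) \<and> fst e' = Suc (fst (k, nd, rw)) \<and>
                (\<exists>\<sigma>'. Rel \<sigma>' m' e' x')) (?X v)"
          using upd[OF v(1) v(2)[unfolded nd[OF i]]] unfolding cell nd[OF i] e .
      qed (use k i xA in simp_all)
    next
      assume "ok I W m1" "\<not> 0 < val m1 (Sub (Add ehorizon C1) (Var rbp))"
      \<comment> \<open>No arm has a pull left, so idling is legal and leaves the potential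
        unchanged.\<close>
      then have idle: "B < prio I (\<sigma> l)" if "l < n" for l using min[OF that] bp by simp
      show "wp I W Z0 Idle m1 e ?P x" unfolding e
      proof (rule wp_Idle)
        show "\<not> bridge I (nd j)" if "j < n" for j using idle[OF that] nd[OF that] by (auto simp:
            prio_def)
        have "Rel \<sigma> m1 (k + 1, nd, rw) x"
          using tab1 mem1 nd run_ok_idle[OF run idle] rw x by (simp add: Rel_def)
        then show "m1 (reg I rt) = m (reg I rt) \<and> fst (k + 1, nd, rw) = Suc (fst (k, nd, rw)) \<and>
            (\<exists>\<sigma>'. Rel \<sigma>' m1 (k + 1, nd, rw) x)" using rt1 by auto
      qed (rule k)
    qed
  qed
qed

lemma Rel_upd_rt: "Rel \<sigma> m e x \<Longrightarrow> Rel \<sigma> (m(reg I rt := z)) e x"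
  by (simp add: Rel_def)

lemma wp_algorithm:
  assumes "\<And>r i j k. m (loc I r i j k) = 0"
  shows "wp I W Z0 algorithm m (0, root I, 0) (\<lambda>m' e' x. fst e' = B \<and> 0 \<le> snd (snd e') \<and> x \<le>
      snd (snd e'))
    (Pot I avg_gam (\<lambda>i. if i < n then avg_omg i else (\<lambda>k. 0)))"
  unfolding algorithm_def
proof (rule wp_Seq, rule wp_cLearn)
  show "m (loc I r i j k) = 0" for r i j k by (rule assms)
next
  fix m1 assume "\<And>k s u. k < KK I \<Longrightarrow> s < B \<Longrightarrow> u < N \<Longrightarrow> m1 (loc I rpol k s u) = learned I k s u"
    "\<And>k s u. s \<le> B \<Longrightarrow> u < N \<Longrightarrow> m1 (loc I rnx k s u) = int (nx (pol I k) s u)"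
  then have "tables m1" by (simp add: tables_def)
  let ?Q = "\<lambda>m' e' x. fst e' = B \<and> 0 \<le> snd (snd e') \<and> x \<le> snd (snd e')"
  show "wp I W Z0 (Seq cInit (For rt ehorizon cStep)) m1 (0, root I, 0) ?Q
      (Pot I avg_gam (\<lambda>i. if i < n then avg_omg i else (\<lambda>k. 0)))"
  proof (rule wp_Seq, rule wp_cInit[OF \<open>tables m1\<close>])
    fix m2 x \<sigma> assume tab: "tables m2" and st: "\<And>i. i < n \<Longrightarrow> \<exists>z. \<sigma> i = start I i z"
      and mem: "\<And>i. i < n \<Longrightarrow> arm_mem m2 i (\<sigma> i)" and x: "x \<le> Phi \<sigma>"
    have "root I i = anode (\<sigma> i)" if "i < n" for i using st[OF that] by (auto simp: start_def)
    then have rel: "Rel \<sigma> m2 (0, root I, 0) x" using tab mem x run_ok_start[OF st] by (simp add: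
        Rel_def)
    show "wp I W Z0 (For rt ehorizon cStep) m2 (0, root I, 0) ?Q x"
    proof (rule wp_For[where n = B and Inv = "\<lambda>t m e x. fst e = t \<and> (\<exists>\<sigma>. Rel \<sigma> m e x)"])
      show "B \<le> Z0" "int B < 2 ^ W" using le_Z0 nat_less_W sizes by auto
      show "fst (0, root I, 0 :: real) = 0 \<and> (\<exists>\<sigma>. Rel \<sigma> (m2(reg I rt := 0)) (0, root I, 0) x)"
        using Rel_upd_rt[OF rel] by auto
      show "val m' ehorizon = int B" if "ok I W m'" for m' using that by simp
      show "?Q m' e' x'" if "fst e' = B \<and> (\<exists>\<sigma>. Rel \<sigma> m' e' x')" for m' e' x'
        using that Phi_final by (auto simp: Rel_def) fastforce
    next
      fix t m' e' x' assume t: "t < B" and inv: "fst e' = t \<and> (\<exists>\<sigma>. Rel \<sigma> m' e' x')"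
          and r: "m' (reg I rt) = int t"
      then obtain \<sigma> where "Rel \<sigma> m' e' x'" by blast
      from wp_cStep[OF this] show "wp I W Z0 cStep m' e' (\<lambda>m'' e'' x''. m'' (reg I rt) = int t \<and>
          fst e'' = Suc t \<and> (\<exists>\<sigma>. Rel \<sigma> (m''(reg I rt := int (Suc t))) e'' x'')) x'"
        by (rule wp_mono) (use inv t r in \<open>auto intro: Rel_upd_rt simp del: of_nat_Suc\<close>)
    qed
  qed
qed

lemma algorithm_run:
  obtains p :: "(config \<times> real) pmf" where "run I algorithm = spmf_of_pmf (map_pmf fst p)"
    "finite (set_pmf p)"
    "\<And>c x. (c, x) \<in> set_pmf p \<Longrightarrow> elapsed c = B \<and> 0 \<le> reward c \<and> x \<le> reward c \<and> cost c \<le>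
        time_bound W Z0 algorithm"
    "Pot I avg_gam (\<lambda>i. if i < n then avg_omg i else (\<lambda>k. 0)) \<le> measure_pmf.expectation p snd"
proof -
  define m where "m = mem (initial I)"
  have init: "initial I = mk m 0 (0, root I, 0)" by (simp add: initial_def m_def mk_def)
  have "\<bar>encode I ! k\<bar> < 2 ^ W" if "k < length (encode I)" for k
  proof -
    have "E < 2 ^ W" by (rule E_power_less[of _ 1]) simp_all
    then have "(2::int) ^ sz \<le> 2 ^ W" using E_ge(1) by linarith
    then show ?thesis using abs_input_less[OF that] by linarith
  qed
  then have "ok I W m" by (auto simp: ok_def m_def initial_def)
  moreover have "m (loc I r i j k) = 0" for r i j k by (simp add: m_def initial_def loc_def)
  ultimately have "outcome I W (0 + time_bound W Z0 algorithm)
      (\<lambda>m' e' x. fst e' = B \<and> 0 \<le> snd (snd e') \<and> x \<le> snd (snd e'))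
      (Pot I avg_gam (\<lambda>i. if i < n then avg_omg i else (\<lambda>k. 0))) (exec I algorithm (mk m 0 (0,
          root I, 0)))"
    using wp_algorithm unfolding wp_def by blast
  then obtain p where p: "exec I algorithm (mk m 0 (0, root I, 0)) = spmf_of_pmf (map_pmf fst p)"
      "finite (set_pmf p)"
      "Pot I avg_gam (\<lambda>i. if i < n then avg_omg i else (\<lambda>k. 0)) \<le> measure_pmf.expectation p snd"
    and Q: "\<And>c x. (c, x) \<in> set_pmf p \<Longrightarrow> \<exists>m' k' e'. c = mk m' k' e' \<and> k' \<le>
        0 + time_bound W Z0 algorithm \<and>
      ok I W m' \<and> fst e' = B \<and> 0 \<le> snd (snd e') \<and> x \<le> snd (snd e')"
    unfolding outcome_def by blast
  show ?thesis
  proof (rule that[of p])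
    fix c x assume "(c, x) \<in> set_pmf p"
    from Q[OF this] obtain m' k' e' where "c = mk m' k' e'" "k' \<le> 0 + time_bound W Z0 algorithm"
      "fst e' = B" "0 \<le> snd (snd e')" "x \<le> snd (snd e')" by blast
    then show "elapsed c = B \<and> 0 \<le> reward c \<and> x \<le> reward c \<and> cost c \<le> time_bound W Z0 algorithm"
        by simp
  qed (use p init in \<open>simp_all add: run_def\<close>)
qed

lemma algorithm_reward: "1 / 12 * OPT_PolyLP I \<le> expected_reward I algorithm"
proof -
  obtain p where p: "run I algorithm = spmf_of_pmf (map_pmf fst p)" "finite (set_pmf p)"
    "\<And>c x. (c, x) \<in> set_pmf p \<Longrightarrow> elapsed c = B \<and> 0 \<le> reward c \<and> x \<le> reward c \<and> cost c \<le>
        time_bound W Z0 algorithm"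
    "Pot I avg_gam (\<lambda>i. if i < n then avg_omg i else (\<lambda>k. 0)) \<le> measure_pmf.expectation p snd"
    by (rule algorithm_run) blast
  have exp: "expected_reward I algorithm = measure_pmf.expectation p (\<lambda>cx. reward (fst cx))"
    by (simp add: expected_reward_def p(1))
  have ge0: "0 \<le> expected_reward I algorithm"
    unfolding exp using p(3) by (intro integral_nonneg_AE) (auto simp: AE_measure_pmf_iff)
  obtain L where L: "OPT_PolyLP I \<le> L" "0 \<le> L"
    "(1 - 1 / (4 * B)) * L * KK I \<le> (\<Sum>k<KK I. total (learned I k))"
    "\<And>q. q < B \<Longrightarrow> L = 0 \<or> (\<Sum>k<KK I. load (learned I k) q) \<le> (1 + 1 / (4 * B)) * KK I"
    by (rule learned_mixture) blast
  show ?thesis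
  proof (cases "L = 0")
    case True
    then show ?thesis using L(1) ge0 by simp
  next
    case False
    then have "L / 12 \<le> Pot I avg_gam (\<lambda>i. if i < n then avg_omg i else (\<lambda>k. 0))"
      using L(4) by (intro Pot_start[OF L(2,3)]) auto
    also have "\<dots> \<le> measure_pmf.expectation p snd" by (rule p(4))
    also have "\<dots> \<le> measure_pmf.expectation p (\<lambda>cx. reward (fst cx))"
      using p(2,3) by (intro integral_mono_AE integrable_measure_pmf_finite)
          (auto simp: AE_measure_pmf_iff)
    finally show ?thesis using L(1) by (simp add: exp)
  qed
qed

end

lemma algorithm_polynomial: "polynomial_time_algorithm algorithm"
proof -
  obtain q :: "nat poly" where q: "\<And>W Z X. W \<le> X \<Longrightarrow> Z \<le> X \<Longrightarrow> time_bound W Z algorithm \<le> poly q X"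
    using poly_bounded_time_bound[of algorithm] unfolding poly_bounded_def by blast
  \<comment> \<open>Dominates both \<open>Wb I\<close> and \<open>Zb I\<close> as a function of the
    input size.\<close>
  define r :: "nat poly" where "r = smult 20 ([:1, 1:] ^ 3) + smult 80 ([:1, 1:] ^ 7)"
  have r: "poly r x = 20 * (x + 1) ^ 3 + 80 * (x + 1) ^ 7" for x
    by (simp add: r_def poly_power)
  have "lossless_spmf (run I algorithm) \<and> (\<forall>c\<in>set_spmf (run I algorithm).
      elapsed c = horizon I \<and> cost c \<le> poly (pcompose q r) (input_size I))"
    if "superprocess I" for I
  proof -
    interpret superprocess_instance I by standard (rule that)
    have cube: "x * x ^ 2 = x ^ 3" for x :: nat by (simp add: power2_eq_square power3_eq_cube)
    have "Wb I = 20 * (sz + 1) ^ 3" unfolding Wb_def mult.assoc cube ..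
    then have time: "time_bound (Wb I) (Zb I) algorithm \<le> poly (pcompose q r) sz"
      unfolding poly_pcompose by (intro q) (simp_all add: r Zb_def)
    obtain p :: "(config \<times> real) pmf" where p: "run I algorithm = spmf_of_pmf (map_pmf fst p)"
      "\<And>c x. (c, x) \<in> set_pmf p \<Longrightarrow> elapsed c = B \<and> 0 \<le> reward c \<and> x \<le> reward c \<and> cost c \<le>
          time_bound W Z0 algorithm"
      by (rule algorithm_run) blast
    show ?thesis using p(2) time unfolding p(1) by (fastforce dest: order_trans)
  qed
  then show ?thesis unfolding polynomial_time_algorithm_def by blast
qed

theorem theorem11:
  shows "\<exists>P. polynomial_time_algorithm P \<and>
    (\<forall>I. superprocess I \<longrightarrow> expected_reward I P \<ge> 1/12 * OPT_PolyLP I)"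
  using algorithm_polynomial superprocess_instance.algorithm_reward superprocess_instance.intro by
      blast

end
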